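(* Assume $0<\lambda_\diamond$ and $\lambda^*<\infty$. Then for any probability density $\nu$ on $\mathbb{S}$ (with respect to $\psi$) and any probability density $\beta$ on $\mathbb{S}$ (with respect to $\psi$) such that $\beta(x)\ge\beta_*$ for all $x\in\mathbb{S}$ for some constant $\beta_*>0$, the following two statements hold: (i) $$E\left(\frac{\nu}{\beta}(X_0^\beta)\,\Big|\,Y^\beta_{[1,\infty)}\right)=\lim_{n\to\infty}E\left(\frac{\nu}{\beta}(X_0^\beta)\,\Big|\,X_n^\beta,\,Y^\beta_{[1,n]}\right)\quad\text{a.s.};$$ (ii) $$\limsup_{n\to\infty}\frac1n\log\|\pi_n^{\beta\nu}-\pi_n^{\nu}\|\le-\frac{\lambda_\diamond}{\lambda^*}\quad\text{a.s.}$$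
   Context: Signal and observation: $X=(X_n)_{n\ge0}$ is a homogeneous ergodic Markov chain with values in $\mathbb{S}\subseteq\mathbb{R}^d$, with transition kernel $K(x;dy)=\lambda(x,y)\psi(dy)$, where $\psi$ is a ($\sigma$-finite) reference measure on $\mathbb{S}$ and $\lambda\ge0$ is measurable. Its invariant probability measure is $M(dx)=m(x)\psi(dx)$. The observations $Y=(Y_n)_{n\ge1}$ take values in $\mathbb{R}^p$, and $P(Y_n\in A\mid X_{[0,n]}\vee Y_{[1,n-1]})=\int_A\Gamma(X_n;dy)$ a.s. for every Borel $A\subseteq\mathbb{R}^p$, with $\Gamma(x;dy)=\gamma(x,y)\theta(dy)$ for a ($\sigma$-finite) reference measure $\theta$ on $\mathbb{R}^p$ and measurable $\gamma\ge0$. Here $X_{[0,n]}$ and $Y_{[1,n]}$ are the $\sigma$-algebras generated by $X_0,\dots,X_n$ and by $Y_1,\dots,Y_n$. The pair $(X,Y)$ is a hidden Markov model: given the past $X_{[0,n-1]}\vee Y_{[1,n-1]}$, the conditional law of $(X_n,Y_n)$ is $K(X_{n-1};dx)\Gamma(x;dy)$. No further assumption is made on $\gamma$. Constants: $\lambda^*$ is a constant with $\lambda(x,y)\le\lambda^*$ for all $x,y$ (so "$\lambda^*<\infty$" means $\lambda$ is bounded above), and $$\lambda_\diamond=\int_{\mathbb{S}}\operatorname*{ess\,inf}_{y\in\mathbb{S}}\lambda(x,y)\,m(x)\,\psi(dx),$$ with $\operatorname{ess\,inf}$ taken with respect to $\psi$. For a probability density $\vartheta$ with respect to $\psi$, $(X^\vartheta,Y^\vartheta)$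 denotes the signal/observation pair with signal transition kernel $K(x;dy)=\lambda(x,y)\psi(dy)$, observation kernel $\Gamma(x;dy)=\gamma(x,y)\theta(dy)$, and with $X_0^\vartheta$ having density $\vartheta$; $Y^\vartheta_{[1,n]}=\sigma(Y^\vartheta_1,\dots,Y^\vartheta_n)$ and $Y^\vartheta_{[1,\infty)}=\bigvee_{n\ge1}Y^\vartheta_{[1,n]}$. We write $\frac{\nu}{\beta}(x)=\nu(x)/\beta(x)$. Filters: statement (ii) concerns the model with true initial density $\nu$, i.e. the observations are $Y_n=Y_n^\nu$. The filtering density $\pi_n^\nu(x)$ is the density with respect to $\psi$ of $P(X_n^\nu\in dx\mid Y^\nu_{[1,n]})$; it satisfies $\pi_0^\nu=\nu$ and $$\pi_n^\nu(x)=\frac{\gamma(x,Y_n)\int_{\mathbb{S}}\lambda(z,x)\pi_{n-1}^\nu(z)\psi(dz)}{\int_{\mathbb{S}}\int_{\mathbb{S}}\gamma(u,Y_n)\lambda(v,u)\pi_{n-1}^\nu(v)\psi(dv)\psi(du)},\quad n\ge1.$$ The "wrong" filtering density $\pi_n^{\beta\nu}$ is defined by the same recursion with the same observations $Y_n=Y_n^\nu$ but with $\pi_0^{\beta\nu}=\beta$ (this is a.s. well defined since $\nu\,d\psi\ll\beta\,d\psi$). Finally $\|\pi_n^{\beta\nu}-\pi_n^\nu\|=\int_{\mathbb{S}}|\pi_n^{\beta\nu}(x)-\pi_n^\nu(x)|\psi(dx)$, and $\log0=-\infty$. *)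

theory Defs
  imports "HOL-Probability.Probability"
begin

definition prob_density :: "'a measure \<Rightarrow> ('a \<Rightarrow> real) \<Rightarrow> bool" where
  "prob_density R f \<longleftrightarrow>
     f \<in> borel_measurable R \<and> (\<forall>x\<in>space R. 0 \<le> f x) \<and> (\<integral>\<^sup>+x. ennreal (f x) \<partial>R) = 1"

definition kernel_density :: "'a measure \<Rightarrow> 'b measure \<Rightarrow> ('a \<Rightarrow> 'b \<Rightarrow> real) \<Rightarrow> bool" where
  "kernel_density N R k \<longleftrightarrow>
     case_prod k \<in> borel_measurable (N \<Otimes>\<^sub>M R) \<and> (\<forall>x\<in>space N. prob_density R (k x))"

definition density_kernel :: "'b measure \<Rightarrow> ('a \<Rightarrow> 'b \<Rightarrow> real) \<Rightarrow> 'a \<Rightarrow> 'b measure" where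
  "density_kernel R k x = density R (\<lambda>y. ennreal (k x y))"

definition invariant_measure :: "('a \<Rightarrow> 'a measure) \<Rightarrow> 'a measure \<Rightarrow> bool" where
  "invariant_measure K M \<longleftrightarrow>
     (\<forall>A\<in>sets M. (\<integral>\<^sup>+x. emeasure (K x) A \<partial>M) = emeasure M A)"

text \<open>Ergodicity in the measure-theoretic sense: every almost surely invariant set is trivial.
  This is implied by the stronger notions of ergodicity in use for Markov chains, such as
  convergence of the n-step transition probabilities to \<open>M\<close> in total variation.\<close>

definition ergodic_measure :: "('a \<Rightarrow> 'a measure) \<Rightarrow> 'a measure \<Rightarrow> bool" where
  "ergodic_measure K M \<longleftrightarrow>
     prob_space M \<and> invariant_measure K M \<and>
     (\<forall>A\<in>sets M. (AE x in M. emeasure (K x) A = indicator A x) \<longrightarrow>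
        emeasure M A = 0 \<or> emeasure M A = 1)"

definition essinf :: "'a measure \<Rightarrow> ('a \<Rightarrow> ereal) \<Rightarrow> ereal" where
  "essinf R f = - esssup R (\<lambda>x. - f x)"

definition lam_diamond ::
  "'a measure \<Rightarrow> ('a \<Rightarrow> 'a \<Rightarrow> real) \<Rightarrow> ('a \<Rightarrow> real) \<Rightarrow> real" where
  "lam_diamond psi lam m =
     (\<integral>x. real_of_ereal (essinf psi (\<lambda>y. ereal (lam x y))) * m x \<partial>psi)"

text \<open>The sigma-algebra on \<open>space P\<close> generated by the variables \<open>X i\<close> for \<open>i \<in> I\<close> and \<open>Y j\<close>
  for \<open>j \<in> J\<close>, as a measure on which only the sigma-algebra matters.\<close>

definition sigma_XY ::
  "'w measure \<Rightarrow> 'a measure \<Rightarrow> 'b measure \<Rightarrow> (nat \<Rightarrow> 'w \<Rightarrow> 'a) \<Rightarrow> (nat \<Rightarrow> 'w \<Rightarrow> 'b) \<Rightarrow>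
     nat set \<Rightarrow> nat set \<Rightarrow> 'w measure" where
  "sigma_XY P N R X Y I J = sigma (space P)
     ({X i -` A \<inter> space P | i A. i \<in> I \<and> A \<in> sets N} \<union>
      {Y j -` B \<inter> space P | j B. j \<in> J \<and> B \<in> sets R})"

text \<open>The observations are \<open>Y 1, Y 2, \<dots>\<close>; the value of \<open>Y 0\<close> is never used. The conditional law of
  \<open>(X n, Y n)\<close> given the past is prescribed on rectangles \<open>A \<times> B\<close>, which determine it.\<close>

definition hidden_markov ::
  "'a measure \<Rightarrow> 'b measure \<Rightarrow> ('a \<Rightarrow> 'a measure) \<Rightarrow> ('a \<Rightarrow> 'b measure) \<Rightarrow> ('a \<Rightarrow> real) \<Rightarrow>
     'w measure \<Rightarrow> (nat \<Rightarrow> 'w \<Rightarrow> 'a) \<Rightarrow> (nat \<Rightarrow> 'w \<Rightarrow> 'b) \<Rightarrow> bool" where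
  "hidden_markov psi theta K G init P X Y \<longleftrightarrow>
     prob_space P \<and>
     (\<forall>n. X n \<in> measurable P psi) \<and>
     (\<forall>n\<ge>1. Y n \<in> measurable P theta) \<and>
     distr P psi (X 0) = density psi (\<lambda>x. ennreal (init x)) \<and>
     (\<forall>n\<ge>1. \<forall>A\<in>sets psi. \<forall>B\<in>sets theta. AE w in P.
        nn_cond_exp P (sigma_XY P psi theta X Y {0..n-1} {1..n-1})
          (indicator {w \<in> space P. X n w \<in> A \<and> Y n w \<in> B}) w =
        (\<integral>\<^sup>+u\<in>A. emeasure (G u) B \<partial>K (X (n-1) w)))"

text \<open>\<open>p n w\<close> is a version of the conditional density of \<open>X n\<close> given \<open>Y 1, \<dots>, Y n\<close> at the
  outcome \<open>w\<close>.\<close>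

definition filtering_density ::
  "'a measure \<Rightarrow> 'b measure \<Rightarrow> 'w measure \<Rightarrow> (nat \<Rightarrow> 'w \<Rightarrow> 'a) \<Rightarrow> (nat \<Rightarrow> 'w \<Rightarrow> 'b) \<Rightarrow>
     (nat \<Rightarrow> 'w \<Rightarrow> 'a \<Rightarrow> real) \<Rightarrow> bool" where
  "filtering_density psi theta P X Y p \<longleftrightarrow>
     (\<forall>n. case_prod (p n) \<in> borel_measurable (sigma_XY P psi theta X Y {} {1..n} \<Otimes>\<^sub>M psi)) \<and>
     (\<forall>n. \<forall>w\<in>space P. \<forall>x\<in>space psi. 0 \<le> p n w x) \<and>
     (\<forall>n. \<forall>A\<in>sets psi. AE w in P.
        nn_cond_exp P (sigma_XY P psi theta X Y {} {1..n})
          (indicator {w \<in> space P. X n w \<in> A}) w =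
        emeasure (density psi (\<lambda>x. ennreal (p n w x))) A)"

text \<open>The filtering recursion started from the density \<open>init\<close> and driven by \<open>y 1, y 2, \<dots>\<close>. For
  exceptional \<open>y\<close> the denominator may vanish or diverge; the quotient is then \<open>0\<close>.\<close>

primrec filter_rec ::
  "'a measure \<Rightarrow> ('a \<Rightarrow> 'a \<Rightarrow> real) \<Rightarrow> ('a \<Rightarrow> 'b \<Rightarrow> real) \<Rightarrow> ('a \<Rightarrow> real) \<Rightarrow> (nat \<Rightarrow> 'b) \<Rightarrow>
     nat \<Rightarrow> 'a \<Rightarrow> real" where
  "filter_rec psi lam gam init y 0 = init"
| "filter_rec psi lam gam init y (Suc n) = (\<lambda>x.
     gam x (y (Suc n)) * (\<integral>z. lam z x * filter_rec psi lam gam init y n z \<partial>psi) /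
     (\<integral>u. (\<integral>v. gam u (y (Suc n)) * lam v u * filter_rec psi lam gam init y n v \<partial>psi) \<partial>psi))"

definition L1_dist :: "'a measure \<Rightarrow> ('a \<Rightarrow> real) \<Rightarrow> ('a \<Rightarrow> real) \<Rightarrow> ennreal" where
  "L1_dist R f g = (\<integral>\<^sup>+x. ennreal \<bar>f x - g x\<bar> \<partial>R)"

definition elog :: "ennreal \<Rightarrow> ereal" where
  "elog a = (if a = 0 then -\<infinity> else if a = \<infinity> then \<infinity> else ereal (ln (enn2real a)))"

end

theory Submission
  imports Defs "HOL-Library.Discrete_Functions"
begin

text \<open>
  The proof compares two filters along one observation path and shows that their ratio becomes
  constant at an exponential rate; both statements follow from that comparison. Write \<open>b x\<close> for
  the essential infimum of \<open>lam x\<close>, \<open>L\<close> for the bound of \<open>lam\<close>, \<open>c\<close> for \<open>\<integral>b m\<close>, and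
  \<open>predict h x = \<integral>lam z x h z\<close>.

  \<^emph>\<open>Contraction.\<close> Let \<open>f\<close> be the filter started from the true initial density. Let \<open>g\<close> be
  started from another density and updated with the same likelihoods and the normalising constants
  of \<open>f\<close>, so that it is a multiple of the other filter. Suppose \<open>i f \<le> g \<le> s f\<close>. The prediction of
  \<open>g - i f \<ge> 0\<close> is at least the constant \<open>\<integral>b (g - i f)\<close>, and the prediction of the density \<open>f\<close> is at
  most \<open>L\<close>. Hence after one step \<open>i\<close> may be raised by \<open>\<integral>b (g - i f) / L\<close>, and symmetrically \<open>s\<close>
  may be lowered by \<open>\<integral>b (s f - g) / L\<close>. The likelihood multiplies \<open>f\<close> and \<open>g\<close> alike and
  leaves the bounds unchanged, and the gap \<open>s - i\<close> is multiplied by \<open>1 - \<integral>b f / L\<close>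
  (\<open>relax_diff\<close>). Finite bounds are available one step after a time at which \<open>\<integral>b f > 0\<close>
  (\<open>entry_upper\<close>, \<open>entry_lower\<close>).

  \<^emph>\<open>Law of large numbers.\<close> It remains to see that the averages of \<open>\<integral>b f\<close> over time have lower limit
  at least \<open>c\<close>. Since \<open>lam x y \<ge> b x\<close>, the chain regenerates from the measure \<open>psi\<close> with intensity
  \<open>b\<close>. By invariance of \<open>m\<close>, the expected number of steps until regeneration, integrated over the
  initial state with respect to \<open>psi\<close>, is at most \<open>1 / c\<close>. This yields, for every \<open>e > 0\<close>, a bounded
  function \<open>t\<close> and \<open>k \<le> 1 / c\<close> with \<open>1 - e - t + K t \<le> k b\<close>, where \<open>K\<close> is the transition operator (\<open>poisson_inequality\<close>). Integrated
  against the filter and summed over time, \<open>K t - t\<close> contributes a bounded term and a sum of bounded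
  martingale differences, and the latter is negligible by a second moment argument
  (\<open>orthogonal_averages_tendsto_0\<close>). This proves \<open>filtered_b_average\<close>.

  \<^emph>\<open>Conclusion.\<close> For the second statement, the true initial density is \<open>nu\<close> and \<open>g\<close> starts from \<open>beta\<close>.
  As \<open>beta > 0\<close>, \<open>g\<close> charges whatever \<open>f\<close> charges, so the lower bound at the entry time is
  positive, and the \<open>L\<^sup>1\<close> distance is at most a constant times \<open>s - i\<close>. For the first statement, the
  true initial density is \<open>beta\<close> and \<open>g\<close> starts from \<open>nu\<close>. Then \<open>g / f\<close> at the current signal is the
  conditional expectation of \<open>nu / beta\<close> of the initial signal given the observations and the
  current signal. It lies in the nested intervals \<open>[i, s]\<close>, which depend on the observations only
  and shrink to a point; bounded convergence identifies that point as the conditional expectation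
  given all observations.

  The recursion is linked to the hidden Markov model by \<open>joint_density\<close>: the recursively
  defined functions are densities of the current signal relative to the observed past.
\<close>

section \<open>Prediction with a minorized bounded kernel\<close>

text \<open>The minorant \<open>b\<close> is any measurable function below the essential infimum of the transition
  density; later it is a measurable version of that infimum.\<close>

locale minorized_kernel = finite_measure psi
  for psi :: "'a measure" +
  fixes lam :: "'a \<Rightarrow> 'a \<Rightarrow> real" and L :: real and b :: "'a \<Rightarrow> real"
  assumes kernel: "kernel_density psi psi lam"
    and lam_le: "\<And>x y. x \<in> space psi \<Longrightarrow> y \<in> space psi \<Longrightarrow> lam x y \<le> L"
    and b_measurable [measurable]: "b \<in> borel_measurable psi"
    and b_nonneg: "\<And>x. x \<in> space psi \<Longrightarrow> 0 \<le> b x"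
    and b_le_lam: "\<And>x. x \<in> space psi \<Longrightarrow> AE y in psi. b x \<le> lam x y"
    and space_ne: "space psi \<noteq> {}"
begin

definition nonneg_integrable :: "('a \<Rightarrow> real) \<Rightarrow> bool" where
  "nonneg_integrable h \<longleftrightarrow> integrable psi h \<and> (\<forall>x\<in>space psi. 0 \<le> h x)"

definition predict :: "('a \<Rightarrow> real) \<Rightarrow> 'a \<Rightarrow> real" where
  "predict h x = (\<integral>z. lam z x * h z \<partial>psi)"

lemma lam_measurable [measurable]: "case_prod lam \<in> borel_measurable (psi \<Otimes>\<^sub>M psi)"
  using kernel by (simp add: kernel_density_def)

lemma lam_nonneg: "x \<in> space psi \<Longrightarrow> y \<in> space psi \<Longrightarrow> 0 \<le> lam x y"
  using kernel by (auto simp: kernel_density_def prob_density_def)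

lemma nn_integral_lam: "x \<in> space psi \<Longrightarrow> (\<integral>\<^sup>+y. ennreal (lam x y) \<partial>psi) = 1"
  using kernel by (auto simp: kernel_density_def prob_density_def)

lemma psi_nontrivial: "\<not> (AE y in psi. False)"
proof
  assume *: "AE y in psi. False"
  obtain x where x: "x \<in> space psi" using space_ne by blast
  have "(\<integral>\<^sup>+y. ennreal (lam x y) \<partial>psi) = (\<integral>\<^sup>+y. 0 \<partial>psi)"
    using * by (intro nn_integral_cong_AE) auto
  with nn_integral_lam[OF x] show False by simp
qed

lemma b_le_L: assumes "x \<in> space psi" shows "b x \<le> L"
proof (rule ccontr)
  assume "\<not> b x \<le> L"
  have "AE y in psi. b x \<le> lam x y \<and> y \<in> space psi"
    using b_le_lam[OF assms] AE_space by eventually_elim simp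
  then have "AE y in psi. False"
    by (rule eventually_mono) (use lam_le[OF assms] \<open>\<not> b x \<le> L\<close> in force)
  then show False using psi_nontrivial by simp
qed

lemma L_pos: "0 < L"
proof (rule ccontr)
  assume neg: "\<not> 0 < L"
  obtain x where x: "x \<in> space psi" using space_ne by blast
  have "(\<integral>\<^sup>+y. ennreal (lam x y) \<partial>psi) = (\<integral>\<^sup>+y. 0 \<partial>psi)"
  proof (intro nn_integral_cong)
    fix y assume "y \<in> space psi"
    then have "lam x y \<le> 0" using lam_le[OF x, of y] neg by simp
    then show "ennreal (lam x y) = 0" by (simp add: ennreal_neg)
  qed
  with nn_integral_lam[OF x] show False by simp
qed

lemma lam_section [measurable]:
  assumes "x \<in> space psi"
  shows "(\<lambda>z. lam z x) \<in> borel_measurable psi" "(\<lambda>z. lam x z) \<in> borel_measurable psi"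
  using measurable_compose_Pair1 measurable_Pair2[OF lam_measurable assms]
    measurable_Pair1[OF lam_measurable assms] by auto

lemma integrable_lam_mult:
  assumes "integrable psi h" "x \<in> space psi"
  shows "integrable psi (\<lambda>z. lam z x * h z)"
proof (rule Bochner_Integration.integrable_bound)
  show "integrable psi (\<lambda>z. L * h z)" using assms by simp
  show "(\<lambda>z. lam z x * h z) \<in> borel_measurable psi"
    using assms lam_section by auto
  show "AE z in psi. norm (lam z x * h z) \<le> norm (L * h z)"
    using assms(2) lam_nonneg lam_le by (auto simp: abs_mult intro!: AE_I2 mult_right_mono)
      (metis abs_of_nonneg abs_ge_self order_trans)
qed

lemma integrable_b_mult:
  assumes "integrable psi h" shows "integrable psi (\<lambda>z. b z * h z)"
proof (rule Bochner_Integration.integrable_bound)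
  show "integrable psi (\<lambda>z. L * h z)" using assms by simp
  show "(\<lambda>z. b z * h z) \<in> borel_measurable psi" using assms by auto
  show "AE z in psi. norm (b z * h z) \<le> norm (L * h z)"
    using b_nonneg b_le_L by (auto simp: abs_mult intro!: AE_I2 mult_right_mono)
      (metis abs_of_nonneg abs_ge_self order_trans)
qed

lemma predict_measurable [measurable]:
  assumes [measurable]: "h \<in> borel_measurable psi"
  shows "predict h \<in> borel_measurable psi"
  unfolding predict_def by measurable

lemma predict_nonneg:
  "(\<And>z. z \<in> space psi \<Longrightarrow> 0 \<le> h z) \<Longrightarrow> x \<in> space psi \<Longrightarrow> 0 \<le> predict h x"
  unfolding predict_def using lam_nonneg by (intro integral_nonneg_AE AE_I2) auto

lemma predict_le:
  assumes "nonneg_integrable h" "x \<in> space psi"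
  shows "predict h x \<le> L * (\<integral>z. h z \<partial>psi)"
proof -
  have "predict h x \<le> (\<integral>z. L * h z \<partial>psi)"
    unfolding predict_def
    using assms lam_le by (intro integral_mono integrable_lam_mult)
      (auto simp: nonneg_integrable_def intro!: mult_right_mono)
  then show ?thesis by simp
qed

text \<open>The minorization holds for almost every target point for each fixed source point. By
  Fubini it also holds for almost every source point for almost every fixed target point, which
  is the direction that prediction integrates over.\<close>

lemma b_le_lam_swapped: "AE x in psi. AE z in psi. b z \<le> lam z x"
proof -
  interpret pair_sigma_finite psi psi by standard
  show ?thesis
  proof (rule AE_commute[THEN iffD1])
    show "{x \<in> space (psi \<Otimes>\<^sub>M psi). b (fst x) \<le> lam (fst x) (snd x)} \<in> sets (psi \<Otimes>\<^sub>M psi)"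
      by measurable
    show "AE x in psi. AE y in psi. b x \<le> lam x y" using b_le_lam by (rule AE_I2)
  qed
qed

lemma predict_ge:
  assumes "integrable psi h" "AE z in psi. 0 \<le> h z"
  shows "AE x in psi. (\<integral>z. b z * h z \<partial>psi) \<le> predict h x"
  using b_le_lam_swapped AE_space
proof eventually_elim
  fix x assume x: "AE z in psi. b z \<le> lam z x" "x \<in> space psi"
  show "(\<integral>z. b z * h z \<partial>psi) \<le> predict h x"
    unfolding predict_def
  proof (rule integral_mono_AE)
    show "AE z in psi. b z * h z \<le> lam z x * h z"
      using x(1) assms(2) by eventually_elim (rule mult_right_mono)
  qed (use assms x integrable_lam_mult integrable_b_mult in auto)
qed

lemma predict_linear:
  assumes "integrable psi g" "integrable psi f" "x \<in> space psi"
  shows "predict (\<lambda>z. g z - c * f z) x = predict g x - c * predict f x"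
proof -
  have "predict (\<lambda>z. g z - c * f z) x = (\<integral>z. lam z x * g z - c * (lam z x * f z) \<partial>psi)"
    unfolding predict_def by (intro Bochner_Integration.integral_cong) (auto simp: algebra_simps)
  also have "\<dots> = predict g x - c * predict f x"
    unfolding predict_def using assms integrable_lam_mult by (subst Bochner_Integration.integral_diff) auto
  finally show ?thesis .
qed

text \<open>The heart of the contraction. Write \<open>g = i f + h\<close> with \<open>h \<ge> 0\<close>. Prediction turns \<open>h\<close> into
  something bounded below by the constant \<open>\<integral>b h\<close>, whereas the prediction of the density \<open>f\<close> is at
  most \<open>L\<close>; so the remainder contributes at least \<open>\<integral>b h / L\<close> multiples of \<open>predict f\<close>.\<close>

lemma predict_lower_bound_improves:
  assumes f: "nonneg_integrable f" "(\<integral>z. f z \<partial>psi) = 1" and g: "integrable psi g"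
    and le: "AE x in psi. i * f x \<le> g x"
  shows "AE x in psi. (i + (\<integral>z. b z * (g z - i * f z) \<partial>psi) / L) * predict f x \<le> predict g x"
proof -
  let ?h = "\<lambda>z. g z - i * f z"
  let ?A = "\<integral>z. b z * ?h z \<partial>psi"
  have f': "integrable psi f" using f by (simp add: nonneg_integrable_def)
  have "AE z in psi. 0 \<le> ?h z" using le by simp
  have A: "0 \<le> ?A"
    using le AE_space
    by (intro integral_nonneg_AE, eventually_elim) (simp add: b_nonneg)
  have "AE x in psi. ?A \<le> predict ?h x"
    using f' g \<open>AE z in psi. 0 \<le> ?h z\<close> by (intro predict_ge) auto
  then show ?thesis using AE_space
  proof eventually_elim
    fix x assume *: "?A \<le> predict ?h x" and x: "x \<in> space psi"
    have "predict f x \<le> L" using predict_le[OF f(1) x] f(2) by simp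
    then have "?A / L * predict f x \<le> ?A / L * L"
      using A L_pos by (intro mult_left_mono) auto
    also have "\<dots> = ?A" using L_pos by simp
    finally have "?A / L * predict f x \<le> ?A" .
    then show "(i + ?A / L) * predict f x \<le> predict g x"
      using * predict_linear[OF g f' x, of i] by (simp add: algebra_simps)
  qed
qed

lemma predict_upper_bound_improves:
  assumes f: "nonneg_integrable f" "(\<integral>z. f z \<partial>psi) = 1" and g: "integrable psi g"
    and le: "AE x in psi. g x \<le> s * f x"
  shows "AE x in psi. predict g x \<le> (s + (\<integral>z. b z * (g z - s * f z) \<partial>psi) / L) * predict f x"
proof -
  have "AE x in psi. ((- s) + (\<integral>z. b z * ((- g z) - (- s) * f z) \<partial>psi) / L) * predict f x
      \<le> predict (\<lambda>z. - g z) x"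
    using le by (intro predict_lower_bound_improves f) (use g in auto)
  moreover have "(\<integral>z. b z * ((- g z) - (- s) * f z) \<partial>psi) = - (\<integral>z. b z * (g z - s * f z) \<partial>psi)"
    by (subst Bochner_Integration.integral_minus[symmetric])
      (auto intro!: Bochner_Integration.integral_cong simp: algebra_simps)
  moreover have "predict (\<lambda>z. - g z) x = - predict g x" for x
    by (simp add: predict_def)
  ultimately show ?thesis by (simp add: algebra_simps)
qed

text \<open>Supports propagate through prediction: if \<open>predict f x = 0\<close>, then \<open>lam z x * f z\<close> vanishes
  for almost every \<open>z\<close>, and so does \<open>lam z x * g z\<close>.\<close>

lemma predict_zero_mono:
  assumes f: "nonneg_integrable f" and g: "nonneg_integrable g"
    and dom: "AE z in psi. f z = 0 \<longrightarrow> g z = 0"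
    and x: "x \<in> space psi" and zero: "predict f x = 0"
  shows "predict g x = 0"
proof -
  have "AE z in psi. lam z x * f z = 0"
    using integral_nonneg_eq_0_iff_AE[of psi "\<lambda>z. lam z x * f z"] integrable_lam_mult[of f x]
      f x zero lam_nonneg unfolding predict_def nonneg_integrable_def by auto
  then have "AE z in psi. lam z x * g z = 0"
    using dom by eventually_elim auto
  then show ?thesis unfolding predict_def
    by (simp add: integral_eq_zero_AE)
qed

lemma b_integral_zero_mono:
  assumes f: "nonneg_integrable f" and g: "nonneg_integrable g"
    and dom: "AE z in psi. g z = 0 \<longrightarrow> f z = 0" and pos: "0 < (\<integral>z. b z * f z \<partial>psi)"
  shows "0 < (\<integral>z. b z * g z \<partial>psi)"
proof (rule ccontr)
  have nn: "0 \<le> (\<integral>z. b z * g z \<partial>psi)"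
    using g b_nonneg by (intro integral_nonneg_AE AE_I2) (auto simp: nonneg_integrable_def)
  assume "\<not> 0 < (\<integral>z. b z * g z \<partial>psi)"
  then have "(\<integral>z. b z * g z \<partial>psi) = 0" using nn by simp
  then have "AE z in psi. b z * g z = 0"
    using integral_nonneg_eq_0_iff_AE[of psi "\<lambda>z. b z * g z"] integrable_b_mult[of g] g b_nonneg
    unfolding nonneg_integrable_def by auto
  then have "AE z in psi. b z * f z = 0"
    using dom by eventually_elim auto
  then have "(\<integral>z. b z * f z \<partial>psi) = 0" by (simp add: integral_eq_zero_AE)
  with pos show False by simp
qed

text \<open>One recursion serves both sides: from a lower bound of \<open>G 0 / F 0\<close> the integrand is nonnegative
  and the sequence increases, from an upper bound it decreases.\<close>

primrec ratio_bound :: "(nat \<Rightarrow> 'a \<Rightarrow> real) \<Rightarrow> (nat \<Rightarrow> 'a \<Rightarrow> real) \<Rightarrow> real \<Rightarrow> nat \<Rightarrow> real" where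
  "ratio_bound F G c 0 = c"
| "ratio_bound F G c (Suc n) = ratio_bound F G c n
     + (\<integral>z. b z * (G n z - ratio_bound F G c n * F n z) \<partial>psi) / L"

end

section \<open>Two filters driven by the same observation path\<close>

text \<open>The weight \<open>w n\<close> stands for the likelihood of the next observation divided by the normalising
  constant of \<open>F\<close>. The same weight acts on \<open>G\<close>, which therefore need not have integral one.\<close>

locale coupled_filters = minorized_kernel psi lam L b
  for psi :: "'a measure" and lam L b +
  fixes F G :: "nat \<Rightarrow> 'a \<Rightarrow> real" and w :: "nat \<Rightarrow> 'a \<Rightarrow> real"
  assumes F: "\<And>n. nonneg_integrable (F n)" "\<And>n. (\<integral>x. F n x \<partial>psi) = 1"
    and G: "\<And>n. nonneg_integrable (G n)"
    and F_Suc: "\<And>n x. x \<in> space psi \<Longrightarrow> F (Suc n) x = w n x * predict (F n) x"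
    and G_Suc: "\<And>n x. x \<in> space psi \<Longrightarrow> G (Suc n) x = w n x * predict (G n) x"
    and w_nonneg: "\<And>n x. x \<in> space psi \<Longrightarrow> 0 \<le> w n x"
begin

abbreviation relax :: "real \<Rightarrow> nat \<Rightarrow> real" where
  "relax \<equiv> ratio_bound F G"

lemma F_int: "integrable psi (F n)" and G_int: "integrable psi (G n)"
  and F_nn: "x \<in> space psi \<Longrightarrow> 0 \<le> F n x" and G_nn: "x \<in> space psi \<Longrightarrow> 0 \<le> G n x"
  using F G by (auto simp: nonneg_integrable_def)

lemma relax_lower:
  assumes "AE x in psi. i * F 0 x \<le> G 0 x"
  shows "AE x in psi. relax i n * F n x \<le> G n x"
proof (induction n)
  case 0 then show ?case using assms by simp
next
  case (Suc n)
  from predict_lower_bound_improves[OF F G_int Suc]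
  show ?case using AE_space
  proof eventually_elim
    case (elim x)
    then show ?case using mult_left_mono[OF elim(1) w_nonneg[OF elim(2), of n]]
      by (simp add: F_Suc G_Suc algebra_simps)
  qed
qed

lemma relax_upper:
  assumes "AE x in psi. G 0 x \<le> s * F 0 x"
  shows "AE x in psi. G n x \<le> relax s n * F n x"
proof (induction n)
  case 0 then show ?case using assms by simp
next
  case (Suc n)
  from predict_upper_bound_improves[OF F G_int Suc]
  show ?case using AE_space
  proof eventually_elim
    case (elim x)
    then show ?case using mult_left_mono[OF elim(1) w_nonneg[OF elim(2), of n]]
      by (simp add: F_Suc G_Suc algebra_simps)
  qed
qed

lemma relax_lower_Suc:
  assumes "AE x in psi. i * F 0 x \<le> G 0 x"
  shows "relax i n \<le> relax i (Suc n)"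
proof -
  have "0 \<le> (\<integral>z. b z * (G n z - relax i n * F n z) \<partial>psi)"
    using relax_lower[OF assms, of n] AE_space
    by (intro integral_nonneg_AE, eventually_elim) (simp add: b_nonneg)
  then show ?thesis using L_pos by simp
qed

lemma relax_upper_Suc:
  assumes "AE x in psi. G 0 x \<le> s * F 0 x"
  shows "relax s (Suc n) \<le> relax s n"
proof -
  have "0 \<le> (\<integral>z. - (b z * (G n z - relax s n * F n z)) \<partial>psi)"
    using relax_upper[OF assms, of n] AE_space
    by (intro integral_nonneg_AE, eventually_elim) (auto intro!: mult_nonneg_nonpos b_nonneg)
  then show ?thesis using L_pos by (simp add: divide_le_0_iff)
qed

text \<open>The mass that the filter gives to \<open>b\<close>; it is the rate of contraction, up to the factor \<open>L\<close>.\<close>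

definition mass :: "nat \<Rightarrow> real" where "mass n = (\<integral>z. b z * F n z \<partial>psi)"

lemma mass_nonneg: "0 \<le> mass n"
  unfolding mass_def using F_nn b_nonneg by (intro integral_nonneg_AE AE_I2) auto

lemma mass_le: "mass n \<le> L"
proof -
  have "mass n \<le> (\<integral>z. L * F n z \<partial>psi)"
    unfolding mass_def using F_int F_nn b_le_L integrable_b_mult
    by (intro integral_mono) (auto intro!: mult_right_mono)
  then show ?thesis using F(2) by simp
qed

text \<open>Subtracting the two recursions, the terms with \<open>G\<close> cancel.\<close>

lemma relax_diff: "relax s n - relax i n = (s - i) * (\<Prod>k<n. 1 - mass k / L)"
proof (induction n)
  case (Suc n)
  have *: "(\<integral>z. b z * (G n z - c * F n z) \<partial>psi) = (\<integral>z. b z * G n z \<partial>psi) - c * mass n" for c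
  proof -
    have "(\<integral>z. b z * (G n z - c * F n z) \<partial>psi) = (\<integral>z. b z * G n z - c * (b z * F n z) \<partial>psi)"
      by (intro Bochner_Integration.integral_cong) (auto simp: algebra_simps)
    then show ?thesis unfolding mass_def
      using integrable_b_mult[OF F_int] integrable_b_mult[OF G_int]
      by (subst (asm) Bochner_Integration.integral_diff) auto
  qed
  have "relax s (Suc n) - relax i (Suc n) = (relax s n - relax i n) * (1 - mass n / L)"
    unfolding ratio_bound.simps * using L_pos by (simp add: field_simps)
  then show ?case using Suc by simp
qed simp

lemma relax_diff_le:
  assumes "i \<le> s"
  shows "relax s n - relax i n \<le> (s - i) * exp (- (\<Sum>k<n. mass k) / L)"
proof -
  have "(\<Prod>k<n. 1 - mass k / L) \<le> (\<Prod>k<n. exp (- (mass k / L)))"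
  proof (intro prod_mono conjI)
    fix k show "0 \<le> 1 - mass k / L" using mass_le[of k] L_pos by simp
    show "1 - mass k / L \<le> exp (- (mass k / L))"
      using exp_ge_add_one_self[of "- (mass k / L)"] by simp
  qed
  also have "\<dots> = exp (- (\<Sum>k<n. mass k) / L)"
    by (simp add: exp_sum[symmetric] sum_negf sum_divide_distrib)
  finally show ?thesis unfolding relax_diff using assms by (intro mult_left_mono) auto
qed

lemma relax_diff_nonneg: "i \<le> s \<Longrightarrow> relax i n \<le> relax s n"
  using mass_le L_pos relax_diff[of s n i]
  by (smt (verit, best) divide_le_eq_1 mult_nonneg_nonneg prod_nonneg)

text \<open>One step after a time at which the filter charges \<open>b\<close>, the two filters are comparable,
  whatever they were before: the prediction of \<open>F 0\<close> lies between \<open>mass 0\<close> and \<open>L\<close>, that of \<open>G 0\<close>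
  between \<open>\<integral>b (G 0)\<close> and \<open>L \<integral>G 0\<close>.\<close>

lemma entry_upper:
  assumes "0 < mass 0"
  shows "AE x in psi. G 1 x \<le> (L * (\<integral>z. G 0 z \<partial>psi) / mass 0) * F 1 x"
proof -
  have "AE x in psi. mass 0 \<le> predict (F 0) x"
    unfolding mass_def using F_nn by (intro predict_ge F_int AE_I2) auto
  then show ?thesis using AE_space
  proof eventually_elim
  case (elim x)
  let ?I = "L * (\<integral>z. G 0 z \<partial>psi)"
  have I: "0 \<le> ?I"
    using G_nn L_pos by (intro mult_nonneg_nonneg integral_nonneg_AE AE_I2) auto
  have "predict (G 0) x \<le> ?I / mass 0 * mass 0"
    using predict_le[OF G elim(2), of 0] assms by simp
  also have "\<dots> \<le> ?I / mass 0 * predict (F 0) x"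
    using elim I assms by (intro mult_left_mono) auto
  finally have "w 0 x * predict (G 0) x \<le> w 0 x * (?I / mass 0 * predict (F 0) x)"
    by (intro mult_left_mono w_nonneg elim)
  then show ?case using elim(2) by (simp add: F_Suc G_Suc algebra_simps)
  qed
qed

lemma entry_lower:
  "AE x in psi. ((\<integral>z. b z * G 0 z \<partial>psi) / L) * F 1 x \<le> G 1 x"
proof -
  have "AE x in psi. (0 + (\<integral>z. b z * (G 0 z - 0 * F 0 z) \<partial>psi) / L) * predict (F 0) x \<le> predict (G 0) x"
    by (rule predict_lower_bound_improves[OF F G_int]) (auto simp: G_nn)
  then show ?thesis using AE_space
  proof eventually_elim
    case (elim x)
    show ?case using mult_left_mono[OF elim(1) w_nonneg[OF elim(2), of 0]] elim(2)
      by (simp add: F_Suc G_Suc algebra_simps)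
  qed
qed

lemma G_dominated:
  assumes "AE x in psi. F 0 x = 0 \<longrightarrow> G 0 x = 0"
  shows "AE x in psi. F n x = 0 \<longrightarrow> G n x = 0"
proof (induction n)
  case (Suc n)
  show ?case
  proof (intro AE_I2 impI)
    fix x assume x: "x \<in> space psi" "F (Suc n) x = 0"
    then show "G (Suc n) x = 0"
      using predict_zero_mono[OF F(1) G Suc x(1)] by (auto simp: F_Suc G_Suc)
  qed
qed (use assms in simp)

lemma F_dominated:
  assumes "AE x in psi. G 0 x = 0 \<longrightarrow> F 0 x = 0"
  shows "AE x in psi. G n x = 0 \<longrightarrow> F n x = 0"
proof (induction n)
  case (Suc n)
  show ?case
  proof (intro AE_I2 impI)
    fix x assume x: "x \<in> space psi" "G (Suc n) x = 0"
    then show "F (Suc n) x = 0"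
      using predict_zero_mono[OF G F(1) Suc x(1)] by (auto simp: F_Suc G_Suc)
  qed
qed (use assms in simp)

lemma shifted: "coupled_filters psi lam L b (\<lambda>n. F (n + N)) (\<lambda>n. G (n + N)) (\<lambda>n. w (n + N))"
  by unfold_locales (auto simp: F F_Suc G G_Suc w_nonneg)

end

text \<open>The constant \<open>c = \<integral>G\<close> also lies between \<open>lo\<close> and \<open>hi\<close>, so \<open>\<bar>G - c F\<bar> \<le> (hi - lo) F\<close>, and
  division by \<open>c \<ge> lo\<close> gives the claim.\<close>

lemma L1_dist_normalised_le:
  assumes F: "integrable R F" "(\<integral>x. F x \<partial>R) = 1" "\<And>x. x \<in> space R \<Longrightarrow> 0 \<le> F x"
    and G: "integrable R G"
    and lo: "AE x in R. lo * F x \<le> G x" and hi: "AE x in R. G x \<le> hi * F x" and pos: "0 < lo"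
  shows "L1_dist R (\<lambda>x. G x / (\<integral>x. G x \<partial>R)) F \<le> ennreal ((hi - lo) / lo)"
proof -
  define c where "c = (\<integral>x. G x \<partial>R)"
  have "(\<integral>x. lo * F x \<partial>R) \<le> c" unfolding c_def
    by (rule integral_mono_AE) (use F G lo in auto)
  moreover have "c \<le> (\<integral>x. hi * F x \<partial>R)" unfolding c_def
    by (rule integral_mono_AE) (use F G hi in auto)
  ultimately have c: "lo \<le> c" "c \<le> hi" using F by auto
  have "L1_dist R (\<lambda>x. G x / c) F \<le> (\<integral>\<^sup>+x. ennreal ((hi - lo) / lo * F x) \<partial>R)"
    unfolding L1_dist_def
  proof (rule nn_integral_mono_AE)
    show "AE x in R. ennreal \<bar>G x / c - F x\<bar> \<le> ennreal ((hi - lo) / lo * F x)"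
      using lo hi AE_space
    proof eventually_elim
      case (elim x)
      have F0: "0 \<le> F x" using F elim by auto
      have "\<bar>G x - c * F x\<bar> \<le> (hi - lo) * F x"
        using elim c F0 mult_right_mono[OF c(1) F0] mult_right_mono[OF c(2) F0]
        by (auto simp: abs_le_iff algebra_simps)
      then have "\<bar>G x - c * F x\<bar> / c \<le> (hi - lo) * F x / lo"
        using c pos F0 by (intro frac_le) auto
      moreover have "G x / c - F x = (G x - c * F x) / c"
        using c pos by (simp add: diff_divide_distrib)
      then have "\<bar>G x - c * F x\<bar> / c = \<bar>G x / c - F x\<bar>"
        using c pos by (simp add: abs_divide)
      ultimately show ?case by (intro ennreal_leI) simp
    qed
  qed
  also have "\<dots> = ennreal ((hi - lo) / lo)"
    using F c pos by (subst nn_integral_eq_integral) (auto intro!: AE_I2)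
  finally show ?thesis unfolding c_def .
qed

lemma elog_le_of_le_exp:
  assumes "a \<le> ennreal (exp r)" shows "elog a \<le> ereal r"
proof (cases "a = 0")
  case False
  then have fin: "a < \<infinity>" using assms by (simp add: order_le_less_trans ennreal_less_top)
  have pos: "0 < enn2real a" using False fin by (simp add: enn2real_positive_iff zero_less_iff_neq_zero)
  have "enn2real a \<le> exp r" using enn2real_mono[OF assms] by simp
  then have "ln (enn2real a) \<le> ln (exp r)" using pos by (subst ln_le_cancel_iff) auto
  then have "ln (enn2real a) \<le> r" by simp
  then show ?thesis using False fin by (simp add: elog_def less_top)
qed (simp add: elog_def)

context coupled_filters
begin

text \<open>Contraction starts at \<open>N + 1\<close>. The first \<open>N + 1\<close> terms of the sum are absorbed in \<open>D\<close>, which also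
  contains the reciprocal of the lower bound at the entry time.\<close>

lemma normalised_distance_le:
  assumes dom: "AE x in psi. G 0 x = 0 \<longrightarrow> F 0 x = 0" and N: "0 < mass N"
  shows "\<exists>D>0. \<forall>n>N. L1_dist psi (\<lambda>x. G n x / (\<integral>x. G n x \<partial>psi)) (F n)
      \<le> ennreal (D * exp (- (\<Sum>k<n. mass k) / L))"
proof -
  interpret A: coupled_filters psi lam L b "\<lambda>n. F (n + N)" "\<lambda>n. G (n + N)" "\<lambda>n. w (n + N)"
    by (rule shifted)
  define N1 where "N1 = Suc N"
  interpret B: coupled_filters psi lam L b "\<lambda>n. F (n + N1)" "\<lambda>n. G (n + N1)" "\<lambda>n. w (n + N1)"
    by (rule shifted)
  define i where "i = (\<integral>z. b z * G N z \<partial>psi) / L"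
  define s where "s = L * (\<integral>z. G N z \<partial>psi) / mass N"
  have mA: "A.mass k = mass (k + N)" and mB: "B.mass k = mass (k + N1)" for k
    unfolding A.mass_def B.mass_def mass_def by (rule refl)+
  have "0 < (\<integral>z. b z * G N z \<partial>psi)"
    by (rule b_integral_zero_mono[OF F(1) G F_dominated[OF dom]]) (use N in \<open>simp add: mass_def\<close>)
  then have i: "0 < i" using L_pos by (simp add: i_def)
  have lo0: "AE x in psi. i * F (0 + N1) x \<le> G (0 + N1) x"
    using A.entry_lower by (simp add: i_def N1_def)
  have hi0: "AE x in psi. G (0 + N1) x \<le> s * F (0 + N1) x"
    using A.entry_upper N by (simp add: s_def mA N1_def)
  have ilo: "i \<le> B.relax i k" for k
    by (induction k) (auto intro: order_trans[OF _ B.relax_lower_Suc[OF lo0]] simp del: ratio_bound.simps(2))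
  have i_le_s: "i \<le> s"
  proof -
    have "(\<integral>x. i * F N1 x \<partial>psi) \<le> (\<integral>x. s * F N1 x \<partial>psi)"
      using lo0 hi0 by (intro integral_mono_AE) (auto simp: F_int)
    then show ?thesis by (simp add: F(2))
  qed
  \<comment> \<open>The summand 1 keeps the constant positive when the two bounds coincide.\<close>
  define D where "D = (s - i) / i * exp (\<Sum>k<N1. mass k / L) + 1"
  have "L1_dist psi (\<lambda>x. G n x / (\<integral>x. G n x \<partial>psi)) (F n)
      \<le> ennreal (D * exp (- (\<Sum>k<n. mass k) / L))" if "n > N" for n
  proof -
    obtain k where n: "n = k + N1"
      using \<open>n > N\<close> by (metis N1_def Suc_leI add.commute le_add_diff_inverse)
    let ?lo = "B.relax i k" and ?hi = "B.relax s k"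
    have split: "(\<Sum>j<n. mass j) = (\<Sum>j<N1. mass j) + (\<Sum>j<k. mass (j + N1))"
      unfolding n by (induction k) simp_all
    have "L1_dist psi (\<lambda>x. G n x / (\<integral>x. G n x \<partial>psi)) (F n) \<le> ennreal ((?hi - ?lo) / ?lo)"
      unfolding n using i ilo[of k] F_nn
      by (intro L1_dist_normalised_le F_int F(2) G_int B.relax_lower[OF lo0] B.relax_upper[OF hi0]) auto
    also have "(?hi - ?lo) / ?lo \<le> (s - i) * exp (- (\<Sum>j<k. mass (j + N1)) / L) / i"
      using B.relax_diff_le[OF i_le_s, of k] ilo[of k] i B.relax_diff_nonneg[OF i_le_s, of k] i_le_s
      by (intro frac_le) (auto simp: mB)
    also have "- (\<Sum>j<k. mass (j + N1)) / L = (\<Sum>j<N1. mass j / L) + - (\<Sum>j<n. mass j) / L"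
      unfolding split by (simp add: diff_divide_distrib sum_divide_distrib)
    also have "(s - i) * exp \<dots> / i = (s - i) / i * exp (\<Sum>j<N1. mass j / L) * exp (- (\<Sum>j<n. mass j) / L)"
      by (simp only: exp_add) simp
    also have "\<dots> \<le> D * exp (- (\<Sum>k<n. mass k) / L)"
      unfolding D_def by (intro mult_right_mono) auto
    finally show ?thesis by (simp add: ennreal_leI)
  qed
  moreover have "D > 0" unfolding D_def using i i_le_s by (intro add_nonneg_pos mult_nonneg_nonneg) auto
  ultimately show ?thesis by blast
qed

lemma limsup_log_distance_le:
  assumes dom: "AE x in psi. G 0 x = 0 \<longrightarrow> F 0 x = 0" and c: "0 < c"
    and avg: "\<And>c'. c' < c \<Longrightarrow> eventually (\<lambda>n. c' * real n \<le> (\<Sum>k<n. mass k)) sequentially"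
  shows "limsup (\<lambda>n. ereal (1 / real n) *
      elog (L1_dist psi (\<lambda>x. G n x / (\<integral>x. G n x \<partial>psi)) (F n))) \<le> ereal (- c / L)"
    (is "limsup ?u \<le> _")
proof -
  have "\<exists>N. 0 < mass N"
  proof (rule ccontr)
    assume "\<not> (\<exists>N. 0 < mass N)"
    then have "mass k = 0" for k using mass_nonneg[of k] by (simp add: not_less antisym)
    then have "eventually (\<lambda>n. c / 2 * real n \<le> 0) sequentially"
      using avg[of "c / 2"] c by simp
    then obtain n where "c / 2 * real n \<le> 0" "n > 0"
      using eventually_gt_at_top[of 0] by (metis (mono_tags, lifting) eventually_at_top_linorder le_cases less_le_trans)
    then show False using c by (simp add: mult_le_0_iff)
  qed
  then obtain N D where D: "D > 0" and bound: "\<And>n. n > N \<Longrightarrow>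
      L1_dist psi (\<lambda>x. G n x / (\<integral>x. G n x \<partial>psi)) (F n) \<le> ennreal (D * exp (- (\<Sum>k<n. mass k) / L))"
    using normalised_distance_le[OF dom] by blast
  have "limsup ?u \<le> ereal (- c' / L)" if "c' < c" for c'
  proof -
    have "eventually (\<lambda>n. ?u n \<le> ereal (ln D / real n - c' / L)) sequentially"
      using avg[OF that] eventually_gt_at_top[of N]
    proof eventually_elim
      case (elim n)
      have "exp (- (\<Sum>k<n. mass k) / L) \<le> exp (- (c' * real n) / L)"
        using elim L_pos by (simp add: divide_right_mono)
      then have "D * exp (- (\<Sum>k<n. mass k) / L) \<le> D * exp (- (c' * real n) / L)"
        using D by simp
      also have "\<dots> = exp (ln D - c' * real n / L)"
        using D by (simp add: exp_diff exp_minus field_simps)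
      finally have "elog (L1_dist psi (\<lambda>x. G n x / (\<integral>x. G n x \<partial>psi)) (F n)) \<le> ereal (ln D - c' * real n / L)"
        using bound[OF elim(2)] by (intro elog_le_of_le_exp) (meson ennreal_leI order_trans)
      then have "?u n \<le> ereal (1 / real n) * ereal (ln D - c' * real n / L)"
        by (intro ereal_mult_left_mono) auto
      also have "\<dots> = ereal (ln D / real n - c' / L)"
        using elim by (simp add: field_simps)
      finally show ?case .
    qed
    then have "limsup ?u \<le> limsup (\<lambda>n. ereal (ln D / real n - c' / L))"
      by (rule Limsup_mono)
    also have "(\<lambda>n. ereal (ln D / real n - c' / L)) \<longlonglongrightarrow> ereal (0 - c' / L)"
      by (intro tendsto_intros tendsto_ereal lim_const_over_n)
    then have "limsup (\<lambda>n. ereal (ln D / real n - c' / L)) = ereal (0 - c' / L)"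
      by (intro lim_imp_Limsup) auto
    finally show ?thesis by simp
  qed
  note le = this
  show ?thesis
  proof (rule ereal_le_epsilon2)
    fix e :: real assume "0 < e"
    then have "limsup ?u \<le> ereal (- (c - e * L) / L)" using L_pos by (intro le) simp
    also have "- (c - e * L) / L = - c / L + e" using L_pos by (simp add: field_simps)
    finally show "limsup ?u \<le> ereal (- c / L) + ereal e" by simp
  qed
qed

end

section \<open>Solving the Poisson inequality by regeneration\<close>

text \<open>The transition kernel splits as \<open>lam x y = b x + (lam x y - b x)\<close>: with the first part the next
  state is drawn from the normalised \<open>psi\<close> independently of the past (the chain regenerates), with
  the second part it survives. Invariance of \<open>m\<close> controls the time until regeneration.\<close>

locale stationary_kernel = minorized_kernel +
  fixes m :: "'a \<Rightarrow> real"
  assumes m: "prob_density psi m"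
    and invariant: "invariant_measure (density_kernel psi lam) (density psi (\<lambda>x. ennreal (m x)))"
    and b_charged: "0 < (\<integral>x. b x * m x \<partial>psi)"
begin

definition forward :: "('a \<Rightarrow> real) \<Rightarrow> 'a \<Rightarrow> real" where
  "forward h x = (\<integral>y. lam x y * h y \<partial>psi)"

definition bounded_fun :: "real \<Rightarrow> ('a \<Rightarrow> real) \<Rightarrow> bool" where
  "bounded_fun C h \<longleftrightarrow> h \<in> borel_measurable psi \<and> (\<forall>x\<in>space psi. 0 \<le> h x \<and> h x \<le> C)"

text \<open>\<open>survival n x\<close> is the probability that the chain started at \<open>x\<close> does not regenerate during the
  first \<open>n\<close> steps.\<close>

primrec survival :: "nat \<Rightarrow> 'a \<Rightarrow> real" where
  "survival 0 = (\<lambda>_. 1)"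
| "survival (Suc n) = (\<lambda>x. \<integral>y. (lam x y - b x) * survival n y \<partial>psi)"

lemma m_measurable [measurable]: "m \<in> borel_measurable psi"
  and m_nonneg: "x \<in> space psi \<Longrightarrow> 0 \<le> m x"
  and nn_integral_m: "(\<integral>\<^sup>+x. ennreal (m x) \<partial>psi) = 1"
  using m by (auto simp: prob_density_def)

lemma integrable_m: "integrable psi m" and integral_m: "(\<integral>x. m x \<partial>psi) = 1"
  using nn_integral_m m_nonneg by (auto intro!: integrableI_nonneg integral_eq_nn_integral[THEN trans] AE_I2)

lemma integrable_lam: "x \<in> space psi \<Longrightarrow> integrable psi (lam x)"
  and integral_lam: "x \<in> space psi \<Longrightarrow> (\<integral>y. lam x y \<partial>psi) = 1"
  using nn_integral_lam[of x] lam_nonneg[of x] lam_section(2)[of x]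
  by (auto intro!: integrableI_nonneg integral_eq_nn_integral[THEN trans] AE_I2)

lemma bounded_mult_integrable:
  assumes "bounded_fun C h" "integrable psi f" shows "integrable psi (\<lambda>x. f x * h x)"
proof (rule Bochner_Integration.integrable_bound)
  show "integrable psi (\<lambda>x. C * f x)" using assms by simp
  show "(\<lambda>x. f x * h x) \<in> borel_measurable psi" using assms by (auto simp: bounded_fun_def)
  show "AE x in psi. norm (f x * h x) \<le> norm (C * f x)"
    using assms(1) unfolding bounded_fun_def
    by (intro AE_I2) (auto simp: abs_mult mult.commute intro!: mult_right_mono)
qed

lemma forward_measurable [measurable]:
  assumes [measurable]: "h \<in> borel_measurable psi" shows "forward h \<in> borel_measurable psi"
  unfolding forward_def by measurable

lemma forward_bounded: assumes "bounded_fun C h" shows "bounded_fun C (forward h)"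
  unfolding bounded_fun_def
proof (intro conjI ballI)
  show "forward h \<in> borel_measurable psi" using assms by (auto simp: bounded_fun_def)
  fix x assume x: "x \<in> space psi"
  show "0 \<le> forward h x" unfolding forward_def
    using assms lam_nonneg[OF x] by (intro integral_nonneg_AE AE_I2) (auto simp: bounded_fun_def)
  have "forward h x \<le> (\<integral>y. lam x y * C \<partial>psi)" unfolding forward_def
    using assms lam_nonneg[OF x] integrable_lam[OF x] bounded_mult_integrable[OF assms]
    by (intro integral_mono) (auto simp: bounded_fun_def intro!: mult_left_mono)
  then show "forward h x \<le> C" using integral_lam[OF x] by simp
qed

text \<open>Invariance on sets says that \<open>m\<close> and \<open>\<integral>lam x y m x\<close> are densities of the same measure;
  integrating \<open>h\<close> against this measure and exchanging the integrals gives invariance for functions.\<close>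

lemma invariance:
  assumes h: "bounded_fun C h"
  shows "(\<integral>x. forward h x * m x \<partial>psi) = (\<integral>x. h x * m x \<partial>psi)"
proof -
  interpret pair_sigma_finite psi psi by standard
  have [measurable]: "h \<in> borel_measurable psi" using h by (simp add: bounded_fun_def)
  define k where "k y = (\<integral>\<^sup>+x. ennreal (lam x y) * ennreal (m x) \<partial>psi)" for y
  have [measurable]: "k \<in> borel_measurable psi" unfolding k_def by measurable
  have eq: "density psi (\<lambda>x. ennreal (m x)) = density psi k"
  proof (rule measure_eqI)
    fix A assume "A \<in> sets (density psi (\<lambda>x. ennreal (m x)))"
    then have A[measurable]: "A \<in> sets psi" by simp
    have "emeasure (density psi (\<lambda>x. ennreal (m x))) A
        = (\<integral>\<^sup>+x. emeasure (density_kernel psi lam x) A \<partial>density psi (\<lambda>x. ennreal (m x)))"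
      using invariant A by (simp add: invariant_measure_def)
    also have "\<dots> = (\<integral>\<^sup>+x. ennreal (m x) * emeasure (density_kernel psi lam x) A \<partial>psi)"
    proof (rule nn_integral_density)
      have "(\<lambda>x. \<integral>\<^sup>+y. ennreal (lam x y) * indicator A y \<partial>psi) \<in> borel_measurable psi" by measurable
      then show "(\<lambda>x. emeasure (density_kernel psi lam x) A) \<in> borel_measurable psi"
        by (subst measurable_cong) (auto simp: density_kernel_def emeasure_density)
    qed auto
    also have "\<dots> = (\<integral>\<^sup>+x. \<integral>\<^sup>+y. ennreal (m x) * (ennreal (lam x y) * indicator A y) \<partial>psi \<partial>psi)"
      by (intro nn_integral_cong) (auto simp: density_kernel_def emeasure_density nn_integral_cmult)
    also have "\<dots> = (\<integral>\<^sup>+y. \<integral>\<^sup>+x. ennreal (m x) * (ennreal (lam x y) * indicator A y) \<partial>psi \<partial>psi)"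
      by (intro Fubini'[symmetric]) measurable
    also have "\<dots> = (\<integral>\<^sup>+y. k y * indicator A y \<partial>psi)"
      unfolding k_def by (intro nn_integral_cong, subst nn_integral_multc[symmetric])
        (auto simp: ac_simps)
    also have "\<dots> = emeasure (density psi k) A" by (simp add: emeasure_density)
    finally show "emeasure (density psi (\<lambda>x. ennreal (m x))) A = emeasure (density psi k) A" .
  qed simp
  have nn: "(\<integral>\<^sup>+x. ennreal (forward h x * m x) \<partial>psi) = (\<integral>\<^sup>+x. ennreal (h x * m x) \<partial>psi)"
  proof -
    have "(\<integral>\<^sup>+x. ennreal (forward h x * m x) \<partial>psi)
        = (\<integral>\<^sup>+x. \<integral>\<^sup>+y. ennreal (m x) * (ennreal (lam x y) * ennreal (h y)) \<partial>psi \<partial>psi)"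
    proof (rule nn_integral_cong)
      fix x assume x: "x \<in> space psi"
      have "ennreal (forward h x) = (\<integral>\<^sup>+y. ennreal (lam x y * h y) \<partial>psi)"
        unfolding forward_def using h lam_nonneg[OF x] bounded_mult_integrable[OF h integrable_lam[OF x]]
        by (intro nn_integral_eq_integral[symmetric] AE_I2) (auto simp: bounded_fun_def)
      also have "\<dots> = (\<integral>\<^sup>+y. ennreal (lam x y) * ennreal (h y) \<partial>psi)"
        using h lam_nonneg[OF x] by (intro nn_integral_cong) (auto simp: ennreal_mult bounded_fun_def)
      finally show "ennreal (forward h x * m x)
          = (\<integral>\<^sup>+y. ennreal (m x) * (ennreal (lam x y) * ennreal (h y)) \<partial>psi)"
        using forward_bounded[OF h] x m_nonneg[OF x]
        by (simp add: bounded_fun_def ennreal_mult nn_integral_cmult mult.commute)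
    qed
    also have "\<dots> = (\<integral>\<^sup>+y. \<integral>\<^sup>+x. ennreal (m x) * (ennreal (lam x y) * ennreal (h y)) \<partial>psi \<partial>psi)"
      by (intro Fubini'[symmetric]) measurable
    also have "\<dots> = (\<integral>\<^sup>+y. k y * ennreal (h y) \<partial>psi)"
      unfolding k_def by (intro nn_integral_cong, subst nn_integral_multc[symmetric])
        (auto simp: ac_simps)
    also have "\<dots> = (\<integral>\<^sup>+y. ennreal (h y) \<partial>density psi k)"
      by (simp add: nn_integral_density)
    also have "\<dots> = (\<integral>\<^sup>+y. ennreal (h y) \<partial>density psi (\<lambda>x. ennreal (m x)))"
      by (simp add: eq)
    also have "\<dots> = (\<integral>\<^sup>+x. ennreal (h x * m x) \<partial>psi)"
      using h m_nonneg by (subst nn_integral_density)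
        (auto intro!: nn_integral_cong simp: bounded_fun_def ennreal_mult mult.commute)
    finally show ?thesis .
  qed
  show ?thesis
    using h forward_bounded[OF h] m_nonneg
    by (subst (1 2) integral_eq_nn_integral) (auto simp: nn bounded_fun_def intro!: AE_I2)
qed

lemma survival_measurable [measurable]: "survival n \<in> borel_measurable psi"
  by (induction n) simp_all

lemma integrable_bounded: "bounded_fun C h \<Longrightarrow> integrable psi h"
  using bounded_mult_integrable[of C h "\<lambda>_. 1"] by simp

lemma integrable_residual:
  assumes "x \<in> space psi" "bounded_fun C h"
  shows "integrable psi (\<lambda>y. (lam x y - b x) * h y)"
  using assms by (intro bounded_mult_integrable) (auto simp: integrable_lam)

lemma survival_bounded: "bounded_fun 1 (survival n)"
proof (induction n)
  case (Suc n)
  show ?case unfolding bounded_fun_def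
  proof (intro conjI ballI survival_measurable)
    fix x assume x: "x \<in> space psi"
    have nn: "AE y in psi. 0 \<le> (lam x y - b x) * survival n y"
      using b_le_lam[OF x] AE_space by eventually_elim (use Suc in \<open>auto simp: bounded_fun_def\<close>)
    then show "0 \<le> survival (Suc n) x" by (simp add: integral_nonneg_AE)
    have "survival (Suc n) x \<le> (\<integral>y. lam x y \<partial>psi)"
      unfolding survival.simps
    proof (rule integral_mono_AE)
      show "AE y in psi. (lam x y - b x) * survival n y \<le> lam x y"
        using b_le_lam[OF x] AE_space
      proof eventually_elim
        case (elim y)
        have "(lam x y - b x) * survival n y \<le> (lam x y - b x) * 1"
          using elim Suc by (intro mult_left_mono) (auto simp: bounded_fun_def)
        then show ?case using b_nonneg[OF x] by simp
      qed
    qed (use x Suc integrable_residual integrable_lam in auto)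
    then show "survival (Suc n) x \<le> 1" using integral_lam[OF x] by simp
  qed
qed (simp add: bounded_fun_def)

lemma survival_Suc_eq:
  assumes x: "x \<in> space psi"
  shows "survival (Suc n) x = forward (survival n) x - b x * (\<integral>y. survival n y \<partial>psi)"
proof -
  have "survival (Suc n) x = (\<integral>y. lam x y * survival n y - b x * survival n y \<partial>psi)"
    by (simp add: algebra_simps)
  then show ?thesis unfolding forward_def
    using bounded_mult_integrable[OF survival_bounded integrable_lam[OF x]] integrable_bounded[OF survival_bounded]
    by (subst (asm) Bochner_Integration.integral_diff) auto
qed

lemma survival_Suc_le:
  assumes x: "x \<in> space psi" shows "survival (Suc n) x \<le> L * (\<integral>y. survival n y \<partial>psi)"
proof -
  have "survival (Suc n) x \<le> (\<integral>y. L * survival n y \<partial>psi)"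
    unfolding survival.simps
  proof (rule integral_mono)
    fix y assume "y \<in> space psi"
    then show "(lam x y - b x) * survival n y \<le> L * survival n y"
      using lam_le[OF x] b_nonneg[OF x] survival_bounded[of n]
      by (intro mult_right_mono) (auto simp: bounded_fun_def intro: order_trans[of _ "lam x y"])
  qed (use x integrable_residual[OF _ survival_bounded] integrable_bounded[OF survival_bounded] in auto)
  then show ?thesis by simp
qed

abbreviation "c_diamond \<equiv> (\<integral>x. b x * m x \<partial>psi)"

text \<open>Integrate \<open>survival_Suc_eq\<close> against \<open>m\<close>: invariance removes the transition operator, and the
  survival probability under \<open>m\<close> drops at each step by the amount that regenerates. The sum over \<open>n\<close>
  telescopes, so the masses of the survival functions are summable.\<close>

lemma survival_mass: "c_diamond * (\<integral>y. survival n y \<partial>psi)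
    = (\<integral>x. survival n x * m x \<partial>psi) - (\<integral>x. survival (Suc n) x * m x \<partial>psi)"
proof -
  let ?a = "\<integral>y. survival n y \<partial>psi"
  have "integrable psi (\<lambda>x. forward (survival n) x * m x)"
    using bounded_mult_integrable[OF forward_bounded[OF survival_bounded] integrable_m]
    by (simp add: mult.commute)
  moreover have "integrable psi (\<lambda>x. ?a * (b x * m x))"
    using integrable_b_mult[OF integrable_m] by simp
  moreover have "(\<integral>x. survival (Suc n) x * m x \<partial>psi)
      = (\<integral>x. forward (survival n) x * m x - ?a * (b x * m x) \<partial>psi)"
    by (intro Bochner_Integration.integral_cong refl) (simp only: survival_Suc_eq, simp add: algebra_simps)
  ultimately have "(\<integral>x. survival (Suc n) x * m x \<partial>psi)
      = (\<integral>x. survival n x * m x \<partial>psi) - ?a * c_diamond"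
    by (simp add: invariance[OF survival_bounded])
  then show ?thesis by (simp add: mult.commute)
qed

lemma survival_m_nonneg: "0 \<le> (\<integral>x. survival n x * m x \<partial>psi)"
  using survival_bounded[of n] m_nonneg by (intro integral_nonneg_AE AE_I2) (auto simp: bounded_fun_def)

lemma survival_mass_sum: "c_diamond * (\<Sum>n<N. \<integral>y. survival n y \<partial>psi) \<le> 1"
proof -
  have "c_diamond * (\<Sum>n<N. \<integral>y. survival n y \<partial>psi)
      = (\<integral>x. survival 0 x * m x \<partial>psi) - (\<integral>x. survival N x * m x \<partial>psi)"
    unfolding sum_distrib_left survival_mass by (rule sum_lessThan_telescope')
  then show ?thesis using survival_m_nonneg[of N] integral_m by simp
qed

lemma integral_survival_nonneg: "0 \<le> (\<integral>y. survival n y \<partial>psi)"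
  using survival_bounded[of n] by (intro integral_nonneg_AE AE_I2) (auto simp: bounded_fun_def)

lemma survival_mass_tendsto_0: "(\<lambda>n. \<integral>y. survival n y \<partial>psi) \<longlonglongrightarrow> 0"
proof (rule summable_LIMSEQ_zero, rule summableI_nonneg_bounded)
  show "(\<Sum>n<N. \<integral>y. survival n y \<partial>psi) \<le> 1 / c_diamond" for N
    using survival_mass_sum[of N] b_charged by (simp add: field_simps)
qed (rule integral_survival_nonneg)

text \<open>With \<open>t = survival 0 + \<dots> + survival N\<close>, summing \<open>survival_Suc_eq\<close> over \<open>n \<le> N\<close> gives
  \<open>b k = 1 - survival (Suc N) - t + forward t\<close>, where \<open>k\<close> is the mass of \<open>t\<close>. The bound on
  \<open>lam\<close> turns the decay of the masses into uniform smallness of \<open>survival (Suc N)\<close>.\<close>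

lemma poisson_inequality:
  assumes "0 < e"
  obtains t C k where "bounded_fun C t" "0 < k" "c_diamond * k \<le> 1"
    "\<And>x. x \<in> space psi \<Longrightarrow> 1 - e - t x + forward t x \<le> b x * k"
proof -
  have "eventually (\<lambda>n. L * (\<integral>y. survival n y \<partial>psi) < e) sequentially"
    using tendsto_mult_left[OF survival_mass_tendsto_0, of L] assms by (intro order_tendstoD(2)) auto
  then obtain N where N: "L * (\<integral>y. survival N y \<partial>psi) < e" by (auto simp: eventually_sequentially)
  define t where "t x = (\<Sum>n<Suc N. survival n x)" for x
  define k where "k = (\<Sum>n<Suc N. \<integral>y. survival n y \<partial>psi)"
  show ?thesis
  proof (rule that)
    have [measurable]: "t \<in> borel_measurable psi" unfolding t_def by measurable
    have "0 \<le> t x \<and> t x \<le> (\<Sum>n<Suc N. 1)" if "x \<in> space psi" for x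
      using survival_bounded that unfolding t_def bounded_fun_def by (intro conjI sum_nonneg sum_mono) auto
    then show bt: "bounded_fun (\<Sum>n<Suc N. 1) t" by (auto simp: bounded_fun_def)
    show "0 < k"
    proof -
      have "measure psi (space psi) \<noteq> 0"
      proof
        assume "measure psi (space psi) = 0"
        then have "{x \<in> space psi. \<not> False} \<in> null_sets psi"
          by (auto simp: emeasure_eq_measure)
        then show False using psi_nontrivial by (auto simp: eventually_ae_filter)
      qed
      then have "0 < (\<integral>y. survival 0 y \<partial>psi)" by (simp add: zero_less_measure_iff)
      then show ?thesis unfolding k_def using integral_survival_nonneg
        by (intro sum_pos2[of _ 0]) auto
    qed
    show "c_diamond * k \<le> 1" unfolding k_def by (rule survival_mass_sum)
    fix x assume x: "x \<in> space psi"
    have "forward t x = (\<Sum>n<Suc N. forward (survival n) x)"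
      unfolding forward_def t_def sum_distrib_left
      by (intro Bochner_Integration.integral_sum bounded_mult_integrable[OF survival_bounded integrable_lam[OF x]])
    moreover have "b x * k = (\<Sum>n<Suc N. forward (survival n) x - survival (Suc n) x)"
      unfolding k_def sum_distrib_left by (intro sum.cong refl) (simp add: survival_Suc_eq[OF x] del: survival.simps)
    moreover have "t x + survival (Suc N) x = 1 + (\<Sum>n<Suc N. survival (Suc n) x)"
      unfolding t_def by (subst sum.lessThan_Suc_shift[of "\<lambda>n. survival n x" N]) (simp del: survival.simps(2))
    ultimately have "b x * k = 1 - survival (Suc N) x - t x + forward t x"
      by (simp add: sum_subtractf del: sum.lessThan_Suc survival.simps)
    then show "1 - e - t x + forward t x \<le> b x * k"
      using survival_Suc_le[OF x, of N] N by simp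
  qed
qed

end

section \<open>A strong law for bounded orthogonal variables\<close>

text \<open>The second moment of the \<open>n\<close>-th partial sum is at most \<open>C\<^sup>2 n\<close>. Hence the squared averages at the times
  \<open>k\<^sup>2\<close> have summable expectations and tend to zero almost surely. Between two consecutive squares the
  sum changes by at most \<open>2 C k\<close>, which is negligible against \<open>k\<^sup>2\<close>.\<close>

lemma (in prob_space) orthogonal_averages_tendsto_0:
  fixes D :: "nat \<Rightarrow> 'a \<Rightarrow> real"
  assumes [measurable]: "\<And>n. D n \<in> borel_measurable M"
    and bd: "\<And>n w. w \<in> space M \<Longrightarrow> \<bar>D n w\<bar> \<le> C"
    and orth: "\<And>i j. i < j \<Longrightarrow> expectation (\<lambda>w. D i w * D j w) = 0"
  shows "AE w in M. (\<lambda>n. (\<Sum>i<n. D i w) / real n) \<longlonglongrightarrow> 0"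
proof -
  define S where "S n w = (\<Sum>i<n. D i w)" for n w
  have [measurable]: "S n \<in> borel_measurable M" for n unfolding S_def by measurable
  have C: "0 \<le> C" using bd[of _ 0] not_empty by (metis abs_ge_zero all_not_in_conv order_trans)
  have intD: "integrable M (\<lambda>w. D i w * D j w)" for i j
    using bd C by (intro integrable_const_bound[of _ "C * C"] AE_I2) (auto simp: abs_mult intro!: mult_mono)
  have Sbd: "\<bar>S n w\<bar> \<le> real n * C" if "w \<in> space M" for n w
    unfolding S_def using sum_norm_bound[of "{..<n}" "\<lambda>i. D i w" C] bd[OF that] by simp
  have intS: "integrable M (\<lambda>w. (S n w)\<^sup>2)" for n
    using power_mono[OF Sbd abs_ge_zero, of _ n 2]
    by (intro integrable_const_bound[of _ "(real n * C)\<^sup>2"] AE_I2) auto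
  have var: "expectation (\<lambda>w. (S n w)\<^sup>2) \<le> C\<^sup>2 * real n" for n
  proof (induction n)
    case (Suc n)
    have "expectation (\<lambda>w. (S (Suc n) w)\<^sup>2)
        = expectation (\<lambda>w. (S n w)\<^sup>2 + 2 * (\<Sum>i<n. D i w * D n w) + D n w * D n w)"
      unfolding S_def by (intro Bochner_Integration.integral_cong refl)
        (simp add: power2_eq_square algebra_simps sum_distrib_left sum_distrib_right)
    also have "\<dots> = expectation (\<lambda>w. (S n w)\<^sup>2) + 2 * (\<Sum>i<n. expectation (\<lambda>w. D i w * D n w))
        + expectation (\<lambda>w. D n w * D n w)"
      using intS intD by (simp add: Bochner_Integration.integral_add Bochner_Integration.integral_sum)
    also have "(\<Sum>i<n. expectation (\<lambda>w. D i w * D n w)) = 0" using orth by simp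
    also have "expectation (\<lambda>w. D n w * D n w) \<le> expectation (\<lambda>w. C * C)"
    proof (intro integral_mono intD)
      fix w assume "w \<in> space M"
      then have "\<bar>D n w\<bar> * \<bar>D n w\<bar> \<le> C * C" using bd C by (intro mult_mono) auto
      then show "D n w * D n w \<le> C * C" by (simp flip: abs_mult)
    qed simp
    finally show ?case using Suc by (simp add: algebra_simps power2_eq_square prob_space)
  qed (simp add: S_def)
  define T where "T k w = S ((Suc k)\<^sup>2) w / (real (Suc k))\<^sup>2" for k w
  have [measurable]: "T n \<in> borel_measurable M" for n unfolding T_def by measurable
  have ET: "(\<integral>\<^sup>+w. ennreal ((T k w)\<^sup>2) \<partial>M) \<le> ennreal (C\<^sup>2 * inverse (real (Suc k))^2)" for k
  proof -
    have "(\<integral>\<^sup>+w. ennreal ((T k w)\<^sup>2) \<partial>M) = ennreal (expectation (\<lambda>w. (S ((Suc k)\<^sup>2) w)\<^sup>2 / (real (Suc k))^4))"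
      unfolding T_def power_divide using intS
      by (subst nn_integral_eq_integral) (auto simp flip: power_mult)
    also have "\<dots> \<le> ennreal (C\<^sup>2 * real ((Suc k)\<^sup>2) / (real (Suc k))^4)"
      using var[of "(Suc k)\<^sup>2"] by (intro ennreal_leI) (simp add: divide_right_mono)
    also have "C\<^sup>2 * real ((Suc k)\<^sup>2) / (real (Suc k))^4 = C\<^sup>2 * inverse (real (Suc k))^2"
    proof -
      have "C\<^sup>2 * (z\<^sup>2) / z^4 = C\<^sup>2 * inverse z^2" if "z > 0" for z :: real
        using that by (simp add: power2_eq_square power4_eq_xxxx field_simps)
      from this[of "real (Suc k)"] show ?thesis by (simp only: of_nat_power)
    qed
    finally show ?thesis .
  qed
  have "summable (\<lambda>k. inverse (real (Suc k))^2)"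
    using inverse_power_summable[of 2] by (subst summable_Suc_iff) (simp add: power_inverse)
  then have sm: "summable (\<lambda>k. C\<^sup>2 * inverse (real (Suc k))^2)" by (rule summable_mult)
  have "(\<integral>\<^sup>+w. (\<Sum>k. ennreal ((T k w)\<^sup>2)) \<partial>M) = (\<Sum>k. \<integral>\<^sup>+w. ennreal ((T k w)\<^sup>2) \<partial>M)"
    by (rule nn_integral_suminf) measurable
  also have "\<dots> \<le> (\<Sum>k. ennreal (C\<^sup>2 * inverse (real (Suc k))^2))"
    by (intro suminf_le ET) auto
  also have "\<dots> = ennreal (\<Sum>k. C\<^sup>2 * inverse (real (Suc k))^2)"
    using sm by (intro suminf_ennreal_eq summable_sums) auto
  finally have "(\<integral>\<^sup>+w. (\<Sum>k. ennreal ((T k w)\<^sup>2)) \<partial>M) \<noteq> \<infinity>"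
    by (auto simp: top_unique)
  then have "AE w in M. (\<Sum>k. ennreal ((T k w)\<^sup>2)) \<noteq> \<infinity>"
    by (intro nn_integral_noteq_infinite) auto
  then show ?thesis using AE_space
  proof eventually_elim
    fix w assume fin: "(\<Sum>k. ennreal ((T k w)\<^sup>2)) \<noteq> \<infinity>" and w: "w \<in> space M"
    have "summable (\<lambda>k. (T k w)\<^sup>2)"
      using fin by (intro summable_suminf_not_top) auto
    then have "(\<lambda>k. (T k w)\<^sup>2) \<longlonglongrightarrow> 0" by (rule summable_LIMSEQ_zero)
    then have "(\<lambda>k. sqrt ((T k w)\<^sup>2)) \<longlonglongrightarrow> sqrt 0" by (intro tendsto_real_sqrt)
    then have T0: "(\<lambda>k. \<bar>T k w\<bar>) \<longlonglongrightarrow> 0" by simp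
    have "(\<lambda>k. \<bar>T k w\<bar> + 2 * C / real (Suc k)) \<longlonglongrightarrow> 0 + 0"
      by (intro tendsto_add T0 LIMSEQ_Suc[OF lim_const_over_n])
    then have lim: "(\<lambda>k. \<bar>T k w\<bar> + 2 * C / real (Suc k)) \<longlonglongrightarrow> 0" by simp
    show "(\<lambda>n. (\<Sum>i<n. D i w) / real n) \<longlonglongrightarrow> 0"
    proof (rule LIMSEQ_I)
      fix r :: real assume "0 < r"
      then obtain K where "\<And>k. k \<ge> K \<Longrightarrow> norm (\<bar>T k w\<bar> + 2 * C / real (Suc k) - 0) < r"
        using LIMSEQ_D[OF lim] by blast
      then have K: "\<bar>T k w\<bar> + 2 * C / real (Suc k) < r" if "k \<ge> K" for k
        using that by (auto intro: order.strict_trans1[OF abs_ge_self])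
      have "norm ((\<Sum>i<n. D i w) / real n - 0) < r" if n: "n \<ge> (Suc K)\<^sup>2" for n
      proof -
        let ?j = "floor_sqrt n"
        have "Suc K \<le> ?j" using n by (simp add: le_floor_sqrt_iff)
        then obtain k where k: "?j = Suc k" "k \<ge> K" by (metis Suc_le_D Suc_le_mono)
        have lo: "(Suc k)\<^sup>2 \<le> n" using k floor_sqrt_power2_le[of n] by simp
        have hi: "n < (Suc (Suc k))\<^sup>2" using k Suc_floor_sqrt_power2_gt[of n] by simp
        have split: "S n w = S ((Suc k)\<^sup>2) w + (\<Sum>i\<in>{(Suc k)\<^sup>2..<n}. D i w)"
          unfolding S_def using lo
          by (metis atLeast0LessThan le0 sum.atLeastLessThan_concat)
        have "\<bar>\<Sum>i\<in>{(Suc k)\<^sup>2..<n}. D i w\<bar> \<le> real (card {(Suc k)\<^sup>2..<n}) * C"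
          using sum_norm_bound[of "{(Suc k)\<^sup>2..<n}" "\<lambda>i. D i w" C] bd[OF w] by simp
        also have "\<dots> \<le> real (2 * Suc k) * C"
        proof (intro mult_right_mono C)
          have "n \<le> (Suc k)\<^sup>2 + 2 * Suc k" using hi by (simp add: power2_eq_square)
          then show "real (card {(Suc k)\<^sup>2..<n}) \<le> real (2 * Suc k)" by (simp del: of_nat_Suc)
        qed
        finally have "\<bar>S n w\<bar> \<le> \<bar>S ((Suc k)\<^sup>2) w\<bar> + real (2 * Suc k) * C" using split by linarith
        then have "\<bar>S n w\<bar> / real n \<le> (\<bar>S ((Suc k)\<^sup>2) w\<bar> + real (2 * Suc k) * C) / (real (Suc k))\<^sup>2"
          using lo C by (intro frac_le) (auto simp del: of_nat_Suc simp flip: of_nat_power)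
        also have "\<dots> = \<bar>T k w\<bar> + 2 * C / real (Suc k)"
        proof -
          have "(a + 2 * z * C) / z\<^sup>2 = a / z\<^sup>2 + 2 * C / z" if "z > 0" for a z :: real
            using that by (simp add: power2_eq_square field_simps)
          from this[of "real (Suc k)" "\<bar>S ((Suc k)\<^sup>2) w\<bar>"] show ?thesis
            unfolding T_def by (simp add: abs_divide)
        qed
        also have "\<dots> < r" using K k by simp
        finally show ?thesis by (simp add: S_def)
      qed
      then show "\<exists>no. \<forall>n\<ge>no. norm ((\<Sum>i<n. D i w) / real n - 0) < r" by blast
    qed
  qed
qed

section \<open>Filters along a fixed observation path\<close>

locale filter_model = minorized_kernel psi lam L b
  for psi :: "'a measure" and lam L b +
  fixes theta :: "'b measure" and gam :: "'a \<Rightarrow> 'b \<Rightarrow> real"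
  assumes theta_sigma_finite: "sigma_finite_measure theta"
    and gam_kernel: "kernel_density psi theta gam"
begin

definition normalizer :: "('a \<Rightarrow> real) \<Rightarrow> 'b \<Rightarrow> real" where
  "normalizer f v = (\<integral>u. gam u v * predict f u \<partial>psi)"

abbreviation filter :: "('a \<Rightarrow> real) \<Rightarrow> (nat \<Rightarrow> 'b) \<Rightarrow> nat \<Rightarrow> 'a \<Rightarrow> real" where
  "filter \<equiv> filter_rec psi lam gam"

text \<open>The filter started from \<open>eta\<close>, but divided at each step by the normalising constant of the
  filter started from \<open>mu\<close>. This keeps the recursion linear in \<open>eta\<close>.\<close>

primrec companion :: "('a \<Rightarrow> real) \<Rightarrow> ('a \<Rightarrow> real) \<Rightarrow> (nat \<Rightarrow> 'b) \<Rightarrow> nat \<Rightarrow> 'a \<Rightarrow> real" where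
  "companion mu eta y 0 = eta"
| "companion mu eta y (Suc n) = (\<lambda>x. gam x (y (Suc n)) * predict (companion mu eta y n) x
     / normalizer (filter mu y n) (y (Suc n)))"

text \<open>On a regular path all quotients of the recursion are meaningful. Almost every path is regular.\<close>

definition regular :: "('a \<Rightarrow> real) \<Rightarrow> (nat \<Rightarrow> 'b) \<Rightarrow> nat \<Rightarrow> bool" where
  "regular mu y n \<longleftrightarrow> y (Suc n) \<in> space theta \<and> integrable psi (\<lambda>u. gam u (y (Suc n))) \<and>
     0 < normalizer (filter mu y n) (y (Suc n))"

lemma gam_measurable [measurable]: "case_prod gam \<in> borel_measurable (psi \<Otimes>\<^sub>M theta)"
  using gam_kernel by (simp add: kernel_density_def)

lemma gam_nonneg: "x \<in> space psi \<Longrightarrow> v \<in> space theta \<Longrightarrow> 0 \<le> gam x v"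
  using gam_kernel by (auto simp: kernel_density_def prob_density_def)

lemma nn_integral_gam: "x \<in> space psi \<Longrightarrow> (\<integral>\<^sup>+v. ennreal (gam x v) \<partial>theta) = 1"
  using gam_kernel by (auto simp: kernel_density_def prob_density_def)

lemma filter_Suc: "filter mu y (Suc n) x
    = gam x (y (Suc n)) * predict (filter mu y n) x / normalizer (filter mu y n) (y (Suc n))"
  unfolding filter_rec.simps(2) normalizer_def predict_def
  by (simp only: mult.assoc integral_mult_right_zero)

lemma companion_self: "companion mu mu y n = filter mu y n"
proof (induction n)
  case (Suc n)
  show ?case unfolding companion.simps Suc by (rule ext) (rule filter_Suc[symmetric])
qed simp

lemma prob_density_integrable:
  assumes "prob_density psi f"
  shows "nonneg_integrable f" "(\<integral>x. f x \<partial>psi) = 1"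
proof -
  have f: "f \<in> borel_measurable psi" "\<And>x. x \<in> space psi \<Longrightarrow> 0 \<le> f x"
    "(\<integral>\<^sup>+x. ennreal (f x) \<partial>psi) = 1"
    using assms by (auto simp: prob_density_def)
  then show "nonneg_integrable f"
    unfolding nonneg_integrable_def by (auto intro!: integrableI_nonneg AE_I2)
  show "(\<integral>x. f x \<partial>psi) = 1"
    using f by (subst integral_eq_nn_integral) (auto intro!: AE_I2)
qed

lemma likelihood_predict_integrable:
  assumes v: "v \<in> space theta" "integrable psi (\<lambda>u. gam u v)" and h: "nonneg_integrable h"
  shows "nonneg_integrable (\<lambda>u. gam u v * predict h u)"
  unfolding nonneg_integrable_def
proof
  have h': "h \<in> borel_measurable psi" "\<And>x. x \<in> space psi \<Longrightarrow> 0 \<le> h x"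
    using h by (auto simp: nonneg_integrable_def)
  show "integrable psi (\<lambda>u. gam u v * predict h u)"
  proof (rule Bochner_Integration.integrable_bound)
    show "integrable psi (\<lambda>u. gam u v * (L * (\<integral>z. h z \<partial>psi)))" using v by simp
    show "(\<lambda>u. gam u v * predict h u) \<in> borel_measurable psi" using h' v by measurable
    show "AE u in psi. norm (gam u v * predict h u) \<le> norm (gam u v * (L * (\<integral>z. h z \<partial>psi)))"
    proof (intro AE_I2)
      fix u assume u: "u \<in> space psi"
      have "0 \<le> predict h u" by (rule predict_nonneg[OF h'(2) u])
      then have "\<bar>predict h u\<bar> \<le> \<bar>L * (\<integral>z. h z \<partial>psi)\<bar>" using predict_le[OF h u] by linarith
      then show "norm (gam u v * predict h u) \<le> norm (gam u v * (L * (\<integral>z. h z \<partial>psi)))"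
        unfolding real_norm_def abs_mult[of "gam u v"] by (intro mult_left_mono) auto
    qed
  qed
  show "\<forall>x\<in>space psi. 0 \<le> gam x v * predict h x"
    using predict_nonneg[OF h'(2)] gam_nonneg v by auto
qed

lemma companion_integrable:
  assumes eta: "nonneg_integrable eta" and reg: "\<And>k. k < n \<Longrightarrow> regular mu y k"
  shows "nonneg_integrable (companion mu eta y n)"
  using reg
proof (induction n)
  case (Suc n)
  then have r: "regular mu y n" and IH: "nonneg_integrable (companion mu eta y n)" by auto
  show ?case
    using likelihood_predict_integrable[OF _ _ IH] r
    by (auto simp: nonneg_integrable_def regular_def)
qed (use eta in simp)

lemma filter_prob_density:
  assumes mu: "prob_density psi mu" and reg: "\<And>k. k < n \<Longrightarrow> regular mu y k"
  shows "nonneg_integrable (filter mu y n)" "(\<integral>x. filter mu y n x \<partial>psi) = 1"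
proof -
  show "nonneg_integrable (filter mu y n)"
    using companion_integrable[OF prob_density_integrable(1)[OF mu] reg] by (simp add: companion_self)
  show "(\<integral>x. filter mu y n x \<partial>psi) = 1"
  proof (cases n)
    case 0 then show ?thesis using prob_density_integrable(2)[OF mu] by simp
  next
    case (Suc k)
    then have "regular mu y k" using reg by simp
    then show ?thesis unfolding Suc filter_Suc[abs_def] by (simp add: regular_def normalizer_def)
  qed
qed

lemma coupled_filters_companion:
  assumes mu: "prob_density psi mu" and eta: "prob_density psi eta" and reg: "\<And>k. regular mu y k"
  shows "coupled_filters psi lam L b (filter mu y) (companion mu eta y)
    (\<lambda>n x. gam x (y (Suc n)) / normalizer (filter mu y n) (y (Suc n)))"
proof unfold_locales
  show "nonneg_integrable (companion mu eta y n)" for n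
    using companion_integrable[OF prob_density_integrable(1)[OF eta] reg] .
  show "0 \<le> gam x (y (Suc n)) / normalizer (filter mu y n) (y (Suc n))" if "x \<in> space psi" for n x
    using reg[of n] gam_nonneg[OF that] by (simp add: regular_def)
  show "nonneg_integrable (filter mu y n)" "(\<integral>x. filter mu y n x \<partial>psi) = 1" for n
    using filter_prob_density[OF mu reg] .
  show "filter mu y (Suc n) x = gam x (y (Suc n)) / normalizer (filter mu y n) (y (Suc n))
      * predict (filter mu y n) x" for n x
    unfolding filter_Suc by simp
  show "companion mu eta y (Suc n) x = gam x (y (Suc n)) / normalizer (filter mu y n) (y (Suc n))
      * predict (companion mu eta y n) x" for n x
    by simp
qed

text \<open>The companion evolves linearly with the normalising constants of the true filter, so it
  differs from the wrong filter only by a constant factor depending on time.\<close>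

lemma filter_eq_normalised_companion:
  assumes mu: "prob_density psi mu" and eta: "prob_density psi eta" and reg: "\<And>k. regular mu y k"
    and dom: "AE x in psi. eta x = 0 \<longrightarrow> mu x = 0" and x: "x \<in> space psi"
  shows "filter eta y n x = companion mu eta y n x / (\<integral>x. companion mu eta y n x \<partial>psi)"
  using x
proof (induction n arbitrary: x)
  case 0 then show ?case using prob_density_integrable(2)[OF eta] by simp
next
  case (Suc n)
  interpret coupled_filters psi lam L b "filter mu y" "companion mu eta y"
    "\<lambda>n x. gam x (y (Suc n)) / normalizer (filter mu y n) (y (Suc n))"
    by (rule coupled_filters_companion[OF mu eta reg])
  let ?G = "companion mu eta y" and ?Z = "normalizer (filter mu y n) (y (Suc n))"
  define c where "c = (\<integral>x. ?G n x \<partial>psi)"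
  have Z: "?Z > 0" using reg by (simp add: regular_def)
  have "c \<noteq> 0"
  proof
    assume "c = 0"
    then have "AE x in psi. ?G n x = 0"
      unfolding c_def using integral_nonneg_eq_0_iff_AE[OF G_int] G_nn by auto
    moreover have "AE x in psi. ?G n x = 0 \<longrightarrow> filter mu y n x = 0"
      by (rule F_dominated) (use dom in simp)
    ultimately have "AE x in psi. filter mu y n x = 0" by eventually_elim simp
    then have "(\<integral>x. filter mu y n x \<partial>psi) = 0" by (rule integral_eq_zero_AE)
    then show False using F(2)[of n] by simp
  qed
  have pr: "predict (filter eta y n) u = predict (?G n) u / c" for u
  proof -
    have "predict (filter eta y n) u = (\<integral>z. (lam z u * ?G n z) / c \<partial>psi)"
      unfolding predict_def by (intro Bochner_Integration.integral_cong) (auto simp: Suc.IH c_def)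
    then show ?thesis by (simp add: predict_def)
  qed
  have gz: "gam u (y (Suc n)) * predict (filter eta y n) u = ?G (Suc n) u * (?Z / c)" for u
    using Z by (simp add: pr)
  have "normalizer (filter eta y n) (y (Suc n)) = (\<integral>u. ?G (Suc n) u \<partial>psi) * (?Z / c)"
    unfolding normalizer_def[of "filter eta y n"] gz by simp
  then show ?case
    unfolding filter_Suc gz using Z \<open>c \<noteq> 0\<close> by (simp del: companion.simps)
qed

end

section \<open>The sigma-algebras generated by signal and observations\<close>

lemma space_sigma_XY [simp]: "space (sigma_XY P N R X Y I J) = space P"
  unfolding sigma_XY_def by (rule space_measure_of) auto

lemma sets_sigma_XY: "sets (sigma_XY P N R X Y I J) = sigma_sets (space P)
    ({X i -` A \<inter> space P | i A. i \<in> I \<and> A \<in> sets N} \<union>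
      {Y j -` B \<inter> space P | j B. j \<in> J \<and> B \<in> sets R})"
  unfolding sigma_XY_def by (rule sets_measure_of) auto

lemma sets_sigma_XY_subset:
  assumes "space Q = space P" "\<And>i. i \<in> I \<Longrightarrow> X i \<in> measurable Q N" "\<And>j. j \<in> J \<Longrightarrow> Y j \<in> measurable Q R"
  shows "sets (sigma_XY P N R X Y I J) \<subseteq> sets Q"
proof -
  have "X i -` A \<inter> space P \<in> sets Q" if "i \<in> I" "A \<in> sets N" for i A
    using measurable_sets[OF assms(2) that(2)] that assms(1) by simp
  moreover have "Y j -` B \<inter> space P \<in> sets Q" if "j \<in> J" "B \<in> sets R" for j B
    using measurable_sets[OF assms(3) that(2)] that assms(1) by simp
  ultimately have "sigma_sets (space Q) ({X i -` A \<inter> space P | i A. i \<in> I \<and> A \<in> sets N} \<union>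
      {Y j -` B \<inter> space P | j B. j \<in> J \<and> B \<in> sets R}) \<subseteq> sets Q"
    by (intro sets.sigma_sets_subset) blast
  then show ?thesis unfolding sets_sigma_XY assms(1) .
qed

lemma measurable_sigma_XY_fst:
  assumes "i \<in> I" "X i \<in> measurable P N" shows "X i \<in> measurable (sigma_XY P N R X Y I J) N"
proof (rule measurableI)
  show "X i x \<in> space N" if "x \<in> space (sigma_XY P N R X Y I J)" for x
    using measurable_space[OF assms(2)] that by simp
  show "X i -` A \<inter> space (sigma_XY P N R X Y I J) \<in> sets (sigma_XY P N R X Y I J)"
    if "A \<in> sets N" for A
    unfolding space_sigma_XY sets_sigma_XY
    by (rule sigma_sets.Basic) (use assms(1) that in blast)
qed

lemma measurable_sigma_XY_snd:
  assumes "j \<in> J" "Y j \<in> measurable P R" shows "Y j \<in> measurable (sigma_XY P N R X Y I J) R"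
proof (rule measurableI)
  show "Y j x \<in> space R" if "x \<in> space (sigma_XY P N R X Y I J)" for x
    using measurable_space[OF assms(2)] that by simp
  show "Y j -` A \<inter> space (sigma_XY P N R X Y I J) \<in> sets (sigma_XY P N R X Y I J)"
    if "A \<in> sets R" for A
    unfolding space_sigma_XY sets_sigma_XY
    by (rule sigma_sets.Basic) (use assms(1) that in blast)
qed

lemma sets_sigma_XY_mono:
  assumes "I \<subseteq> I'" "J \<subseteq> J'"
  shows "sets (sigma_XY P N R X Y I J) \<subseteq> sets (sigma_XY P N R X Y I' J')"
  unfolding sets_sigma_XY
proof (rule sigma_sets_mono', rule Un_mono)
  show "{X i -` A \<inter> space P | i A. i \<in> I \<and> A \<in> sets N} \<subseteq> {X i -` A \<inter> space P | i A. i \<in> I' \<and> A \<in> sets N}"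
    using assms by fast
  show "{Y j -` B \<inter> space P | j B. j \<in> J \<and> B \<in> sets R} \<subseteq> {Y j -` B \<inter> space P | j B. j \<in> J' \<and> B \<in> sets R}"
    using assms by fast
qed

lemma measurable_ident_mono:
  assumes "space M = space N" "sets N \<subseteq> sets M" shows "(\<lambda>w. w) \<in> measurable M N"
proof (rule measurableI)
  show "(\<lambda>w. w) -` A \<inter> space M \<in> sets M" if "A \<in> sets N" for A
    using that assms sets.sets_into_space[OF that] by (auto simp: Int_absorb2)
qed (use assms in simp)

text \<open>A sigma-algebra enlarged by one variable \<open>V\<close> consists of the preimages of product-measurable
  sets under \<open>w \<mapsto> (w, V w)\<close>. This replaces conditioning on one more variable by testing against
  functions on a product.\<close>

lemma sets_vimage_pair:
  assumes C: "C \<in> sets S" and S: "sets S \<subseteq> sets (vimage_algebra (space P) (\<lambda>w. (w, V w)) (Q \<Otimes>\<^sub>M R))"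
    and V: "V \<in> measurable P R" and Q: "space Q = space P"
  obtains D where "D \<in> sets (Q \<Otimes>\<^sub>M R)" "\<And>w. w \<in> space P \<Longrightarrow> w \<in> C \<longleftrightarrow> (w, V w) \<in> D"
proof -
  have "(\<lambda>w. (w, V w)) \<in> space P \<rightarrow> space (Q \<Otimes>\<^sub>M R)"
    using measurable_space[OF V] Q by (auto simp: space_pair_measure)
  then have "C \<in> {(\<lambda>w. (w, V w)) -` D \<inter> space P | D. D \<in> sets (Q \<Otimes>\<^sub>M R)}"
    using C S by (auto simp: sets_vimage_algebra2)
  then show ?thesis using that by blast
qed

lemma measurable_vimage_pair:
  assumes V: "V \<in> measurable P R" and Q: "space Q = space P"
  shows "(\<lambda>w. w) \<in> measurable (vimage_algebra (space P) (\<lambda>w. (w, V w)) (Q \<Otimes>\<^sub>M R)) Q"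
    and "V \<in> measurable (vimage_algebra (space P) (\<lambda>w. (w, V w)) (Q \<Otimes>\<^sub>M R)) R"
proof -
  have f: "(\<lambda>w. (w, V w)) \<in> space P \<rightarrow> space (Q \<Otimes>\<^sub>M R)"
    using measurable_space[OF V] Q by (auto simp: space_pair_measure)
  have *: "(\<lambda>w. (w, V w)) \<in> measurable (vimage_algebra (space P) (\<lambda>w. (w, V w)) (Q \<Otimes>\<^sub>M R)) (Q \<Otimes>\<^sub>M R)"
    by (rule measurable_vimage_algebra1[OF f])
  show "(\<lambda>w. w) \<in> measurable (vimage_algebra (space P) (\<lambda>w. (w, V w)) (Q \<Otimes>\<^sub>M R)) Q"
    using measurable_compose[OF * measurable_fst] by simp
  show "V \<in> measurable (vimage_algebra (space P) (\<lambda>w. (w, V w)) (Q \<Otimes>\<^sub>M R)) R"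
    using measurable_compose[OF * measurable_snd] by simp
qed

lemma measure_eqI_rectangles:
  assumes M1: "sets M1 = sets (A \<Otimes>\<^sub>M B)" and M2: "sets M2 = sets (A \<Otimes>\<^sub>M B)"
    and eq: "\<And>a b. a \<in> sets A \<Longrightarrow> b \<in> sets B \<Longrightarrow> emeasure M1 (a \<times> b) = emeasure M2 (a \<times> b)"
    and fin: "emeasure M1 (space A \<times> space B) \<noteq> \<infinity>"
  shows "M1 = M2"
proof (rule measure_eqI_generator_eq[OF Int_stable_pair_measure_generator[of A B]])
  show "{a \<times> b |a b. a \<in> sets A \<and> b \<in> sets B} \<subseteq> Pow (space A \<times> space B)"
    using sets.space_closed[of A] sets.space_closed[of B] by auto
  show "range (\<lambda>_::nat. space A \<times> space B) \<subseteq> {a \<times> b |a b. a \<in> sets A \<and> b \<in> sets B}" by auto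
  show "sets M1 = sigma_sets (space A \<times> space B) {a \<times> b |a b. a \<in> sets A \<and> b \<in> sets B}"
    "sets M2 = sigma_sets (space A \<times> space B) {a \<times> b |a b. a \<in> sets A \<and> b \<in> sets B}"
    unfolding M1 M2 by (rule sets_pair_measure)+
  show "emeasure M1 x = emeasure M2 x" if "x \<in> {a \<times> b |a b. a \<in> sets A \<and> b \<in> sets B}" for x
    using that eq by blast
  show "emeasure M1 (space A \<times> space B) \<noteq> \<infinity>" for i :: nat by (rule fin)
  show "(\<Union>i::nat. space A \<times> space B) = space A \<times> space B" by simp
qed

text \<open>For a fixed first side, the slices of the measures agree on rectangles, hence everywhere.\<close>

lemma measure_eqI_boxes:
  assumes M1: "sets M1 = sets (A \<Otimes>\<^sub>M (B \<Otimes>\<^sub>M C))" and M2: "sets M2 = sets (A \<Otimes>\<^sub>M (B \<Otimes>\<^sub>M C))"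
    and eq: "\<And>a b c. a \<in> sets A \<Longrightarrow> b \<in> sets B \<Longrightarrow> c \<in> sets C \<Longrightarrow>
      emeasure M1 (a \<times> b \<times> c) = emeasure M2 (a \<times> b \<times> c)"
    and fin: "emeasure M1 (space A \<times> space (B \<Otimes>\<^sub>M C)) \<noteq> \<infinity>"
  shows "M1 = M2"
proof (rule measure_eqI_rectangles[OF M1 M2 _ fin])
  fix a E assume a: "a \<in> sets A" and E: "E \<in> sets (B \<Otimes>\<^sub>M C)"
  define slice where "slice M = distr (density M (indicator (a \<times> space (B \<Otimes>\<^sub>M C)))) (B \<Otimes>\<^sub>M C) snd"
    for M :: "('a \<times> 'b \<times> 'c) measure"
  have slice: "emeasure (slice M) F = emeasure M (a \<times> F)"
    if M: "sets M = sets (A \<Otimes>\<^sub>M (B \<Otimes>\<^sub>M C))" and F: "F \<in> sets (B \<Otimes>\<^sub>M C)" for M F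
  proof -
    have aS: "a \<times> space (B \<Otimes>\<^sub>M C) \<in> sets M" and aF: "a \<times> F \<in> sets M" using a F by (auto simp: M)
    have snd: "snd \<in> measurable M (B \<Otimes>\<^sub>M C)"
      using measurable_snd unfolding measurable_cong_sets[OF M refl] .
    have "emeasure (slice M) F = emeasure (density M (indicator (a \<times> space (B \<Otimes>\<^sub>M C)))) (snd -` F \<inter> space M)"
      unfolding slice_def using snd F by (subst emeasure_distr) auto
    also have "\<dots> = (\<integral>\<^sup>+x. indicator (a \<times> space (B \<Otimes>\<^sub>M C)) x * indicator (snd -` F \<inter> space M) x \<partial>M)"
      using aS measurable_sets[OF snd F] by (intro emeasure_density) auto
    also have "\<dots> = (\<integral>\<^sup>+x. indicator (a \<times> F) x \<partial>M)"
      using sets.sets_into_space[OF F] by (intro nn_integral_cong) (auto simp: indicator_def)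
    also have "\<dots> = emeasure M (a \<times> F)" using aF by simp
    finally show ?thesis .
  qed
  have "slice M1 = slice M2"
  proof (rule measure_eqI_rectangles[where A=B and B=C])
    show "emeasure (slice M1) (b \<times> c) = emeasure (slice M2) (b \<times> c)" if "b \<in> sets B" "c \<in> sets C" for b c
      using that by (simp add: slice[OF M1] slice[OF M2] eq[OF a])
    have "emeasure M1 (a \<times> space (B \<Otimes>\<^sub>M C)) \<le> emeasure M1 (space A \<times> space (B \<Otimes>\<^sub>M C))"
      using sets.sets_into_space[OF a] by (intro emeasure_mono) (auto simp: M1)
    then show "emeasure (slice M1) (space B \<times> space C) \<noteq> \<infinity>"
      using fin slice[OF M1 sets.top] by (auto simp: space_pair_measure top_unique)
  qed (simp_all add: slice_def)
  then show "emeasure M1 (a \<times> E) = emeasure M2 (a \<times> E)"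
    using slice[OF M1 E] slice[OF M2 E] by simp
qed

section \<open>The joint law of signal and observations\<close>

locale hidden_markov_filter = filter_model psi lam L b theta gam + prob_space P
  for psi :: "'a measure" and lam L b and theta :: "'b measure" and gam and P :: "'w measure" +
  fixes mu :: "'a \<Rightarrow> real" and X :: "nat \<Rightarrow> 'w \<Rightarrow> 'a" and Y :: "nat \<Rightarrow> 'w \<Rightarrow> 'b"
  assumes mu: "prob_density psi mu"
    and hmm: "hidden_markov psi theta (density_kernel psi lam) (density_kernel theta gam) mu P X Y"
begin

definition obs :: "nat \<Rightarrow> 'w measure" where
  "obs n = sigma_XY P psi theta X Y {} {1..n}"

definition past :: "nat \<Rightarrow> 'w measure" where
  "past n = sigma_XY P psi theta X Y {0..n} {1..n}"

lemma space_obs [simp]: "space (obs n) = space P" and space_past [simp]: "space (past n) = space P"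
  by (simp_all add: obs_def past_def)

lemma X_measurable [measurable]: "X n \<in> measurable P psi"
  using hmm by (simp add: hidden_markov_def)

lemma Y_measurable: "n \<ge> 1 \<Longrightarrow> Y n \<in> measurable P theta"
  using hmm by (simp add: hidden_markov_def)

lemma Y_Suc_measurable [measurable]: "Y (Suc n) \<in> measurable P theta"
  by (rule Y_measurable) simp

lemma X_space: "w \<in> space P \<Longrightarrow> X n w \<in> space psi"
  using measurable_space[OF X_measurable] .

lemma Y_space: "w \<in> space P \<Longrightarrow> Y (Suc n) w \<in> space theta"
  using measurable_space[OF Y_Suc_measurable] .

lemma initial_law: "distr P psi (X 0) = density psi (\<lambda>x. ennreal (mu x))"
  using hmm by (simp add: hidden_markov_def)

lemma subalgebra_sigma_XY:
  assumes "J \<subseteq> {1..}" shows "subalgebra P (sigma_XY P psi theta X Y I J)"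
  unfolding subalgebra_def using assms Y_measurable
  by (intro conjI sets_sigma_XY_subset) auto

lemma obs_subalgebra: "subalgebra P (obs n)" and past_subalgebra: "subalgebra P (past n)"
  unfolding obs_def past_def by (intro subalgebra_sigma_XY, auto)+

lemma obs_measurable: "f \<in> measurable (obs n) N \<Longrightarrow> f \<in> measurable P N"
  using measurable_from_subalg[OF obs_subalgebra] .

lemma past_measurable: "f \<in> measurable (past n) N \<Longrightarrow> f \<in> measurable P N"
  using measurable_from_subalg[OF past_subalgebra] .

lemma id_past_obs: "(\<lambda>w. w) \<in> measurable (past n) (obs n)"
  unfolding obs_def past_def
  by (intro measurable_ident_mono sets_sigma_XY_mono) (simp_all add: subset_eq)

lemma id_P_obs: "(\<lambda>w. w) \<in> measurable P (obs n)" and id_P_past: "(\<lambda>w. w) \<in> measurable P (past n)"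
  using obs_subalgebra past_subalgebra by (auto intro!: measurable_ident_mono simp: subalgebra_def)

lemma id_obs_Suc: "(\<lambda>w. w) \<in> measurable (obs (Suc n)) (obs n)"
  unfolding obs_def past_def
  by (intro measurable_ident_mono sets_sigma_XY_mono) (simp_all add: subset_eq)

lemma X_past [measurable]: "X n \<in> measurable (past n) psi"
  unfolding past_def by (rule measurable_sigma_XY_fst) auto

lemma Y_obs: "Y (Suc n) \<in> measurable (obs (Suc n)) theta"
  unfolding obs_def by (rule measurable_sigma_XY_snd) auto

lemma sigma_finite_restr: "sigma_finite_measure (restr_to_subalg P (past n))"
  "sigma_finite_measure (restr_to_subalg P (obs n))"
  by (intro prob_space_imp_sigma_finite prob_space_restr_to_subalg past_subalgebra obs_subalgebra
      prob_space_axioms)+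

lemma nn_integral_obs: "f \<in> borel_measurable (obs n) \<Longrightarrow>
    (\<integral>\<^sup>+w. f w \<partial>restr_to_subalg P (obs n)) = (\<integral>\<^sup>+w. f w \<partial>P)"
  by (rule nn_integral_subalgebra2[OF obs_subalgebra])

lemma nn_integral_past: "f \<in> borel_measurable (past n) \<Longrightarrow>
    (\<integral>\<^sup>+w. f w \<partial>restr_to_subalg P (past n)) = (\<integral>\<^sup>+w. f w \<partial>P)"
  by (rule nn_integral_subalgebra2[OF past_subalgebra])

text \<open>The defining property of the conditional law, tested with an event \<open>C\<close> of the past and with the
  two kernels written as integrals of their densities.\<close>

lemma Markov_rectangles:
  assumes C: "C \<in> sets (past n)" and A: "A \<in> sets psi" and B: "B \<in> sets theta"
  shows "(\<integral>\<^sup>+w. indicator C w * (indicator A (X (Suc n) w) * indicator B (Y (Suc n) w)) \<partial>P)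
    = (\<integral>\<^sup>+w. indicator C w * (\<integral>\<^sup>+u. \<integral>\<^sup>+v. (indicator A u * indicator B v)
        * (ennreal (lam (X n w) u) * ennreal (gam u v)) \<partial>theta \<partial>psi) \<partial>P)"
proof -
  interpret th: sigma_finite_measure theta by (rule theta_sigma_finite)
  interpret fms: finite_measure_subalgebra P "past n"
    by unfold_locales (rule past_subalgebra)
  have [measurable]: "A \<in> sets psi" "B \<in> sets theta" by fact+
  let ?E = "{w \<in> space P. X (Suc n) w \<in> A \<and> Y (Suc n) w \<in> B}"
  have E: "?E \<in> sets P" by measurable
  have "(\<integral>\<^sup>+w. indicator C w * (indicator A (X (Suc n) w) * indicator B (Y (Suc n) w)) \<partial>P)
      = (\<integral>\<^sup>+w. indicator C w * indicator ?E w \<partial>P)"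
    by (intro nn_integral_cong) (auto simp: indicator_def)
  also have "\<dots> = (\<integral>\<^sup>+w. indicator C w * nn_cond_exp P (past n) (indicator ?E) w \<partial>P)"
    using C E by (intro fms.nn_cond_exp_intg[symmetric]) auto
  also have "\<dots> = (\<integral>\<^sup>+w. indicator C w * (\<integral>\<^sup>+u\<in>A. emeasure (density_kernel theta gam u) B
      \<partial>density_kernel psi lam (X n w)) \<partial>P)"
  proof (rule nn_integral_cong_AE)
    have "\<forall>n\<ge>1. \<forall>A\<in>sets psi. \<forall>B\<in>sets theta. AE w in P.
        nn_cond_exp P (sigma_XY P psi theta X Y {0..n-1} {1..n-1})
          (indicator {w \<in> space P. X n w \<in> A \<and> Y n w \<in> B}) w =
        (\<integral>\<^sup>+u\<in>A. emeasure (density_kernel theta gam u) B \<partial>density_kernel psi lam (X (n-1) w))"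
      using hmm unfolding hidden_markov_def by (elim conjE)
    from this[rule_format, of "Suc n", OF _ A B]
    have "AE w in P. nn_cond_exp P (past n) (indicator ?E) w =
        (\<integral>\<^sup>+u\<in>A. emeasure (density_kernel theta gam u) B \<partial>density_kernel psi lam (X n w))"
      by (simp add: past_def)
    then show "AE w in P. indicator C w * nn_cond_exp P (past n) (indicator ?E) w
        = indicator C w * (\<integral>\<^sup>+u\<in>A. emeasure (density_kernel theta gam u) B
          \<partial>density_kernel psi lam (X n w))"
      by eventually_elim simp
  qed
  also have "\<dots> = (\<integral>\<^sup>+w. indicator C w * (\<integral>\<^sup>+u. \<integral>\<^sup>+v. (indicator A u * indicator B v)
        * (ennreal (lam (X n w) u) * ennreal (gam u v)) \<partial>theta \<partial>psi) \<partial>P)"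
  proof (intro nn_integral_cong arg_cong2[where f="(*)"] refl)
    fix w assume "w \<in> space P"
    then have x: "X n w \<in> space psi" by (rule X_space)
    have em: "emeasure (density_kernel theta gam u) B = (\<integral>\<^sup>+v. ennreal (gam u v) * indicator B v \<partial>theta)"
      if "u \<in> space psi" for u
      unfolding density_kernel_def using that by (intro emeasure_density) measurable
    have [measurable]: "(\<lambda>u. ennreal (lam (X n w) u)) \<in> borel_measurable psi"
      using lam_section(2)[OF x] by measurable
    have gm: "(\<lambda>u. \<integral>\<^sup>+v. ennreal (gam u v) * indicator B v \<partial>theta) \<in> borel_measurable psi"
      by measurable
    have "(\<integral>\<^sup>+u\<in>A. emeasure (density_kernel theta gam u) B \<partial>density_kernel psi lam (X n w))
        = (\<integral>\<^sup>+u\<in>A. (\<integral>\<^sup>+v. ennreal (gam u v) * indicator B v \<partial>theta) \<partial>density_kernel psi lam (X n w))"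
    proof (rule nn_integral_cong)
      fix u assume "u \<in> space (density_kernel psi lam (X n w))"
      then have "u \<in> space psi" by (simp add: density_kernel_def)
      then show "emeasure (density_kernel theta gam u) B * indicator A u
          = (\<integral>\<^sup>+v. ennreal (gam u v) * indicator B v \<partial>theta) * indicator A u"
        by (simp add: em)
    qed
    also have "\<dots> = (\<integral>\<^sup>+u. ennreal (lam (X n w) u) *
        ((\<integral>\<^sup>+v. ennreal (gam u v) * indicator B v \<partial>theta) * indicator A u) \<partial>psi)"
      unfolding density_kernel_def using gm by (intro nn_integral_density) measurable
    also have "\<dots> = (\<integral>\<^sup>+u. \<integral>\<^sup>+v. (indicator A u * indicator B v)
        * (ennreal (lam (X n w) u) * ennreal (gam u v)) \<partial>theta \<partial>psi)"
    proof (rule nn_integral_cong)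
      fix u assume u: "u \<in> space psi"
      have [measurable]: "(\<lambda>v. gam u v) \<in> borel_measurable theta"
        using u by measurable
      show "ennreal (lam (X n w) u) * ((\<integral>\<^sup>+v. ennreal (gam u v) * indicator B v \<partial>theta) * indicator A u)
          = (\<integral>\<^sup>+v. (indicator A u * indicator B v) * (ennreal (lam (X n w) u) * ennreal (gam u v)) \<partial>theta)"
        by (subst nn_integral_multc[symmetric], measurable, subst nn_integral_cmult[symmetric], measurable)
          (auto intro!: nn_integral_cong simp: ac_simps)
    qed
    finally show "(\<integral>\<^sup>+u\<in>A. emeasure (density_kernel theta gam u) B \<partial>density_kernel psi lam (X n w))
        = (\<integral>\<^sup>+u. \<integral>\<^sup>+v. (indicator A u * indicator B v)
        * (ennreal (lam (X n w) u) * ennreal (gam u v)) \<partial>theta \<partial>psi)" .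
  qed
  finally show ?thesis .
qed

lemma lam_X_measurable [measurable]: "(\<lambda>(w, u). lam (X n w) u) \<in> borel_measurable (past n \<Otimes>\<^sub>M psi)"
  by measurable

text \<open>Extension to functions that depend jointly on the past, the new signal and the new observation:
  both sides are integrals with respect to finite measures that agree on boxes.\<close>

lemma transition_law:
  assumes H [measurable]: "H \<in> borel_measurable (past n \<Otimes>\<^sub>M (psi \<Otimes>\<^sub>M theta))"
  shows "(\<integral>\<^sup>+w. H (w, X (Suc n) w, Y (Suc n) w) \<partial>P)
    = (\<integral>\<^sup>+w. \<integral>\<^sup>+u. \<integral>\<^sup>+v. H (w, u, v) * (ennreal (lam (X n w) u) * ennreal (gam u v)) \<partial>theta \<partial>psi \<partial>P)"
proof -
  interpret th: sigma_finite_measure theta by (rule theta_sigma_finite)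
  interpret pt: pair_sigma_finite psi theta by standard
  interpret R: sigma_finite_measure "restr_to_subalg P (past n)" by (rule sigma_finite_restr)
  let ?R = "restr_to_subalg P (past n)"
  let ?k = "\<lambda>w (u, v). ennreal (lam (X n w) u) * ennreal (gam u v)"
  have sR [measurable_cong]: "sets ?R = sets (past n)" by (rule sets_restr_to_subalg[OF past_subalgebra])
  have XYm: "(\<lambda>w. (X (Suc n) w, Y (Suc n) w)) \<in> measurable P (psi \<Otimes>\<^sub>M theta)" by measurable
  have idm: "(\<lambda>w. (w, X (Suc n) w, Y (Suc n) w)) \<in> measurable P (past n \<Otimes>\<^sub>M (psi \<Otimes>\<^sub>M theta))"
    using id_P_past XYm by measurable
  have km [measurable]: "(\<lambda>(w, z). ?k w z) \<in> borel_measurable (?R \<Otimes>\<^sub>M (psi \<Otimes>\<^sub>M theta))" by measurable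
  define M1 where "M1 = distr P (past n \<Otimes>\<^sub>M (psi \<Otimes>\<^sub>M theta)) (\<lambda>w. (w, X (Suc n) w, Y (Suc n) w))"
  define M2 where "M2 = density (?R \<Otimes>\<^sub>M (psi \<Otimes>\<^sub>M theta)) (\<lambda>(w, z). ?k w z)"
  have M1: "(\<integral>\<^sup>+z. K z \<partial>M1) = (\<integral>\<^sup>+w. K (w, X (Suc n) w, Y (Suc n) w) \<partial>P)"
    if "K \<in> borel_measurable (past n \<Otimes>\<^sub>M (psi \<Otimes>\<^sub>M theta))" for K
    unfolding M1_def using that by (intro nn_integral_distr idm) auto
  have M2: "(\<integral>\<^sup>+z. K z \<partial>M2) = (\<integral>\<^sup>+w. \<integral>\<^sup>+u. \<integral>\<^sup>+v. K (w, u, v) * (ennreal (lam (X n w) u) * ennreal (gam u v)) \<partial>theta \<partial>psi \<partial>P)"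
    if K [measurable]: "K \<in> borel_measurable (past n \<Otimes>\<^sub>M (psi \<Otimes>\<^sub>M theta))" for K
  proof -
    have K': "K \<in> borel_measurable (?R \<Otimes>\<^sub>M (psi \<Otimes>\<^sub>M theta))" using K by measurable
    have "(\<integral>\<^sup>+z. K z \<partial>M2) = (\<integral>\<^sup>+z. (\<lambda>(w, z). ?k w z) z * K z \<partial>(?R \<Otimes>\<^sub>M (psi \<Otimes>\<^sub>M theta)))"
      unfolding M2_def using K' by (intro nn_integral_density) auto
    also have "\<dots> = (\<integral>\<^sup>+w. \<integral>\<^sup>+z. ?k w z * K (w, z) \<partial>(psi \<Otimes>\<^sub>M theta) \<partial>?R)"
      using K' by (subst pt.nn_integral_fst[symmetric]) auto
    also have "\<dots> = (\<integral>\<^sup>+w. \<integral>\<^sup>+u. \<integral>\<^sup>+v. K (w, u, v) * (ennreal (lam (X n w) u) * ennreal (gam u v)) \<partial>theta \<partial>psi \<partial>?R)"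
    proof (rule nn_integral_cong)
      fix w assume w: "w \<in> space ?R"
      then have "(\<lambda>z. ?k w z * K (w, z)) \<in> borel_measurable (psi \<Otimes>\<^sub>M theta)"
        using measurable_Pair2[OF K', of w] measurable_Pair2[OF km, of w]
        by (intro borel_measurable_times_ennreal) simp_all
      from th.nn_integral_fst[OF this, symmetric]
      show "(\<integral>\<^sup>+z. ?k w z * K (w, z) \<partial>(psi \<Otimes>\<^sub>M theta))
         = (\<integral>\<^sup>+u. \<integral>\<^sup>+v. K (w, u, v) * (ennreal (lam (X n w) u) * ennreal (gam u v)) \<partial>theta \<partial>psi)"
        by (simp add: ac_simps)
    qed
    also have "\<dots> = (\<integral>\<^sup>+w. \<integral>\<^sup>+u. \<integral>\<^sup>+v. K (w, u, v) * (ennreal (lam (X n w) u) * ennreal (gam u v)) \<partial>theta \<partial>psi \<partial>P)"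
      by (intro nn_integral_past) measurable
    finally show ?thesis .
  qed
  have "M1 = M2"
  proof (rule measure_eqI_boxes)
    show s1: "sets M1 = sets (past n \<Otimes>\<^sub>M (psi \<Otimes>\<^sub>M theta))" by (simp add: M1_def)
    show s2: "sets M2 = sets (past n \<Otimes>\<^sub>M (psi \<Otimes>\<^sub>M theta))"
      unfolding M2_def sets_density by (intro sets_pair_measure_cong sR refl)
    show "emeasure M1 (space (past n) \<times> space (psi \<Otimes>\<^sub>M theta)) \<noteq> \<infinity>"
      using prob_space.prob_space_distr[OF prob_space_axioms idm] finite_measure.emeasure_finite
      unfolding M1_def prob_space_def by auto
    fix C A B assume C: "C \<in> sets (past n)" and A: "A \<in> sets psi" and B: "B \<in> sets theta"
    note [measurable] = C A B
    let ?i = "\<lambda>(w, u, v). indicator C w * (indicator A u * indicator B v) :: ennreal"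
    have box: "C \<times> A \<times> B \<in> sets (past n \<Otimes>\<^sub>M (psi \<Otimes>\<^sub>M theta))" by simp
    have im: "?i \<in> borel_measurable (past n \<Otimes>\<^sub>M (psi \<Otimes>\<^sub>M theta))" by measurable
    have ind: "indicator (C \<times> A \<times> B) = ?i" by (auto simp: indicator_def)
    have "emeasure M1 (C \<times> A \<times> B) = (\<integral>\<^sup>+z. ?i z \<partial>M1)" and e2: "emeasure M2 (C \<times> A \<times> B) = (\<integral>\<^sup>+z. ?i z \<partial>M2)"
      using box by (simp_all add: s1 s2 flip: ind)
    then have "emeasure M1 (C \<times> A \<times> B)
        = (\<integral>\<^sup>+w. indicator C w * (indicator A (X (Suc n) w) * indicator B (Y (Suc n) w)) \<partial>P)"
      by (simp add: M1[OF im])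
    also have "\<dots> = (\<integral>\<^sup>+w. indicator C w * (\<integral>\<^sup>+u. \<integral>\<^sup>+v. (indicator A u * indicator B v)
        * (ennreal (lam (X n w) u) * ennreal (gam u v)) \<partial>theta \<partial>psi) \<partial>P)"
      by (rule Markov_rectangles[OF C A B])
    also have "\<dots> = emeasure M2 (C \<times> A \<times> B)"
      unfolding e2 M2[OF im] by (intro nn_integral_cong) (simp add: indicator_def)
    finally show "emeasure M1 (C \<times> A \<times> B) = emeasure M2 (C \<times> A \<times> B)" .
  qed
  then show ?thesis using M1[OF H] M2[OF H] by simp
qed

end

section \<open>Joint densities of signal and observations, and Bayes' rule\<close>

context filter_model
begin

lemma predict_joint_measurable [measurable]:
  assumes [measurable]: "case_prod g \<in> borel_measurable (Q \<Otimes>\<^sub>M psi)"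
  shows "(\<lambda>(w, x). predict (g w) x) \<in> borel_measurable (Q \<Otimes>\<^sub>M psi)"
  unfolding predict_def by measurable

lemma normalizer_measurable:
  assumes [measurable]: "case_prod g \<in> borel_measurable (Q \<Otimes>\<^sub>M psi)" "V \<in> measurable Q theta"
  shows "(\<lambda>w. normalizer (g w) (V w)) \<in> borel_measurable Q"
  unfolding normalizer_def by measurable

lemma ennreal_predict:
  assumes "nonneg_integrable h" "u \<in> space psi"
  shows "(\<integral>\<^sup>+x. ennreal (lam x u) * ennreal (h x) \<partial>psi) = ennreal (predict h u)"
proof -
  have "(\<integral>\<^sup>+x. ennreal (lam x u) * ennreal (h x) \<partial>psi) = (\<integral>\<^sup>+x. ennreal (lam x u * h x) \<partial>psi)"
    using assms lam_nonneg by (intro nn_integral_cong) (auto simp: nonneg_integrable_def ennreal_mult)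
  also have "\<dots> = ennreal (predict h u)"
    unfolding predict_def using assms lam_nonneg
    by (intro nn_integral_eq_integral integrable_lam_mult AE_I2) (auto simp: nonneg_integrable_def)
  finally show ?thesis .
qed

lemma AE_likelihood_finite: "AE v in theta. (\<integral>\<^sup>+u. ennreal (gam u v) \<partial>psi) \<noteq> \<infinity>"
proof (rule nn_integral_PInf_AE)
  interpret th: sigma_finite_measure theta by (rule theta_sigma_finite)
  interpret pt: pair_sigma_finite psi theta by standard
  show "(\<lambda>v. \<integral>\<^sup>+u. ennreal (gam u v) \<partial>psi) \<in> borel_measurable theta" by measurable
  have "(\<integral>\<^sup>+v. \<integral>\<^sup>+u. ennreal (gam u v) \<partial>psi \<partial>theta) = (\<integral>\<^sup>+u. \<integral>\<^sup>+v. ennreal (gam u v) \<partial>theta \<partial>psi)"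
    by (rule pt.Fubini') measurable
  also have "\<dots> = (\<integral>\<^sup>+u. 1 \<partial>psi)"
    by (intro nn_integral_cong nn_integral_gam)
  finally show "(\<integral>\<^sup>+v. \<integral>\<^sup>+u. ennreal (gam u v) \<partial>psi \<partial>theta) \<noteq> \<infinity>"
    by (simp add: emeasure_eq_measure)
qed

text \<open>An integrable likelihood makes the normalising constant finite, because predictions are
  bounded; then the integrals over extended and over real numbers coincide.\<close>

lemma ennreal_normalizer:
  assumes v: "v \<in> space theta" and fin: "(\<integral>\<^sup>+u. ennreal (gam u v) \<partial>psi) \<noteq> \<infinity>"
    and h: "nonneg_integrable h"
  shows "integrable psi (\<lambda>u. gam u v)"
    and "(\<integral>\<^sup>+u. ennreal (gam u v) * ennreal (predict h u) \<partial>psi) = ennreal (normalizer h v)"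
proof -
  have gm: "(\<lambda>u. gam u v) \<in> borel_measurable psi" using v by measurable
  show int: "integrable psi (\<lambda>u. gam u v)"
    using gm fin gam_nonneg[OF _ v] by (intro integrableI_nonneg) (auto intro!: AE_I2 simp: less_top)
  have "(\<integral>\<^sup>+u. ennreal (gam u v) * ennreal (predict h u) \<partial>psi) = (\<integral>\<^sup>+u. ennreal (gam u v * predict h u) \<partial>psi)"
    using gam_nonneg[OF _ v] by (intro nn_integral_cong) (simp add: ennreal_mult')
  also have "\<dots> = ennreal (normalizer h v)"
    unfolding normalizer_def using likelihood_predict_integrable[OF v int h]
    by (intro nn_integral_eq_integral AE_I2) (auto simp: nonneg_integrable_def)
  finally show "(\<integral>\<^sup>+u. ennreal (gam u v) * ennreal (predict h u) \<partial>psi) = ennreal (normalizer h v)" .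
qed

end

context hidden_markov_filter
begin

text \<open>The measure with density \<open>g w\<close> gives to a set \<open>A\<close> the conditional expectation, given the first \<open>n\<close>
  observations, of \<open>W\<close> on the event \<open>X n \<in> A\<close>. For \<open>W = 1\<close> it is the conditional density of the
  signal. For \<open>W\<close> the ratio of two initial densities at \<open>X 0\<close> it is the companion, and the quotient
  of the two is the conditional expectation of \<open>W\<close> given \<open>X n\<close> and the observations.\<close>

definition joint_density :: "('w \<Rightarrow> ennreal) \<Rightarrow> nat \<Rightarrow> ('w \<Rightarrow> 'a \<Rightarrow> real) \<Rightarrow> bool" where
  "joint_density W n g \<longleftrightarrow> (\<forall>H\<in>borel_measurable (obs n \<Otimes>\<^sub>M psi).
     (\<integral>\<^sup>+w. W w * H (w, X n w) \<partial>P) = (\<integral>\<^sup>+w. \<integral>\<^sup>+x. H (w, x) * ennreal (g w x) \<partial>psi \<partial>P))"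

lemma psi_sigma_finite: "sigma_finite_measure psi"
  by unfold_locales

lemma nn_integral_obs_density:
  assumes g [measurable]: "case_prod g \<in> borel_measurable (obs n \<Otimes>\<^sub>M psi)"
    and K [measurable]: "K \<in> borel_measurable (obs n \<Otimes>\<^sub>M psi)"
  shows "(\<integral>\<^sup>+z. K z \<partial>density (restr_to_subalg P (obs n) \<Otimes>\<^sub>M psi) (\<lambda>(w, x). ennreal (g w x)))
    = (\<integral>\<^sup>+w. \<integral>\<^sup>+x. K (w, x) * ennreal (g w x) \<partial>psi \<partial>P)"
proof -
  let ?R = "restr_to_subalg P (obs n)"
  have sR [measurable_cong]: "sets ?R = sets (obs n)" by (rule sets_restr_to_subalg[OF obs_subalgebra])
  have "(\<integral>\<^sup>+z. K z \<partial>density (?R \<Otimes>\<^sub>M psi) (\<lambda>(w, x). ennreal (g w x)))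
      = (\<integral>\<^sup>+z. (\<lambda>(w, x). ennreal (g w x)) z * K z \<partial>(?R \<Otimes>\<^sub>M psi))"
    by (intro nn_integral_density) measurable
  also have "\<dots> = (\<integral>\<^sup>+z. (\<lambda>(w, x). K (w, x) * ennreal (g w x)) z \<partial>(?R \<Otimes>\<^sub>M psi))"
    by (intro nn_integral_cong) (auto simp: mult.commute)
  also have "\<dots> = (\<integral>\<^sup>+w. \<integral>\<^sup>+x. K (w, x) * ennreal (g w x) \<partial>psi \<partial>?R)"
  proof -
    have "(\<lambda>(w, x). K (w, x) * ennreal (g w x)) \<in> borel_measurable (?R \<Otimes>\<^sub>M psi)" by measurable
    from sigma_finite_measure.nn_integral_fst[OF psi_sigma_finite this] show ?thesis by simp
  qed
  also have "\<dots> = (\<integral>\<^sup>+w. \<integral>\<^sup>+x. K (w, x) * ennreal (g w x) \<partial>psi \<partial>P)"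
    by (rule nn_integral_obs) measurable
  finally show ?thesis .
qed

lemma sets_obs_density:
  "sets (density (restr_to_subalg P (obs n) \<Otimes>\<^sub>M psi) h) = sets (obs n \<Otimes>\<^sub>M psi)"
  unfolding sets_density
  by (intro sets_pair_measure_cong sets_restr_to_subalg[OF obs_subalgebra] refl)

lemma joint_densityI:
  assumes W [measurable]: "W \<in> borel_measurable P" and fin: "(\<integral>\<^sup>+w. W w \<partial>P) \<noteq> \<infinity>"
    and g: "case_prod g \<in> borel_measurable (obs n \<Otimes>\<^sub>M psi)"
    and rect: "\<And>C A. C \<in> sets (obs n) \<Longrightarrow> A \<in> sets psi \<Longrightarrow>
      (\<integral>\<^sup>+w. W w * (indicator C w * indicator A (X n w)) \<partial>P)
        = (\<integral>\<^sup>+w. \<integral>\<^sup>+x. indicator C w * indicator A x * ennreal (g w x) \<partial>psi \<partial>P)"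
  shows "joint_density W n g"
  unfolding joint_density_def
proof
  fix H :: "'w \<times> 'a \<Rightarrow> ennreal" assume H: "H \<in> borel_measurable (obs n \<Otimes>\<^sub>M psi)"
  have idm: "(\<lambda>w. (w, X n w)) \<in> measurable P (obs n \<Otimes>\<^sub>M psi)"
    using id_P_obs by measurable
  define M1 where "M1 = distr (density P W) (obs n \<Otimes>\<^sub>M psi) (\<lambda>w. (w, X n w))"
  define M2 where "M2 = density (restr_to_subalg P (obs n) \<Otimes>\<^sub>M psi) (\<lambda>(w, x). ennreal (g w x))"
  have M1: "(\<integral>\<^sup>+z. K z \<partial>M1) = (\<integral>\<^sup>+w. W w * K (w, X n w) \<partial>P)"
    if K: "K \<in> borel_measurable (obs n \<Otimes>\<^sub>M psi)" for K
  proof -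
    have "(\<integral>\<^sup>+z. K z \<partial>M1) = (\<integral>\<^sup>+w. K (w, X n w) \<partial>density P W)"
      unfolding M1_def using idm K by (intro nn_integral_distr) auto
    also have "\<dots> = (\<integral>\<^sup>+w. W w * K (w, X n w) \<partial>P)"
      using measurable_compose[OF idm K] by (intro nn_integral_density W) auto
    finally show ?thesis .
  qed
  note M2 = nn_integral_obs_density[OF g, folded M2_def]
  have "M1 = M2"
  proof (rule measure_eqI_rectangles[where A="obs n" and B=psi])
    show s1: "sets M1 = sets (obs n \<Otimes>\<^sub>M psi)" and s2: "sets M2 = sets (obs n \<Otimes>\<^sub>M psi)"
      by (simp_all add: M1_def M2_def sets_obs_density del: sets_density)
    have em: "emeasure M1 D = (\<integral>\<^sup>+w. W w * indicator D (w, X n w) \<partial>P)"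
      "emeasure M2 D = (\<integral>\<^sup>+w. \<integral>\<^sup>+x. indicator D (w, x) * ennreal (g w x) \<partial>psi \<partial>P)"
      if "D \<in> sets (obs n \<Otimes>\<^sub>M psi)" for D
      using M1[of "indicator D"] M2[of "indicator D"] that by (simp_all add: s1 s2)
    have "emeasure M1 (space (obs n) \<times> space psi) \<le> (\<integral>\<^sup>+w. W w \<partial>P)"
      by (subst em) (auto intro!: nn_integral_mono simp: indicator_def space_pair_measure[symmetric] simp del: space_obs)
    then show "emeasure M1 (space (obs n) \<times> space psi) \<noteq> \<infinity>" using fin by (auto simp: top_unique)
    fix C A assume CA: "C \<in> sets (obs n)" "A \<in> sets psi"
    then have "C \<times> A \<in> sets (obs n \<Otimes>\<^sub>M psi)" by simp
    from em[OF this] show "emeasure M1 (C \<times> A) = emeasure M2 (C \<times> A)"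
      using rect[OF CA] by (simp add: indicator_times)
  qed
  then show "(\<integral>\<^sup>+w. W w * H (w, X n w) \<partial>P) = (\<integral>\<^sup>+w. \<integral>\<^sup>+x. H (w, x) * ennreal (g w x) \<partial>psi \<partial>P)"
    using M1[OF H] M2[OF H] by simp
qed

lemma joint_density_unique:
  assumes f: "joint_density W n f" "case_prod f \<in> borel_measurable (obs n \<Otimes>\<^sub>M psi)"
    and g: "joint_density W n g" "case_prod g \<in> borel_measurable (obs n \<Otimes>\<^sub>M psi)"
  shows "AE w in P. AE x in psi. ennreal (f w x) = ennreal (g w x)"
proof -
  let ?R = "restr_to_subalg P (obs n)"
  interpret R: sigma_finite_measure ?R by (rule sigma_finite_restr)
  interpret Rp: pair_sigma_finite ?R psi by standard
  note [measurable] = f(2) g(2)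
  have sR [measurable_cong]: "sets ?R = sets (obs n)" by (rule sets_restr_to_subalg[OF obs_subalgebra])
  have "density (?R \<Otimes>\<^sub>M psi) (\<lambda>(w, x). ennreal (f w x)) = density (?R \<Otimes>\<^sub>M psi) (\<lambda>(w, x). ennreal (g w x))"
    (is "?F = ?G")
  proof (rule measure_eqI)
    fix D assume "D \<in> sets ?F"
    then have D: "D \<in> sets (obs n \<Otimes>\<^sub>M psi)" by (simp add: sets_obs_density del: sets_density)
    then have H: "indicator D \<in> borel_measurable (obs n \<Otimes>\<^sub>M psi)" by simp
    have e: "emeasure ?F D = (\<integral>\<^sup>+z. indicator D z \<partial>?F)" "emeasure ?G D = (\<integral>\<^sup>+z. indicator D z \<partial>?G)"
      using D by (simp_all add: sets_obs_density del: sets_density)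
    have "(\<integral>\<^sup>+z. indicator D z \<partial>?F) = (\<integral>\<^sup>+w. W w * indicator D (w, X n w) \<partial>P)"
      unfolding nn_integral_obs_density[OF f(2) H]
      using f(1)[unfolded joint_density_def, rule_format, OF H] by simp
    also have "\<dots> = (\<integral>\<^sup>+z. indicator D z \<partial>?G)"
      unfolding nn_integral_obs_density[OF g(2) H]
      using g(1)[unfolded joint_density_def, rule_format, OF H] by simp
    finally show "emeasure ?F D = emeasure ?G D" unfolding e .
  qed simp
  then have "AE z in ?R \<Otimes>\<^sub>M psi. (\<lambda>(w, x). ennreal (f w x)) z = (\<lambda>(w, x). ennreal (g w x)) z"
    by (subst (asm) Rp.density_unique_iff) measurable
  from Rp.AE_pair[OF this] have "AE w in ?R. AE x in psi. ennreal (f w x) = ennreal (g w x)" by simp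
  then show ?thesis by (rule AE_restr_to_subalg[OF obs_subalgebra])
qed

text \<open>Integrate out the new signal and the new observation by the transition law, replace the current
  signal by its density \<open>g\<close>, and exchange the integrals: \<open>lam\<close> and \<open>g\<close> combine to a prediction.\<close>

lemma joint_transition:
  assumes JD: "joint_density W n g" and g [measurable]: "case_prod g \<in> borel_measurable (obs n \<Otimes>\<^sub>M psi)"
    and int: "AE w in P. nonneg_integrable (g w)" and W [measurable]: "W \<in> borel_measurable (past n)"
    and H [measurable]: "H \<in> borel_measurable (obs n \<Otimes>\<^sub>M (psi \<Otimes>\<^sub>M theta))"
  shows "(\<integral>\<^sup>+w. W w * H (w, X (Suc n) w, Y (Suc n) w) \<partial>P)
    = (\<integral>\<^sup>+w. \<integral>\<^sup>+v. \<integral>\<^sup>+u. H (w, u, v) * (ennreal (gam u v) * ennreal (predict (g w) u)) \<partial>psi \<partial>theta \<partial>P)"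
proof -
  interpret th: sigma_finite_measure theta by (rule theta_sigma_finite)
  interpret pt: pair_sigma_finite psi theta by standard
  interpret ppt: pair_sigma_finite psi "psi \<Otimes>\<^sub>M theta" by standard
  note [measurable] = id_past_obs
  have Hp [measurable]: "(\<lambda>(w, z). H (w, z)) \<in> borel_measurable (past n \<Otimes>\<^sub>M (psi \<Otimes>\<^sub>M theta))"
    using H by measurable
  define K where "K w x = (\<integral>\<^sup>+z. H (w, z) * (ennreal (lam x (fst z)) * ennreal (gam (fst z) (snd z))) \<partial>(psi \<Otimes>\<^sub>M theta))" for w x
  have Km [measurable]: "case_prod K \<in> borel_measurable (obs n \<Otimes>\<^sub>M psi)"
    unfolding K_def[abs_def] by measurable
  have Hw [measurable]: "(\<lambda>z. H (w, z)) \<in> borel_measurable (psi \<Otimes>\<^sub>M theta)" if "w \<in> space P" for w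
    using measurable_Pair2[OF H, of w] that by simp
  have "(\<integral>\<^sup>+w. W w * H (w, X (Suc n) w, Y (Suc n) w) \<partial>P)
      = (\<integral>\<^sup>+w. \<integral>\<^sup>+u. \<integral>\<^sup>+v. (W w * H (w, u, v)) * (ennreal (lam (X n w) u) * ennreal (gam u v)) \<partial>theta \<partial>psi \<partial>P)"
  proof -
    have "(\<lambda>(w, z). W w * H (w, z)) \<in> borel_measurable (past n \<Otimes>\<^sub>M (psi \<Otimes>\<^sub>M theta))"
      by measurable
    from transition_law[OF this] show ?thesis by simp
  qed
  also have "\<dots> = (\<integral>\<^sup>+w. W w * K w (X n w) \<partial>P)"
  proof (rule nn_integral_cong)
    fix w assume w: "w \<in> space P"
    note [measurable] = Hw[OF w] lam_section(2)[OF X_space[OF w], of n]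
    have lm [measurable]: "(\<lambda>u. lam (X n w) u) \<in> borel_measurable psi" using lam_section(2)[OF X_space[OF w]] .
    have "W w * K w (X n w) = (\<integral>\<^sup>+z. W w * (H (w, z) * (ennreal (lam (X n w) (fst z)) * ennreal (gam (fst z) (snd z)))) \<partial>(psi \<Otimes>\<^sub>M theta))"
      unfolding K_def by (rule nn_integral_cmult[symmetric]) measurable
    also have "\<dots> = (\<integral>\<^sup>+u. \<integral>\<^sup>+v. (W w * H (w, u, v)) * (ennreal (lam (X n w) u) * ennreal (gam u v)) \<partial>theta \<partial>psi)"
      by (subst th.nn_integral_fst[symmetric]) (measurable, simp add: mult.assoc)
    finally show "(\<integral>\<^sup>+u. \<integral>\<^sup>+v. (W w * H (w, u, v)) * (ennreal (lam (X n w) u) * ennreal (gam u v)) \<partial>theta \<partial>psi)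
      = W w * K w (X n w)" ..
  qed
  also have "\<dots> = (\<integral>\<^sup>+w. \<integral>\<^sup>+x. K w x * ennreal (g w x) \<partial>psi \<partial>P)"
    using JD Km unfolding joint_density_def by (auto dest: bspec[of _ _ "case_prod K"])
  also have "\<dots> = (\<integral>\<^sup>+w. \<integral>\<^sup>+v. \<integral>\<^sup>+u. H (w, u, v) * (ennreal (gam u v) * ennreal (predict (g w) u)) \<partial>psi \<partial>theta \<partial>P)"
    using int AE_space
  proof (intro nn_integral_cong_AE, eventually_elim)
    fix w assume gi: "nonneg_integrable (g w)" and w: "w \<in> space P"
    note [measurable] = Hw[OF w]
    have [measurable]: "g w \<in> borel_measurable psi" 
      using gi borel_measurable_integrable[of psi "g w"] by (simp add: nonneg_integrable_def)
    have "(\<integral>\<^sup>+x. K w x * ennreal (g w x) \<partial>psi)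
        = (\<integral>\<^sup>+x. \<integral>\<^sup>+z. (H (w, z) * (ennreal (lam x (fst z)) * ennreal (gam (fst z) (snd z)))) * ennreal (g w x)
            \<partial>(psi \<Otimes>\<^sub>M theta) \<partial>psi)"
      unfolding K_def
    proof (intro nn_integral_cong nn_integral_multc[symmetric])
      fix x assume "x \<in> space psi"
      note [measurable] = lam_section(2)[OF this]
      show "(\<lambda>z. H (w, z) * (ennreal (lam x (fst z)) * ennreal (gam (fst z) (snd z)))) \<in> borel_measurable (psi \<Otimes>\<^sub>M theta)"
        by measurable
    qed
    also have "\<dots> = (\<integral>\<^sup>+z. \<integral>\<^sup>+x. (H (w, z) * (ennreal (lam x (fst z)) * ennreal (gam (fst z) (snd z)))) * ennreal (g w x)
            \<partial>psi \<partial>(psi \<Otimes>\<^sub>M theta))"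
      by (rule ppt.Fubini'[symmetric]) measurable
    also have "\<dots> = (\<integral>\<^sup>+z. H (w, z) * (ennreal (gam (fst z) (snd z)) * ennreal (predict (g w) (fst z))) \<partial>(psi \<Otimes>\<^sub>M theta))"
    proof (rule nn_integral_cong)
      fix z assume "z \<in> space (psi \<Otimes>\<^sub>M theta)"
      then have u: "fst z \<in> space psi" by (auto simp: space_pair_measure)
      note [measurable] = lam_section(1)[OF u]
      have "(\<integral>\<^sup>+x. (H (w, z) * (ennreal (lam x (fst z)) * ennreal (gam (fst z) (snd z)))) * ennreal (g w x) \<partial>psi)
          = (\<integral>\<^sup>+x. (H (w, z) * ennreal (gam (fst z) (snd z))) * (ennreal (lam x (fst z)) * ennreal (g w x)) \<partial>psi)"
        by (simp add: ac_simps)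
      also have "\<dots> = (H (w, z) * ennreal (gam (fst z) (snd z))) * ennreal (predict (g w) (fst z))"
        by (subst nn_integral_cmult) (measurable, simp add: ennreal_predict[OF gi u])
      finally show "(\<integral>\<^sup>+x. (H (w, z) * (ennreal (lam x (fst z)) * ennreal (gam (fst z) (snd z)))) * ennreal (g w x) \<partial>psi)
          = H (w, z) * (ennreal (gam (fst z) (snd z)) * ennreal (predict (g w) (fst z)))"
        by (simp add: mult.assoc)
    qed
    also have "\<dots> = (\<integral>\<^sup>+v. \<integral>\<^sup>+u. H (w, u, v) * (ennreal (gam u v) * ennreal (predict (g w) u)) \<partial>psi \<partial>theta)"
    proof -
      have "(\<lambda>z. H (w, z) * (ennreal (gam (fst z) (snd z)) * ennreal (predict (g w) (fst z))))
          \<in> borel_measurable (psi \<Otimes>\<^sub>M theta)" by measurable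
      from pt.nn_integral_snd[OF this] show ?thesis by simp
    qed
    finally show "(\<integral>\<^sup>+x. K w x * ennreal (g w x) \<partial>psi)
      = (\<integral>\<^sup>+v. \<integral>\<^sup>+u. H (w, u, v) * (ennreal (gam u v) * ennreal (predict (g w) u)) \<partial>psi \<partial>theta)" .
  qed
  finally show ?thesis .
qed

text \<open>The conditional density of the next observation given the past ones. It is
  \<open>normalizer (f w)\<close> with values in the extended numbers, so that it can be used before almost sure
  finiteness is known.\<close>

definition predictive_density :: "('w \<Rightarrow> 'a \<Rightarrow> real) \<Rightarrow> 'w \<Rightarrow> 'b \<Rightarrow> ennreal" where
  "predictive_density f w v = (\<integral>\<^sup>+u. ennreal (gam u v) * ennreal (predict (f w) u) \<partial>psi)"

lemma observation_law:
  assumes JD: "joint_density (\<lambda>_. 1) n f" and f [measurable]: "case_prod f \<in> borel_measurable (obs n \<Otimes>\<^sub>M psi)"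
    and int: "AE w in P. nonneg_integrable (f w)" and h [measurable]: "h \<in> borel_measurable (obs n \<Otimes>\<^sub>M theta)"
  shows "(\<integral>\<^sup>+w. h (w, Y (Suc n) w) \<partial>P) = (\<integral>\<^sup>+w. \<integral>\<^sup>+v. h (w, v) * predictive_density f w v \<partial>theta \<partial>P)"
proof -
  have hm: "(\<lambda>(w, u, v). h (w, v)) \<in> borel_measurable (obs n \<Otimes>\<^sub>M (psi \<Otimes>\<^sub>M theta))"
    unfolding case_prod_beta' by (rule measurable_compose[OF _ h]) measurable
  have "(\<integral>\<^sup>+w. h (w, Y (Suc n) w) \<partial>P)
      = (\<integral>\<^sup>+w. 1 * (\<lambda>(w, u, v). h (w, v)) (w, X (Suc n) w, Y (Suc n) w) \<partial>P)" by simp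
  also have "\<dots> = (\<integral>\<^sup>+w. \<integral>\<^sup>+v. \<integral>\<^sup>+u. (\<lambda>(w, u, v). h (w, v)) (w, u, v)
      * (ennreal (gam u v) * ennreal (predict (f w) u)) \<partial>psi \<partial>theta \<partial>P)"
    by (rule joint_transition[OF JD f int _ hm]) simp
  also have "\<dots> = (\<integral>\<^sup>+w. \<integral>\<^sup>+v. h (w, v) * predictive_density f w v \<partial>theta \<partial>P)"
    using int
  proof (intro nn_integral_cong_AE, eventually_elim)
    case (elim w)
    then have [measurable]: "f w \<in> borel_measurable psi"
      using borel_measurable_integrable[of psi "f w"] by (simp add: nonneg_integrable_def)
    show ?case
    proof (rule nn_integral_cong)
      fix v assume "v \<in> space theta"
      then have [measurable]: "(\<lambda>u. gam u v) \<in> borel_measurable psi" by measurable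
      have "(\<lambda>u. ennreal (gam u v) * ennreal (predict (f w) u)) \<in> borel_measurable psi" by measurable
      then show "(\<integral>\<^sup>+u. (\<lambda>(w, u, v). h (w, v)) (w, u, v) * (ennreal (gam u v) * ennreal (predict (f w) u)) \<partial>psi)
        = h (w, v) * predictive_density f w v"
        by (simp add: nn_integral_cmult predictive_density_def)
    qed
  qed
  finally show ?thesis .
qed

lemma likelihood_measurable:
  assumes g [measurable]: "case_prod g \<in> borel_measurable (obs n \<Otimes>\<^sub>M psi)" and A [measurable]: "A \<in> sets psi"
  shows "(\<lambda>(w, v). \<integral>\<^sup>+u. indicator A u * (ennreal (gam u v) * ennreal (predict (g w) u)) \<partial>psi)
    \<in> borel_measurable (obs n \<Otimes>\<^sub>M theta)"
proof -
  define p where "p w u = predict (g w) u" for w u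
  have [measurable]: "case_prod p \<in> borel_measurable (obs n \<Otimes>\<^sub>M psi)"
    unfolding p_def by measurable
  have "(\<lambda>(w, v). \<integral>\<^sup>+u. indicator A u * (ennreal (gam u v) * ennreal (p w u)) \<partial>psi)
    \<in> borel_measurable (obs n \<Otimes>\<^sub>M theta)" by measurable
  then show ?thesis by (simp add: p_def)
qed

lemma predictive_density_measurable:
  assumes "case_prod f \<in> borel_measurable (obs n \<Otimes>\<^sub>M psi)"
  shows "case_prod (predictive_density f) \<in> borel_measurable (obs n \<Otimes>\<^sub>M theta)"
  using likelihood_measurable[OF assms sets.top] unfolding predictive_density_def
  by (rule measurable_cong[THEN iffD1, rotated]) (auto intro!: nn_integral_cong)

text \<open>The next observation almost surely avoids the zeros of its own conditional density, and it
  avoids the \<open>theta\<close>-null set on which the likelihood is not integrable.\<close>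

lemma next_observation_regular:
  assumes JD: "joint_density (\<lambda>_. 1) n f" and f [measurable]: "case_prod f \<in> borel_measurable (obs n \<Otimes>\<^sub>M psi)"
    and int: "AE w in P. nonneg_integrable (f w)"
  shows "AE w in P. (\<integral>\<^sup>+u. ennreal (gam u (Y (Suc n) w)) \<partial>psi) \<noteq> \<infinity> \<and>
    0 < normalizer (f w) (Y (Suc n) w)"
proof -
  define Z where "Z = predictive_density f"
  have Zm [measurable]: "case_prod Z \<in> borel_measurable (obs n \<Otimes>\<^sub>M theta)"
    unfolding Z_def by (rule predictive_density_measurable[OF f])
  define G where "G v = (\<integral>\<^sup>+u. ennreal (gam u v) \<partial>psi)" for v
  have Gm [measurable]: "G \<in> borel_measurable theta" unfolding G_def by measurable
  have law: "(\<integral>\<^sup>+w. h (w, Y (Suc n) w) \<partial>P) = (\<integral>\<^sup>+w. \<integral>\<^sup>+v. h (w, v) * Z w v \<partial>theta \<partial>P)"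
    if "h \<in> borel_measurable (obs n \<Otimes>\<^sub>M theta)" for h
    unfolding Z_def by (rule observation_law[OF JD f int that])
  have "(\<integral>\<^sup>+w. (if Z w (Y (Suc n) w) = 0 \<or> G (Y (Suc n) w) = \<infinity> then 1 else 0) \<partial>P)
      = (\<integral>\<^sup>+w. (\<lambda>(w, v). if Z w v = 0 \<or> G v = \<infinity> then 1 else 0) (w, Y (Suc n) w) \<partial>P)" by simp
  also have "\<dots> = (\<integral>\<^sup>+w. \<integral>\<^sup>+v. (\<lambda>(w, v). if Z w v = 0 \<or> G v = \<infinity> then 1 else 0) (w, v) * Z w v \<partial>theta \<partial>P)"
    by (rule law) measurable
  also have "\<dots> = (\<integral>\<^sup>+w. \<integral>\<^sup>+v. 0 \<partial>theta \<partial>P)"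
  proof (rule nn_integral_cong, rule nn_integral_cong_AE)
    fix w
    show "AE v in theta. (\<lambda>(w, v). if Z w v = 0 \<or> G v = \<infinity> then 1 else 0) (w, v) * Z w v = 0"
      using AE_likelihood_finite by eventually_elim (auto simp: G_def)
  qed
  finally have zero: "(\<integral>\<^sup>+w. (if Z w (Y (Suc n) w) = 0 \<or> G (Y (Suc n) w) = \<infinity> then 1 else 0) \<partial>P) = 0" by simp
  have idY [measurable]: "(\<lambda>w. (w, Y (Suc n) w)) \<in> measurable P (obs n \<Otimes>\<^sub>M theta)"
    using id_P_obs by measurable
  have ZY [measurable]: "(\<lambda>w. Z w (Y (Suc n) w)) \<in> borel_measurable P"
    using measurable_compose[OF idY Zm] by simp
  have "AE w in P. (if Z w (Y (Suc n) w) = 0 \<or> G (Y (Suc n) w) = \<infinity> then 1 else 0 :: ennreal) = 0"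
    using zero by (subst (asm) nn_integral_0_iff_AE) measurable
  then show ?thesis using int AE_space
  proof eventually_elim
    case (elim w)
    then have fin: "G (Y (Suc n) w) \<noteq> \<infinity>" and Z: "Z w (Y (Suc n) w) \<noteq> 0" by (auto split: if_splits)
    from ennreal_normalizer(2)[OF Y_space[OF elim(3)] fin[unfolded G_def] elim(2)] Z
    have "ennreal (normalizer (f w) (Y (Suc n) w)) \<noteq> 0" by (simp add: Z_def predictive_density_def)
    then have "0 < normalizer (f w) (Y (Suc n) w)" by (meson ennreal_neg not_le)
    then show ?case using fin by (simp add: G_def)
  qed
qed

lemma obs_Suc_sets:
  assumes "C \<in> sets (obs (Suc n))"
  obtains D where "D \<in> sets (obs n \<Otimes>\<^sub>M theta)" "\<And>w. w \<in> space P \<Longrightarrow> w \<in> C \<longleftrightarrow> (w, Y (Suc n) w) \<in> D"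
proof (rule sets_vimage_pair[OF assms _ Y_Suc_measurable space_obs])
  let ?V = "vimage_algebra (space P) (\<lambda>w. (w, Y (Suc n) w)) (obs n \<Otimes>\<^sub>M theta)"
  note V = measurable_vimage_pair[OF Y_Suc_measurable[of n] space_obs[of n]]
  show "sets (obs (Suc n)) \<subseteq> sets ?V"
    unfolding obs_def[of "Suc n"]
  proof (rule sets_sigma_XY_subset)
    fix j assume "j \<in> {1..Suc n}"
    then consider "j = Suc n" | "j \<in> {1..n}" by (cases "j = Suc n") auto
    then show "Y j \<in> measurable ?V theta"
    proof cases
      case 1 then show ?thesis using V(2) by simp
    next
      case 2
      then have "Y j \<in> measurable (obs n) theta"
        unfolding obs_def by (intro measurable_sigma_XY_snd Y_measurable) auto
      from measurable_compose[OF V(1) this] show ?thesis by simp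
    qed
  qed auto
qed (use that in blast)

text \<open>Bayes' rule. An event of the enlarged past is a test of the old past and the new observation,
  so \<open>joint_transition\<close> expresses its integral with the numerator \<open>N\<close> of Bayes' formula. Multiplying
  and dividing by the conditional density \<open>Z\<close> of the new observation turns this into an integral over
  \<open>w\<close> by \<open>observation_law\<close>. Where \<open>Z\<close> vanishes, so does \<open>N\<close>, because \<open>g\<close> vanishes wherever \<open>f\<close>
  does.\<close>

lemma joint_density_step:
  assumes JDf: "joint_density (\<lambda>_. 1) n f" and f [measurable]: "case_prod f \<in> borel_measurable (obs n \<Otimes>\<^sub>M psi)"
    and fi: "AE w in P. nonneg_integrable (f w)"
    and JDg: "joint_density W n g" and g [measurable]: "case_prod g \<in> borel_measurable (obs n \<Otimes>\<^sub>M psi)"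
    and gi: "AE w in P. nonneg_integrable (g w)"
    and dom: "AE w in P. AE x in psi. f w x = 0 \<longrightarrow> g w x = 0"
    and W: "W \<in> borel_measurable (past n)" and Wfin: "(\<integral>\<^sup>+w. W w \<partial>P) \<noteq> \<infinity>"
    and g'm: "(\<lambda>(w, x). gam x (Y (Suc n) w) * predict (g w) x / normalizer (f w) (Y (Suc n) w))
      \<in> borel_measurable (obs (Suc n) \<Otimes>\<^sub>M psi)"
  shows "joint_density W (Suc n)
    (\<lambda>w x. gam x (Y (Suc n) w) * predict (g w) x / normalizer (f w) (Y (Suc n) w))"
proof (rule joint_densityI[OF past_measurable[OF W] Wfin g'm])
  fix C A assume C: "C \<in> sets (obs (Suc n))" and A [measurable]: "A \<in> sets psi"
  obtain D where D [measurable]: "D \<in> sets (obs n \<Otimes>\<^sub>M theta)" and CD: "\<And>w. w \<in> space P \<Longrightarrow> w \<in> C \<longleftrightarrow> (w, Y (Suc n) w) \<in> D"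
    using obs_Suc_sets[OF C] by blast
  define Z where "Z = predictive_density f"
  define N where "N w v = (\<integral>\<^sup>+u. indicator A u * (ennreal (gam u v) * ennreal (predict (g w) u)) \<partial>psi)" for w v
  have Zm [measurable]: "case_prod Z \<in> borel_measurable (obs n \<Otimes>\<^sub>M theta)"
    unfolding Z_def by (rule predictive_density_measurable[OF f])
  have Nm [measurable]: "case_prod N \<in> borel_measurable (obs n \<Otimes>\<^sub>M theta)"
    using likelihood_measurable[OF g A] unfolding N_def .
  have gmeas: "(\<lambda>u. ennreal (gam u v) * ennreal (predict h u)) \<in> borel_measurable psi"
    if "nonneg_integrable h" "v \<in> space theta" for h v
  proof -
    have [measurable]: "h \<in> borel_measurable psi"
      using that borel_measurable_integrable[of psi h] by (simp add: nonneg_integrable_def)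
    have [measurable]: "(\<lambda>u. gam u v) \<in> borel_measurable psi" using that by measurable
    show ?thesis by measurable
  qed
  have law: "(\<integral>\<^sup>+w. h (w, Y (Suc n) w) \<partial>P) = (\<integral>\<^sup>+w. \<integral>\<^sup>+v. h (w, v) * Z w v \<partial>theta \<partial>P)"
    if "h \<in> borel_measurable (obs n \<Otimes>\<^sub>M theta)" for h
    unfolding Z_def by (rule observation_law[OF JDf f fi that])
  have DA: "(\<lambda>(w, u, v). indicator D (w, v) * indicator A u :: ennreal)
      \<in> borel_measurable (obs n \<Otimes>\<^sub>M (psi \<Otimes>\<^sub>M theta))"
    unfolding case_prod_beta'
  proof (rule borel_measurable_times_ennreal)
    show "(\<lambda>x. indicator D (fst x, snd (snd x)) :: ennreal) \<in> borel_measurable (obs n \<Otimes>\<^sub>M (psi \<Otimes>\<^sub>M theta))"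
      by (rule measurable_compose[OF _ borel_measurable_indicator[OF D]]) measurable
    show "(\<lambda>x. indicator A (fst (snd x)) :: ennreal) \<in> borel_measurable (obs n \<Otimes>\<^sub>M (psi \<Otimes>\<^sub>M theta))"
      by (rule measurable_compose[OF _ borel_measurable_indicator[OF A]]) measurable
  qed
  have "(\<integral>\<^sup>+w. W w * (indicator C w * indicator A (X (Suc n) w)) \<partial>P)
      = (\<integral>\<^sup>+w. W w * (\<lambda>(w, u, v). indicator D (w, v) * indicator A u) (w, X (Suc n) w, Y (Suc n) w) \<partial>P)"
    using CD by (intro nn_integral_cong) (simp add: indicator_def)
  also have "\<dots> = (\<integral>\<^sup>+w. \<integral>\<^sup>+v. \<integral>\<^sup>+u. (\<lambda>(w, u, v). indicator D (w, v) * indicator A u) (w, u, v)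
      * (ennreal (gam u v) * ennreal (predict (g w) u)) \<partial>psi \<partial>theta \<partial>P)"
    by (rule joint_transition[OF JDg g gi W DA])
  also have "\<dots> = (\<integral>\<^sup>+w. \<integral>\<^sup>+v. (\<lambda>(w, v). indicator D (w, v) * (N w v / Z w v)) (w, v) * Z w v \<partial>theta \<partial>P)"
    using fi gi dom AE_space
  proof (intro nn_integral_cong_AE, eventually_elim)
    fix w assume fi: "nonneg_integrable (f w)" and gi: "nonneg_integrable (g w)"
      and dom: "AE x in psi. f w x = 0 \<longrightarrow> g w x = 0"
    show "(\<integral>\<^sup>+v. \<integral>\<^sup>+u. (\<lambda>(w, u, v). indicator D (w, v) * indicator A u) (w, u, v)
        * (ennreal (gam u v) * ennreal (predict (g w) u)) \<partial>psi \<partial>theta)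
      = (\<integral>\<^sup>+v. (\<lambda>(w, v). indicator D (w, v) * (N w v / Z w v)) (w, v) * Z w v \<partial>theta)"
      using AE_likelihood_finite AE_space
    proof (intro nn_integral_cong_AE, eventually_elim)
      fix v assume fin: "(\<integral>\<^sup>+u. ennreal (gam u v) \<partial>psi) \<noteq> \<infinity>" and v: "v \<in> space theta"
      have Zfin: "Z w v \<noteq> \<infinity>"
        unfolding Z_def predictive_density_def ennreal_normalizer(2)[OF v fin fi] by simp
      have NZ: "N w v = N w v / Z w v * Z w v"
      proof (cases "Z w v = 0")
        case True
        then have "AE u in psi. ennreal (gam u v) * ennreal (predict (f w) u) = 0"
          unfolding Z_def predictive_density_def using gmeas[OF fi v] by (subst (asm) nn_integral_0_iff_AE) auto
        then have "AE u in psi. indicator A u * (ennreal (gam u v) * ennreal (predict (g w) u)) = 0"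
          using AE_space
        proof eventually_elim
          case (elim u)
          have "predict (g w) u = 0" if "predict (f w) u \<le> 0"
          proof -
            have "predict (f w) u = 0"
              using that predict_nonneg[OF _ elim(2), of "f w"] fi by (auto simp: nonneg_integrable_def)
            from predict_zero_mono[OF fi gi dom elim(2) this] show ?thesis .
          qed
          then show ?case using elim by (auto simp: ennreal_eq_0_iff)
        qed
        from nn_integral_cong_AE[OF this] have "N w v = 0" unfolding N_def by simp
        then show ?thesis by simp
      next
        case False
        then show ?thesis using Zfin by (simp add: ennreal_divide_times ennreal_divide_self less_top)
      qed
      have "(\<integral>\<^sup>+u. (\<lambda>(w, u, v). indicator D (w, v) * indicator A u) (w, u, v)
          * (ennreal (gam u v) * ennreal (predict (g w) u)) \<partial>psi) = indicator D (w, v) * N w v"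
        unfolding N_def using gmeas[OF gi v] by (subst nn_integral_cmult[symmetric]) (auto simp: mult.assoc)
      also have "\<dots> = indicator D (w, v) * (N w v / Z w v) * Z w v"
        by (subst NZ) (simp add: mult.assoc)
      finally show "(\<integral>\<^sup>+u. (\<lambda>(w, u, v). indicator D (w, v) * indicator A u) (w, u, v)
          * (ennreal (gam u v) * ennreal (predict (g w) u)) \<partial>psi)
        = (\<lambda>(w, v). indicator D (w, v) * (N w v / Z w v)) (w, v) * Z w v" by simp
    qed
  qed
  also have "\<dots> = (\<integral>\<^sup>+w. (\<lambda>(w, v). indicator D (w, v) * (N w v / Z w v)) (w, Y (Suc n) w) \<partial>P)"
    by (rule law[symmetric]) measurable
  also have "\<dots> = (\<integral>\<^sup>+w. \<integral>\<^sup>+x. indicator C w * indicator A x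
      * ennreal (gam x (Y (Suc n) w) * predict (g w) x / normalizer (f w) (Y (Suc n) w)) \<partial>psi \<partial>P)"
    using next_observation_regular[OF JDf f fi] fi gi AE_space
  proof (intro nn_integral_cong_AE, eventually_elim)
    fix w assume r: "(\<integral>\<^sup>+u. ennreal (gam u (Y (Suc n) w)) \<partial>psi) \<noteq> \<infinity> \<and> 0 < normalizer (f w) (Y (Suc n) w)"
      and fi: "nonneg_integrable (f w)" and gi: "nonneg_integrable (g w)" and w: "w \<in> space P"
    let ?v = "Y (Suc n) w" and ?z = "normalizer (f w) (Y (Suc n) w)"
    have v: "?v \<in> space theta" by (rule Y_space[OF w])
    have Z: "Z w ?v = ennreal ?z" unfolding Z_def predictive_density_def using ennreal_normalizer(2)[OF v _ fi] r by simp
    have "(\<integral>\<^sup>+x. indicator C w * indicator A x * ennreal (gam x ?v * predict (g w) x / ?z) \<partial>psi)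
        = (\<integral>\<^sup>+x. indicator C w * ((indicator A x * (ennreal (gam x ?v) * ennreal (predict (g w) x))) / ennreal ?z) \<partial>psi)"
    proof (rule nn_integral_cong)
      fix x assume x: "x \<in> space psi"
      have "0 \<le> gam x ?v" "0 \<le> predict (g w) x"
        using gam_nonneg[OF x v] predict_nonneg[OF _ x, of "g w"] gi by (auto simp: nonneg_integrable_def)
      then have "ennreal (gam x ?v * predict (g w) x / ?z) = ennreal (gam x ?v) * ennreal (predict (g w) x) / ennreal ?z"
        using r by (simp add: divide_ennreal[symmetric] ennreal_mult)
      then show "indicator C w * indicator A x * ennreal (gam x ?v * predict (g w) x / ?z)
          = indicator C w * ((indicator A x * (ennreal (gam x ?v) * ennreal (predict (g w) x))) / ennreal ?z)"
        by (simp add: mult.assoc ennreal_times_divide)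
    qed
    also have "\<dots> = indicator C w * (N w ?v / ennreal ?z)"
      unfolding N_def using gmeas[OF gi v]
      by (subst nn_integral_cmult, measurable, subst nn_integral_divide) auto
    finally show "(\<lambda>(w, v). indicator D (w, v) * (N w v / Z w v)) (w, ?v)
        = (\<integral>\<^sup>+x. indicator C w * indicator A x * ennreal (gam x ?v * predict (g w) x / ?z) \<partial>psi)"
      using CD[OF w] Z by (simp add: indicator_def)
  qed
  finally show "(\<integral>\<^sup>+w. W w * (indicator C w * indicator A (X (Suc n) w)) \<partial>P)
     = (\<integral>\<^sup>+w. \<integral>\<^sup>+x. indicator C w * indicator A x
      * ennreal (gam x (Y (Suc n) w) * predict (g w) x / normalizer (f w) (Y (Suc n) w)) \<partial>psi \<partial>P)" .
qed

end

section \<open>The filtering recursion computes conditional densities\<close>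

context hidden_markov_filter
begin

abbreviation path :: "'w \<Rightarrow> nat \<Rightarrow> 'b" where "path w \<equiv> \<lambda>k. Y k w"

lemma mu_measurable [measurable]: "mu \<in> borel_measurable psi"
  and mu_nonneg: "x \<in> space psi \<Longrightarrow> 0 \<le> mu x"
  using mu by (auto simp: prob_density_def)

lemma nn_integral_X0:
  assumes [measurable]: "h \<in> borel_measurable psi"
  shows "(\<integral>\<^sup>+w. h (X 0 w) \<partial>P) = (\<integral>\<^sup>+x. ennreal (mu x) * h x \<partial>psi)"
proof -
  have "(\<integral>\<^sup>+w. h (X 0 w) \<partial>P) = (\<integral>\<^sup>+x. h x \<partial>distr P psi (X 0))"
    by (rule nn_integral_distr[symmetric]) measurable
  also have "\<dots> = (\<integral>\<^sup>+x. ennreal (mu x) * h x \<partial>psi)"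
    unfolding initial_law by (rule nn_integral_density) measurable
  finally show ?thesis .
qed

lemma sets_obs_0: "sets (obs 0) = {{}, space P}"
proof -
  have "sets (obs 0) = sigma_sets (space P) {}"
    unfolding obs_def sets_sigma_XY by (rule arg_cong[where f="sigma_sets (space P)"]) auto
  then show ?thesis by (simp add: sigma_sets_empty_eq)
qed

text \<open>At time zero the observed sigma-algebra is trivial, so only the law of \<open>X 0\<close> enters.\<close>

lemma joint_density_initial:
  assumes om [measurable]: "om \<in> borel_measurable psi" and om_nn: "\<And>x. x \<in> space psi \<Longrightarrow> 0 \<le> om x"
    and g0: "prob_density psi g0" and eq: "\<And>x. x \<in> space psi \<Longrightarrow> g0 x = mu x * om x"
  shows "joint_density (\<lambda>w. ennreal (om (X 0 w))) 0 (\<lambda>w. g0)"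
proof (rule joint_densityI)
  have [measurable]: "g0 \<in> borel_measurable psi" using g0 by (simp add: prob_density_def)
  have law: "(\<integral>\<^sup>+w. ennreal (om (X 0 w)) * h (X 0 w) \<partial>P) = (\<integral>\<^sup>+x. h x * ennreal (g0 x) \<partial>psi)"
    if [measurable]: "h \<in> borel_measurable psi" for h
  proof -
    have "(\<lambda>x. ennreal (om x) * h x) \<in> borel_measurable psi" by measurable
    from nn_integral_X0[OF this] show ?thesis
      using eq om_nn mu_nonneg by (auto intro!: nn_integral_cong simp: ennreal_mult ac_simps)
  qed
  show "(\<lambda>w. ennreal (om (X 0 w))) \<in> borel_measurable P" by measurable
  show "(\<integral>\<^sup>+w. ennreal (om (X 0 w)) \<partial>P) \<noteq> \<infinity>"
    using law[of "\<lambda>_. 1"] g0 by (simp add: prob_density_def)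
  show "(\<lambda>(w, x). g0 x) \<in> borel_measurable (obs 0 \<Otimes>\<^sub>M psi)" by measurable
  fix C A assume C: "C \<in> sets (obs 0)" and A [measurable]: "A \<in> sets psi"
  from C consider "C = {}" | "C = space P" by (auto simp: sets_obs_0)
  then show "(\<integral>\<^sup>+w. ennreal (om (X 0 w)) * (indicator C w * indicator A (X 0 w)) \<partial>P)
      = (\<integral>\<^sup>+w. \<integral>\<^sup>+x. indicator C w * indicator A x * ennreal (g0 x) \<partial>psi \<partial>P)"
  proof cases
    case 2
    have "(\<integral>\<^sup>+w. ennreal (om (X 0 w)) * (indicator C w * indicator A (X 0 w)) \<partial>P)
        = (\<integral>\<^sup>+w. ennreal (om (X 0 w)) * indicator A (X 0 w) \<partial>P)"
      using 2 by (intro nn_integral_cong) simp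
    also have "\<dots> = (\<integral>\<^sup>+w. \<integral>\<^sup>+x. indicator A x * ennreal (g0 x) \<partial>psi \<partial>P)"
      using law[of "indicator A"] by (simp add: emeasure_space_1)
    also have "\<dots> = (\<integral>\<^sup>+w. \<integral>\<^sup>+x. indicator C w * indicator A x * ennreal (g0 x) \<partial>psi \<partial>P)"
      using 2 by (intro nn_integral_cong) simp
    finally show ?thesis .
  qed simp
qed

lemma companion_joint_measurable:
  assumes "eta \<in> borel_measurable psi"
  shows "(\<lambda>(w, x). companion mu eta (path w) n x) \<in> borel_measurable (obs n \<Otimes>\<^sub>M psi)"
  using assms
proof (induction n arbitrary: eta)
  case 0
  then show ?case by simp
next
  case (Suc n)
  have lift: "case_prod g \<in> borel_measurable (obs (Suc n) \<Otimes>\<^sub>M psi)"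
    if g: "case_prod g \<in> borel_measurable (obs n \<Otimes>\<^sub>M psi)" for g :: "'w \<Rightarrow> 'a \<Rightarrow> real"
  proof -
    have "(\<lambda>x. (fst x, snd x)) \<in> measurable (obs (Suc n) \<Otimes>\<^sub>M psi) (obs n \<Otimes>\<^sub>M psi)"
      using measurable_compose[OF measurable_fst id_obs_Suc] by (intro measurable_Pair) auto
    from measurable_compose[OF this g] show ?thesis by (simp add: case_prod_beta')
  qed
  define f where "f w = companion mu mu (path w) n" for w
  define g where "g w = companion mu eta (path w) n" for w
  have fm [measurable]: "case_prod f \<in> borel_measurable (obs (Suc n) \<Otimes>\<^sub>M psi)"
    unfolding f_def[abs_def] by (rule lift[OF Suc.IH[OF mu_measurable]])
  have gm [measurable]: "case_prod g \<in> borel_measurable (obs (Suc n) \<Otimes>\<^sub>M psi)"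
    unfolding g_def[abs_def] by (rule lift[OF Suc.IH[OF Suc.prems]])
  let ?Q = "obs (Suc n) \<Otimes>\<^sub>M psi"
  have "(\<lambda>w. normalizer (f w) (Y (Suc n) w)) \<in> borel_measurable (obs (Suc n))"
    by (rule normalizer_measurable[OF fm Y_obs])
  from measurable_compose[OF measurable_fst this]
  have Z: "(\<lambda>x. normalizer (f (fst x)) (Y (Suc n) (fst x))) \<in> borel_measurable ?Q" .
  have p: "(\<lambda>x. predict (g (fst x)) (snd x)) \<in> borel_measurable ?Q"
    using predict_joint_measurable[OF gm] by (simp add: case_prod_beta')
  have "(\<lambda>x. (snd x, Y (Suc n) (fst x))) \<in> measurable ?Q (psi \<Otimes>\<^sub>M theta)"
    by (intro measurable_Pair measurable_snd measurable_compose[OF measurable_fst Y_obs])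
  from measurable_compose[OF this gam_measurable]
  have "(\<lambda>x. gam (snd x) (Y (Suc n) (fst x))) \<in> borel_measurable ?Q" by simp
  with Z p have "(\<lambda>x. gam (snd x) (Y (Suc n) (fst x)) * predict (g (fst x)) (snd x)
      / normalizer (f (fst x)) (Y (Suc n) (fst x))) \<in> borel_measurable ?Q"
    by (intro borel_measurable_divide borel_measurable_times)
  then show ?case by (simp add: f_def g_def companion_self case_prod_beta')
qed

lemma filter_joint_measurable:
  "(\<lambda>(w, x). filter mu (path w) n x) \<in> borel_measurable (obs n \<Otimes>\<^sub>M psi)"
  using companion_joint_measurable[OF mu_measurable] by (simp add: companion_self)

text \<open>The two parts need each other: regularity of the next step is a statement about the law of the
  next observation, which the density determines, and the density survives the step on regular
  paths.\<close>

lemma filter_joint_density_and_regular: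
  "joint_density (\<lambda>_. 1) n (\<lambda>w. filter mu (path w) n) \<and> (AE w in P. \<forall>k<n. regular mu (path w) k)"
proof (induction n)
  case 0
  show ?case using joint_density_initial[of "\<lambda>_. 1" mu] mu by simp
next
  case (Suc n)
  let ?f = "\<lambda>w. filter mu (path w) n"
  have JD: "joint_density (\<lambda>_. 1) n ?f" and reg: "AE w in P. \<forall>k<n. regular mu (path w) k"
    using Suc by auto
  have fi: "AE w in P. nonneg_integrable (?f w)"
    using reg by eventually_elim (rule filter_prob_density(1)[OF mu], simp)
  have "AE w in P. \<forall>k<Suc n. regular mu (path w) k"
    using reg next_observation_regular[OF JD filter_joint_measurable fi] fi AE_space
  proof eventually_elim
    case (elim w)
    have "regular mu (path w) n"
      unfolding regular_def using elim Y_space[of w n] ennreal_normalizer(1)[of "Y (Suc n) w" "?f w"] by auto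
    then show ?case using elim by (auto simp: less_Suc_eq)
  qed
  moreover have "joint_density (\<lambda>_. 1) (Suc n) (\<lambda>w x. gam x (Y (Suc n) w) * predict (?f w) x
      / normalizer (?f w) (Y (Suc n) w))"
    by (rule joint_density_step[OF JD filter_joint_measurable fi JD filter_joint_measurable fi])
      (use filter_joint_measurable[of "Suc n", unfolded filter_Suc] in \<open>auto simp: emeasure_space_1\<close>)
  ultimately show ?case by (simp only: filter_Suc[abs_def] simp_thms)
qed

lemma filter_joint_density: "joint_density (\<lambda>_. 1) n (\<lambda>w. filter mu (path w) n)"
  using filter_joint_density_and_regular by blast

lemma AE_regular: "AE w in P. \<forall>k. regular mu (path w) k"
proof -
  have "AE w in P. \<forall>n. \<forall>k<n. regular mu (path w) k"
    using filter_joint_density_and_regular by (subst AE_all_countable) blast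
  then show ?thesis by eventually_elim blast
qed

text \<open>The weight is the ratio of the initial densities. The support condition on the initial densities
  propagates to all times, as Bayes' rule requires.\<close>

lemma companion_joint_density:
  assumes eta: "prob_density psi eta" and ac: "\<And>x. x \<in> space psi \<Longrightarrow> mu x = 0 \<Longrightarrow> eta x = 0"
  shows "joint_density (\<lambda>w. ennreal (eta (X 0 w) / mu (X 0 w))) n (\<lambda>w. companion mu eta (path w) n)"
proof (induction n)
  case 0
  have [measurable]: "eta \<in> borel_measurable psi" using eta by (simp add: prob_density_def)
  show ?case
    unfolding companion.simps
    by (rule joint_density_initial[OF _ _ eta])
      (use eta ac mu_nonneg in \<open>auto simp: prob_density_def field_simps\<close>)
next
  case (Suc n)
  have em [measurable]: "eta \<in> borel_measurable psi" using eta by (simp add: prob_density_def)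
  let ?f = "\<lambda>w. filter mu (path w) n" and ?g = "\<lambda>w. companion mu eta (path w) n"
  have fi: "AE w in P. nonneg_integrable (?f w)"
    using AE_regular by eventually_elim (rule filter_prob_density(1)[OF mu], simp)
  have gi: "AE w in P. nonneg_integrable (?g w)"
    using AE_regular
    by eventually_elim (rule companion_integrable[OF prob_density_integrable(1)[OF eta]], simp)
  have dom: "AE w in P. AE x in psi. ?f w x = 0 \<longrightarrow> ?g w x = 0"
    using AE_regular
  proof eventually_elim
    case (elim w)
    interpret coupled_filters psi lam L b "filter mu (path w)" "companion mu eta (path w)"
      "\<lambda>n x. gam x (path w (Suc n)) / normalizer (filter mu (path w) n) (path w (Suc n))"
      by (rule coupled_filters_companion[OF mu eta]) (use elim in blast)
    show ?case by (rule G_dominated) (use ac in \<open>auto intro!: AE_I2\<close>)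
  qed
  have W: "(\<lambda>w. ennreal (eta (X 0 w) / mu (X 0 w))) \<in> borel_measurable (past n)"
  proof -
    have [measurable]: "X 0 \<in> measurable (past n) psi"
      unfolding past_def by (rule measurable_sigma_XY_fst) auto
    show ?thesis by measurable
  qed
  have Wfin: "(\<integral>\<^sup>+w. ennreal (eta (X 0 w) / mu (X 0 w)) \<partial>P) \<noteq> \<infinity>"
  proof -
    have "(\<integral>\<^sup>+w. ennreal (eta (X 0 w) / mu (X 0 w)) \<partial>P)
        = (\<integral>\<^sup>+x. ennreal (mu x) * ennreal (eta x / mu x) \<partial>psi)"
      by (rule nn_integral_X0) measurable
    also have "\<dots> = (\<integral>\<^sup>+x. ennreal (eta x) \<partial>psi)"
    proof (rule nn_integral_cong)
      fix x assume x: "x \<in> space psi"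
      show "ennreal (mu x) * ennreal (eta x / mu x) = ennreal (eta x)"
        using ac[OF x] mu_nonneg[OF x] eta x
        by (cases "mu x = 0") (auto simp: ennreal_mult[symmetric] prob_density_def)
    qed
    finally show ?thesis using eta by (simp add: prob_density_def)
  qed
  have "joint_density (\<lambda>w. ennreal (eta (X 0 w) / mu (X 0 w))) (Suc n)
    (\<lambda>w x. gam x (Y (Suc n) w) * predict (?g w) x / normalizer (?f w) (Y (Suc n) w))"
    by (rule joint_density_step[OF filter_joint_density filter_joint_measurable fi Suc
          companion_joint_measurable[OF em] gi dom W Wfin])
      (use companion_joint_measurable[OF em, of "Suc n"] in simp)
  then show ?case by simp
qed

definition post :: "nat \<Rightarrow> 'w \<Rightarrow> 'a \<Rightarrow> real" where
  "post n w = filter mu (path w) n"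

definition comp :: "('a \<Rightarrow> real) \<Rightarrow> nat \<Rightarrow> 'w \<Rightarrow> 'a \<Rightarrow> real" where
  "comp eta n w = companion mu eta (path w) n"

definition regular_path :: "'w \<Rightarrow> bool" where
  "regular_path w \<longleftrightarrow> (\<forall>k. regular mu (path w) k)"

lemma post_measurable [measurable]: "case_prod (post n) \<in> borel_measurable (obs n \<Otimes>\<^sub>M psi)"
  using filter_joint_measurable unfolding post_def .

lemma comp_measurable:
  "eta \<in> borel_measurable psi \<Longrightarrow> case_prod (comp eta n) \<in> borel_measurable (obs n \<Otimes>\<^sub>M psi)"
  using companion_joint_measurable unfolding comp_def .

lemma post_density: "joint_density (\<lambda>_. 1) n (post n)"
  using filter_joint_density unfolding post_def[abs_def] .

lemma AE_regular_path: "AE w in P. regular_path w"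
  using AE_regular unfolding regular_path_def .

lemma post_prob:
  assumes "regular_path w"
  shows "nonneg_integrable (post n w)" "(\<integral>x. post n w x \<partial>psi) = 1"
  using filter_prob_density[OF mu] assms unfolding post_def regular_path_def by auto

lemma coupled_path:
  assumes "prob_density psi eta" "regular_path w"
  shows "coupled_filters psi lam L b (\<lambda>n. post n w) (\<lambda>n. comp eta n w)
    (\<lambda>n x. gam x (Y (Suc n) w) / normalizer (post n w) (Y (Suc n) w))"
  using coupled_filters_companion[OF mu assms(1), of "path w"] assms(2)
  by (simp add: post_def comp_def regular_path_def)

end

section \<open>The law of large numbers for the filter\<close>

locale stationary_hidden_markov = hidden_markov_filter psi lam L b theta gam P mu X Y +
  stationary_kernel psi lam L b m
  for psi :: "'a measure" and lam L b and theta :: "'b measure" and gam and P :: "'w measure"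
    and mu X Y m
begin

definition filtered :: "('a \<Rightarrow> real) \<Rightarrow> nat \<Rightarrow> 'w \<Rightarrow> real" where
  "filtered h n w = (\<integral>x. h x * post n w x \<partial>psi)"

lemma filtered_measurable:
  assumes [measurable]: "h \<in> borel_measurable psi"
  shows "filtered h n \<in> borel_measurable (obs n)"
  unfolding filtered_def[abs_def] by measurable

lemma filtered_integrable:
  assumes h: "bounded_fun C h" and reg: "regular_path w"
  shows "integrable psi (\<lambda>x. h x * post n w x)"
  using bounded_mult_integrable[OF h, of "post n w"] post_prob(1)[OF reg]
  by (simp add: nonneg_integrable_def mult.commute)

lemma filtered_bounds:
  assumes h: "bounded_fun C h" and reg: "regular_path w"
  shows "0 \<le> filtered h n w" "filtered h n w \<le> C"
proof -
  have f: "integrable psi (post n w)" "\<And>x. x \<in> space psi \<Longrightarrow> 0 \<le> post n w x"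
    using post_prob(1)[OF reg] by (auto simp: nonneg_integrable_def)
  show "0 \<le> filtered h n w"
    unfolding filtered_def using h f(2) by (intro integral_nonneg_AE AE_I2) (auto simp: bounded_fun_def)
  have "filtered h n w \<le> (\<integral>x. C * post n w x \<partial>psi)"
    unfolding filtered_def using h f filtered_integrable[OF h reg]
    by (intro integral_mono) (auto simp: bounded_fun_def intro!: mult_right_mono)
  then show "filtered h n w \<le> C" using post_prob(2)[OF reg] by simp
qed

lemma nn_integral_filtered:
  assumes h: "bounded_fun C h" and V [measurable]: "V \<in> borel_measurable (obs n)"
  shows "(\<integral>\<^sup>+w. V w * ennreal (h (X n w)) \<partial>P) = (\<integral>\<^sup>+w. V w * ennreal (filtered h n w) \<partial>P)"
proof -
  have [measurable]: "h \<in> borel_measurable psi" using h by (simp add: bounded_fun_def)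
  have Hm: "(\<lambda>(w, x). V w * ennreal (h x)) \<in> borel_measurable (obs n \<Otimes>\<^sub>M psi)" by measurable
  have "(\<integral>\<^sup>+w. V w * ennreal (h (X n w)) \<partial>P)
      = (\<integral>\<^sup>+w. \<integral>\<^sup>+x. (V w * ennreal (h x)) * ennreal (post n w x) \<partial>psi \<partial>P)"
    using post_density[of n, unfolded joint_density_def, rule_format, OF Hm] by simp
  also have "\<dots> = (\<integral>\<^sup>+w. V w * ennreal (filtered h n w) \<partial>P)"
    using AE_regular_path
  proof (intro nn_integral_cong_AE, eventually_elim)
    case (elim w)
    have f: "integrable psi (post n w)" "\<And>x. x \<in> space psi \<Longrightarrow> 0 \<le> post n w x"
      using post_prob(1)[OF elim(2)] by (auto simp: nonneg_integrable_def)
    have "(\<integral>\<^sup>+x. (V w * ennreal (h x)) * ennreal (post n w x) \<partial>psi)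
        = (\<integral>\<^sup>+x. V w * ennreal (h x * post n w x) \<partial>psi)"
      using h f(2) by (intro nn_integral_cong) (auto simp: bounded_fun_def ennreal_mult mult.assoc)
    also have "\<dots> = V w * (\<integral>\<^sup>+x. ennreal (h x * post n w x) \<partial>psi)"
      using filtered_integrable[OF h elim(2), of n] by (intro nn_integral_cmult) auto
    also have "(\<integral>\<^sup>+x. ennreal (h x * post n w x) \<partial>psi) = ennreal (filtered h n w)"
      unfolding filtered_def using h f(2) filtered_integrable[OF h elim(2)]
      by (intro nn_integral_eq_integral AE_I2) (auto simp: bounded_fun_def)
    finally show ?case .
  qed
  finally show ?thesis .
qed

text \<open>Both sides are expectations of \<open>V h (X (Suc n))\<close>. Thus \<open>filtered (forward h) n\<close> is the
  conditional expectation of \<open>filtered h (Suc n)\<close> given the first \<open>n\<close> observations.\<close>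

lemma nn_integral_innovation:
  assumes h: "bounded_fun C h" and V [measurable]: "V \<in> borel_measurable (obs n)"
  shows "(\<integral>\<^sup>+w. V w * ennreal (filtered h (Suc n) w) \<partial>P) = (\<integral>\<^sup>+w. V w * ennreal (filtered (forward h) n w) \<partial>P)"
proof -
  have hm [measurable]: "h \<in> borel_measurable psi" using h by (simp add: bounded_fun_def)
  note [measurable] = id_past_obs
  have VS: "V \<in> borel_measurable (obs (Suc n))"
    using measurable_compose[OF id_obs_Suc V] by simp
  have Vp: "V \<in> borel_measurable (past n)"
    using measurable_compose[OF id_past_obs V] by simp
  have m: "(\<lambda>(w, u, v). V w * ennreal (h u)) \<in> borel_measurable (past n \<Otimes>\<^sub>M (psi \<Otimes>\<^sub>M theta))"
    using Vp by measurable
  have "(\<integral>\<^sup>+w. V w * ennreal (filtered h (Suc n) w) \<partial>P) = (\<integral>\<^sup>+w. V w * ennreal (h (X (Suc n) w)) \<partial>P)"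
    by (rule nn_integral_filtered[OF h VS, symmetric])
  also have "\<dots> = (\<integral>\<^sup>+w. \<integral>\<^sup>+u. \<integral>\<^sup>+v. (V w * ennreal (h u)) * (ennreal (lam (X n w) u) * ennreal (gam u v)) \<partial>theta \<partial>psi \<partial>P)"
    using transition_law[OF m] by simp
  also have "\<dots> = (\<integral>\<^sup>+w. V w * ennreal (forward h (X n w)) \<partial>P)"
  proof (rule nn_integral_cong)
    fix w assume w: "w \<in> space P"
    have x: "X n w \<in> space psi" by (rule X_space[OF w])
    note [measurable] = lam_section(2)[OF x]
    have "(\<integral>\<^sup>+u. \<integral>\<^sup>+v. (V w * ennreal (h u)) * (ennreal (lam (X n w) u) * ennreal (gam u v)) \<partial>theta \<partial>psi)
        = (\<integral>\<^sup>+u. V w * ennreal (lam (X n w) u * h u) \<partial>psi)"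
    proof (rule nn_integral_cong)
      fix u assume u: "u \<in> space psi"
      have [measurable]: "(\<lambda>v. gam u v) \<in> borel_measurable theta" using u by measurable
      have "(\<integral>\<^sup>+v. (V w * ennreal (h u)) * (ennreal (lam (X n w) u) * ennreal (gam u v)) \<partial>theta)
          = (\<integral>\<^sup>+v. (V w * ennreal (lam (X n w) u * h u)) * ennreal (gam u v) \<partial>theta)"
        using h u lam_nonneg[OF x u] by (simp add: bounded_fun_def ennreal_mult ac_simps)
      also have "\<dots> = (V w * ennreal (lam (X n w) u * h u))"
        by (subst nn_integral_cmult) (auto simp: nn_integral_gam[OF u])
      finally show "(\<integral>\<^sup>+v. (V w * ennreal (h u)) * (ennreal (lam (X n w) u) * ennreal (gam u v)) \<partial>theta)
        = V w * ennreal (lam (X n w) u * h u)" .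
    qed
    also have "\<dots> = V w * (\<integral>\<^sup>+u. ennreal (lam (X n w) u * h u) \<partial>psi)"
      by (rule nn_integral_cmult) measurable
    also have "(\<integral>\<^sup>+u. ennreal (lam (X n w) u * h u) \<partial>psi) = ennreal (forward h (X n w))"
      unfolding forward_def using h lam_nonneg[OF x] bounded_mult_integrable[OF h integrable_lam[OF x]]
      by (intro nn_integral_eq_integral AE_I2) (auto simp: bounded_fun_def)
    finally show "(\<integral>\<^sup>+u. \<integral>\<^sup>+v. (V w * ennreal (h u)) * (ennreal (lam (X n w) u) * ennreal (gam u v)) \<partial>theta \<partial>psi)
      = V w * ennreal (forward h (X n w))" .
  qed
  also have "\<dots> = (\<integral>\<^sup>+w. V w * ennreal (filtered (forward h) n w) \<partial>P)"
    by (rule nn_integral_filtered[OF forward_bounded[OF h] V])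
  finally show ?thesis .
qed

text \<open>The identity for nonnegative test functions extends to a bounded \<open>V\<close> by applying it to \<open>V + B\<close> and
  to the constant \<open>B\<close>.\<close>

lemma innovation_orthogonal:
  assumes h: "bounded_fun C h" and V [measurable]: "V \<in> borel_measurable (obs n)"
    and Vb: "\<And>w. w \<in> space P \<Longrightarrow> \<bar>V w\<bar> \<le> B"
  shows "expectation (\<lambda>w. V w * (filtered (forward h) n w - filtered h (Suc n) w)) = 0"
proof -
  let ?U = "filtered (forward h) n" and ?T = "filtered h (Suc n)"
  have "forward h \<in> borel_measurable psi" "h \<in> borel_measurable psi"
    using forward_bounded[OF h] h by (auto simp: bounded_fun_def)
  from this[THEN filtered_measurable, THEN obs_measurable]
  have [measurable]: "?U \<in> borel_measurable P" "?T \<in> borel_measurable P" .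
  have [measurable]: "V \<in> borel_measurable P" by (rule obs_measurable[OF V])
  have bU: "AE w in P. 0 \<le> ?U w \<and> ?U w \<le> C"
    using AE_regular_path by eventually_elim (intro conjI filtered_bounds[OF forward_bounded[OF h]])
  have bT: "AE w in P. 0 \<le> ?T w \<and> ?T w \<le> C"
    using AE_regular_path by eventually_elim (intro conjI filtered_bounds[OF h])
  have key: "expectation (\<lambda>w. V' w * ?U w) = expectation (\<lambda>w. V' w * ?T w)"
    if V'm: "V' \<in> borel_measurable (obs n)" and V': "\<And>w. w \<in> space P \<Longrightarrow> 0 \<le> V' w" for V'
  proof -
    have [measurable]: "V' \<in> borel_measurable P" by (rule obs_measurable[OF V'm])
    have eqn: "(\<integral>\<^sup>+w. ennreal (V' w * F w) \<partial>P) = (\<integral>\<^sup>+w. ennreal (V' w) * ennreal (F w) \<partial>P)" for F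
      using V' by (intro nn_integral_cong) (simp add: ennreal_mult')
    have nnU: "AE w in P. 0 \<le> V' w * ?U w"
      using bU AE_space by eventually_elim (use V' in auto)
    have nnT: "AE w in P. 0 \<le> V' w * ?T w"
      using bT AE_space by eventually_elim (use V' in auto)
    have "(\<integral>\<^sup>+w. ennreal (V' w * ?U w) \<partial>P) = (\<integral>\<^sup>+w. ennreal (V' w * ?T w) \<partial>P)"
      unfolding eqn using nn_integral_innovation[OF h, of "\<lambda>w. ennreal (V' w)" n] V'm by simp
    then show ?thesis
      using nnU nnT by (simp add: integral_eq_nn_integral)
  qed
  have VB: "(\<lambda>w. V w + B) \<in> borel_measurable (obs n)" by measurable
  have V0: "0 \<le> V w + B" if "w \<in> space P" for w using Vb[OF that] by linarith
  obtain w0 where "w0 \<in> space P" using not_empty by blast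
  from order_trans[OF abs_ge_zero Vb[OF this]] have B: "0 \<le> B" .
  have int: "integrable P ?U" "integrable P ?T"
  proof -
    have "AE w in P. norm (?U w) \<le> C" using bU by eventually_elim simp
    then show "integrable P ?U" by (rule integrable_const_bound) measurable
    have "AE w in P. norm (?T w) \<le> C" using bT by eventually_elim simp
    then show "integrable P ?T" by (rule integrable_const_bound) measurable
  qed
  have intV: "integrable P (\<lambda>w. V w * F w)" if F: "integrable P F" for F :: "'w \<Rightarrow> real"
  proof (rule Bochner_Integration.integrable_bound)
    show "integrable P (\<lambda>w. B * F w)" using F by simp
    have [measurable]: "F \<in> borel_measurable P" using F by (rule borel_measurable_integrable)
    show "(\<lambda>w. V w * F w) \<in> borel_measurable P" by measurable
    show "AE w in P. norm (V w * F w) \<le> norm (B * F w)"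
      using Vb B by (intro AE_I2) (auto simp: abs_mult intro!: mult_right_mono)
  qed
  have "expectation (\<lambda>w. (V w + B) * ?U w) = expectation (\<lambda>w. (V w + B) * ?T w)"
    by (rule key[OF VB V0])
  moreover have "expectation (\<lambda>w. B * ?U w) = expectation (\<lambda>w. B * ?T w)"
    using B by (intro key) auto
  moreover have ex: "expectation (\<lambda>w. (V w + B) * F w) = expectation (\<lambda>w. V w * F w) + expectation (\<lambda>w. B * F w)"
    if "integrable P F" for F
    using intV[OF that] that by (subst Bochner_Integration.integral_add[symmetric]) (auto simp: algebra_simps)
  ultimately have "expectation (\<lambda>w. V w * ?U w) = expectation (\<lambda>w. V w * ?T w)"
    using ex[OF int(1)] ex[OF int(2)] by linarith
  then show ?thesis
    using intV[OF int(1)] intV[OF int(2)] by (simp add: right_diff_distrib)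
qed

lemma innovation_averages:
  assumes h: "bounded_fun C h"
  shows "AE w in P. (\<lambda>n. (\<Sum>i<n. filtered (forward h) i w - filtered h (Suc i) w) / real n) \<longlonglongrightarrow> 0"
proof -
  define D where "D n w = filtered (forward h) n w - filtered h (Suc n) w" for n w
  \<comment> \<open>On the null set of irregular paths the filter may fail to be a density, so the bound is
    enforced by truncation.\<close>
  define D' where "D' n w = max (- C) (min C (D n w))" for n w
  have hm: "h \<in> borel_measurable psi" "forward h \<in> borel_measurable psi"
    using h forward_bounded[OF h] by (auto simp: bounded_fun_def)
  have Dm: "D n \<in> borel_measurable (obs (Suc n))" for n
    unfolding D_def[abs_def] using filtered_measurable[OF hm(1), of "Suc n"]
      measurable_compose[OF id_obs_Suc filtered_measurable[OF hm(2), of n]] by simp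
  have D'm: "D' n \<in> borel_measurable (obs (Suc n))" for n
    unfolding D'_def[abs_def] using Dm[of n] by measurable
  have C: "0 \<le> C" using h space_ne by (auto simp: bounded_fun_def intro: order_trans)
  have D'D: "AE w in P. \<forall>n. D' n w = D n w"
    using AE_regular_path
  proof eventually_elim
    case (elim w)
    then show ?case
      using filtered_bounds[OF h elim] filtered_bounds[OF forward_bounded[OF h] elim]
      by (auto simp: D'_def D_def max_def min_def) (smt (verit, ccfv_SIG))+
  qed
  have "AE w in P. (\<lambda>n. (\<Sum>i<n. D' i w) / real n) \<longlonglongrightarrow> 0"
  proof (rule orthogonal_averages_tendsto_0)
    show "D' n \<in> borel_measurable P" for n by (rule obs_measurable[OF D'm])
    show "\<bar>D' n w\<bar> \<le> C" for n w using C by (auto simp: D'_def)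
    fix i j :: nat assume "i < j"
    have "D' i \<in> borel_measurable (obs j)"
    proof -
      have "(\<lambda>w. w) \<in> measurable (obs j) (obs (Suc i))"
        using \<open>i < j\<close> unfolding obs_def
        by (intro measurable_ident_mono sets_sigma_XY_mono) (auto simp: subset_eq)
      from measurable_compose[OF this D'm] show ?thesis by simp
    qed
    then have "expectation (\<lambda>w. D' i w * D j w) = 0"
      unfolding D_def by (rule innovation_orthogonal[OF h, where B=C]) (use C in \<open>auto simp: D'_def\<close>)
    moreover have "expectation (\<lambda>w. D' i w * D' j w) = expectation (\<lambda>w. D' i w * D j w)"
      using D'D obs_measurable[OF Dm] obs_measurable[OF D'm]
      by (intro integral_cong_AE) (auto elim!: eventually_mono)
    ultimately show "expectation (\<lambda>w. D' i w * D' j w) = 0" by simp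
  qed
  then show ?thesis using D'D
    by eventually_elim (simp add: D_def[symmetric])
qed

text \<open>Integrate the Poisson inequality against the filter. The terms \<open>forward t\<close> and \<open>t\<close> are taken at
  the same time; shifting the index of the second one leaves a telescoping sum, bounded by \<open>C\<close>, and
  the innovations, which average to zero.\<close>

lemma filtered_b_average_ge:
  assumes e: "0 < e" "e < 1 / 2"
  shows "AE w in P. eventually (\<lambda>n. c_diamond * (1 - 2 * e) * real n \<le> (\<Sum>k<n. filtered b k w)) sequentially"
proof -
  obtain t C k where t: "bounded_fun C t" and k: "0 < k" "c_diamond * k \<le> 1"
    and poisson: "\<And>x. x \<in> space psi \<Longrightarrow> 1 - e - t x + forward t x \<le> b x * k"
    by (rule poisson_inequality[OF e(1)]) (erule (2) that, assumption)
  show ?thesis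
    using innovation_averages[OF t] AE_regular_path
  proof eventually_elim
    case (elim w)
    let ?T = "\<lambda>n. filtered t n w" and ?U = "\<lambda>n. filtered (forward t) n w"
    let ?S = "\<lambda>n. \<Sum>i<n. ?U i - ?T (Suc i)"
    have step: "1 - e - ?T n + ?U n \<le> k * filtered b n w" for n
    proof -
      let ?f = "post n w"
      have f: "integrable psi ?f" "\<And>x. x \<in> space psi \<Longrightarrow> 0 \<le> ?f x" "(\<integral>x. ?f x \<partial>psi) = 1"
        using post_prob[OF elim(2)] by (auto simp: nonneg_integrable_def)
      note it = filtered_integrable[OF t elim(2), of n]
        filtered_integrable[OF forward_bounded[OF t] elim(2), of n]
      have "(\<integral>x. (1 - e) * ?f x - t x * ?f x + forward t x * ?f x \<partial>psi) \<le> (\<integral>x. k * (b x * ?f x) \<partial>psi)"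
      proof (rule integral_mono)
        fix x assume x: "x \<in> space psi"
        show "(1 - e) * ?f x - t x * ?f x + forward t x * ?f x \<le> k * (b x * ?f x)"
          using mult_right_mono[OF poisson[OF x] f(2)[OF x]] by (simp add: algebra_simps)
      qed (use f(1) it integrable_b_mult[OF f(1)] in auto)
      moreover have "(\<integral>x. (1 - e) * ?f x - t x * ?f x + forward t x * ?f x \<partial>psi) = (1 - e) - ?T n + ?U n"
      proof -
        have "integrable psi (\<lambda>x. (1 - e) * ?f x)" using f(1) by simp
        with it f(3) show ?thesis unfolding filtered_def
          by (subst Bochner_Integration.integral_add, simp, simp, subst Bochner_Integration.integral_diff) simp_all
      qed
      ultimately show ?thesis by (simp add: filtered_def)
    qed
    have sum: "(1 - e) * real n - C + ?S n \<le> k * (\<Sum>j<n. filtered b j w)" for n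
    proof -
      have "(\<Sum>j<n. 1 - e - ?T j + ?U j) \<le> (\<Sum>j<n. k * filtered b j w)"
        by (intro sum_mono step)
      moreover have "(\<Sum>j<n. 1 - e - ?T j + ?U j) = (1 - e) * real n + (?T n - ?T 0) + ?S n"
        by (induction n) (auto simp: algebra_simps)
      moreover have "- C \<le> ?T n - ?T 0"
        using filtered_bounds[OF t elim(2), of n] filtered_bounds[OF t elim(2), of 0] by linarith
      ultimately show ?thesis by (simp add: sum_distrib_left)
    qed
    have "bounded_fun L b" using b_nonneg b_le_L by (auto simp: bounded_fun_def)
    then have nn: "0 \<le> (\<Sum>j<n. filtered b j w)" for n
      by (intro sum_nonneg filtered_bounds(1)[OF _ elim(2)])
    have "(\<lambda>n. ?S n / real n - C / real n) \<longlonglongrightarrow> 0 - 0"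
      by (intro tendsto_diff elim(1) lim_const_over_n)
    then have "eventually (\<lambda>n. - e < ?S n / real n - C / real n) sequentially"
      using e by (intro order_tendstoD(1)) auto
    then show ?case using eventually_gt_at_top[of 0]
    proof eventually_elim
      case (elim n)
      then have "- e * real n < ?S n - C" by (simp add: field_simps)
      then have "(1 - 2 * e) * real n \<le> k * (\<Sum>j<n. filtered b j w)"
        using sum[of n] by (simp add: algebra_simps)
      then have "c_diamond * ((1 - 2 * e) * real n) \<le> c_diamond * (k * (\<Sum>j<n. filtered b j w))"
        using b_charged by (intro mult_left_mono) auto
      also have "\<dots> \<le> 1 * (\<Sum>j<n. filtered b j w)"
      proof -
        show ?thesis using k(2) nn[of n] unfolding mult.assoc[symmetric] by (intro mult_right_mono)
      qed
      finally show ?case by (simp add: mult.assoc)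
    qed
  qed
qed

lemma filtered_b_average:
  "AE w in P. \<forall>c'<c_diamond. eventually (\<lambda>n. c' * real n \<le> (\<Sum>k<n. filtered b k w)) sequentially"
proof -
  have "AE w in P. \<forall>j::nat. eventually (\<lambda>n. c_diamond * (1 - 2 * inverse (real (Suc (j + 2)))) * real n
      \<le> (\<Sum>k<n. filtered b k w)) sequentially"
    unfolding AE_all_countable by (intro allI filtered_b_average_ge) (auto simp: field_simps)
  then show ?thesis
  proof (eventually_elim, intro allI impI)
    fix w c' assume *: "\<forall>j::nat. eventually (\<lambda>n. c_diamond * (1 - 2 * inverse (real (Suc (j + 2)))) * real n
      \<le> (\<Sum>k<n. filtered b k w)) sequentially" and c': "c' < c_diamond"
    have "(\<lambda>j::nat. c_diamond * (1 - 2 * inverse (real (Suc (j + 2))))) \<longlonglongrightarrow> c_diamond * (1 - 2 * 0)"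
      by (intro tendsto_intros LIMSEQ_ignore_initial_segment[OF LIMSEQ_inverse_real_of_nat, of 2])
    then have "eventually (\<lambda>j::nat. c' < c_diamond * (1 - 2 * inverse (real (Suc (j + 2))))) sequentially"
      using c' by (intro order_tendstoD(1)) auto
    then obtain j :: nat where j: "c' < c_diamond * (1 - 2 * inverse (real (Suc (j + 2))))"
      by (auto simp: eventually_sequentially)
    from *[rule_format, of j] show "eventually (\<lambda>n. c' * real n \<le> (\<Sum>k<n. filtered b k w)) sequentially"
    proof eventually_elim
      case (elim n)
      have "c' * real n \<le> c_diamond * (1 - 2 * inverse (real (Suc (j + 2)))) * real n"
        using j by (intro mult_right_mono) auto
      then show ?case using elim by linarith
    qed
  qed
qed

end

section \<open>Exponential forgetting of the initial density\<close>

context hidden_markov_filter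
begin

text \<open>Any version of the conditional densities that is jointly measurable agrees almost everywhere
  with the filtering recursion, by uniqueness of densities on the product of the outcomes with
  the signal space.\<close>

lemma filtering_density_eq_filter:
  assumes p: "filtering_density psi theta P X Y p"
  shows "AE w in P. AE x in psi. p n w x = post n w x"
proof -
  interpret fms: finite_measure_subalgebra P "obs n"
    by unfold_locales (rule obs_subalgebra)
  have pm: "case_prod (p n) \<in> borel_measurable (obs n \<Otimes>\<^sub>M psi)"
    and pnn: "\<And>w x. w \<in> space P \<Longrightarrow> x \<in> space psi \<Longrightarrow> 0 \<le> p n w x"
    and pc: "\<And>A. A \<in> sets psi \<Longrightarrow> AE w in P. nn_cond_exp P (obs n) (indicator {w \<in> space P. X n w \<in> A}) w =
        emeasure (density psi (\<lambda>x. ennreal (p n w x))) A"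
    using p by (auto simp: filtering_density_def obs_def)
  have "joint_density (\<lambda>_. 1) n (p n)"
  proof (rule joint_densityI[OF _ _ pm])
    fix C A assume C: "C \<in> sets (obs n)" and A [measurable]: "A \<in> sets psi"
    let ?E = "{w \<in> space P. X n w \<in> A}"
    have E: "?E \<in> sets P" by measurable
    have "(\<integral>\<^sup>+w. 1 * (indicator C w * indicator A (X n w)) \<partial>P) = (\<integral>\<^sup>+w. indicator C w * indicator ?E w \<partial>P)"
      by (intro nn_integral_cong) (auto simp: indicator_def)
    also have "\<dots> = (\<integral>\<^sup>+w. indicator C w * nn_cond_exp P (obs n) (indicator ?E) w \<partial>P)"
      using C E by (intro fms.nn_cond_exp_intg[symmetric]) auto
    also have "\<dots> = (\<integral>\<^sup>+w. \<integral>\<^sup>+x. indicator C w * indicator A x * ennreal (p n w x) \<partial>psi \<partial>P)"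
      using pc[OF A] AE_space
    proof (intro nn_integral_cong_AE, eventually_elim)
      fix w assume *: "nn_cond_exp P (obs n) (indicator ?E) w = emeasure (density psi (\<lambda>x. ennreal (p n w x))) A"
        and w: "w \<in> space P"
      have pw [measurable]: "p n w \<in> borel_measurable psi" using measurable_Pair2[OF pm, of w] w by simp
      have "nn_cond_exp P (obs n) (indicator ?E) w = (\<integral>\<^sup>+x. indicator A x * ennreal (p n w x) \<partial>psi)"
        unfolding * by (subst emeasure_density) (auto simp: mult.commute)
      then show "indicator C w * nn_cond_exp P (obs n) (indicator ?E) w
          = (\<integral>\<^sup>+x. indicator C w * indicator A x * ennreal (p n w x) \<partial>psi)"
        unfolding mult.assoc by (subst nn_integral_cmult) auto
    qed
    finally show "(\<integral>\<^sup>+w. 1 * (indicator C w * indicator A (X n w)) \<partial>P)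
      = (\<integral>\<^sup>+w. \<integral>\<^sup>+x. indicator C w * indicator A x * ennreal (p n w x) \<partial>psi \<partial>P)" .
  qed (simp_all add: emeasure_space_1)
  from joint_density_unique[OF this pm post_density post_measurable] AE_regular_path AE_space
  show ?thesis
  proof eventually_elim
    fix w assume e: "AE x in psi. ennreal (p n w x) = ennreal (post n w x)"
      and reg: "regular_path w" and w: "w \<in> space P"
    show "AE x in psi. p n w x = post n w x"
      using e AE_space
    proof eventually_elim
      case (elim x)
      have "0 \<le> post n w x"
        using post_prob(1)[OF reg] elim(2) by (auto simp: nonneg_integrable_def)
      then show ?case using elim pnn[OF w elim(2)] by simp
    qed
  qed
qed

end

context stationary_hidden_markov
begin

text \<open>Positivity of \<open>eta\<close> is what makes the true filter absolutely continuous with respect to the wrong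
  one at all times.\<close>

theorem wrong_filter_forgets:
  assumes eta: "prob_density psi eta" and eta_pos: "\<And>x. x \<in> space psi \<Longrightarrow> 0 < eta x"
    and p: "filtering_density psi theta P X Y p"
  shows "AE w in P. limsup (\<lambda>n. ereal (1 / real n) * elog (L1_dist psi (filter eta (path w) n) (p n w)))
    \<le> ereal (- c_diamond / L)"
proof -
  have "AE w in P. \<forall>n. AE x in psi. p n w x = post n w x"
    unfolding AE_all_countable using filtering_density_eq_filter[OF p] by blast
  then show ?thesis using AE_regular_path filtered_b_average
  proof eventually_elim
    fix w assume p: "\<forall>n. AE x in psi. p n w x = post n w x"
      and reg: "regular_path w"
      and avg: "\<forall>c'<c_diamond. eventually (\<lambda>n. c' * real n \<le> (\<Sum>k<n. filtered b k w)) sequentially"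
    interpret coupled_filters psi lam L b "\<lambda>n. post n w" "\<lambda>n. comp eta n w"
      "\<lambda>n x. gam x (Y (Suc n) w) / normalizer (post n w) (Y (Suc n) w)"
      by (rule coupled_path[OF eta reg])
    have mass: "mass n = filtered b n w" for n by (simp add: mass_def filtered_def)
    have dom: "AE x in psi. eta x = 0 \<longrightarrow> mu x = 0"
    proof (rule AE_I2)
      fix x assume "x \<in> space psi"
      from eta_pos[OF this] show "eta x = 0 \<longrightarrow> mu x = 0" by simp
    qed
    have dom0: "AE x in psi. comp eta 0 w x = 0 \<longrightarrow> post 0 w x = 0"
      using dom by (simp add: comp_def post_def)
    have "L1_dist psi (filter eta (path w) n) (p n w)
        = L1_dist psi (\<lambda>x. comp eta n w x / (\<integral>x. comp eta n w x \<partial>psi))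
            (post n w)" for n
      unfolding L1_dist_def
      using p[rule_format, of n] AE_space
    proof (intro nn_integral_cong_AE, eventually_elim)
      fix x assume px: "p n w x = post n w x" and x: "x \<in> space psi"
      have "filter eta (path w) n x = comp eta n w x / (\<integral>x. comp eta n w x \<partial>psi)"
        unfolding comp_def
        by (rule filter_eq_normalised_companion[OF mu eta _ dom x]) (use reg in \<open>auto simp: regular_path_def\<close>)
      then show "ennreal \<bar>filter eta (path w) n x - p n w x\<bar>
          = ennreal \<bar>comp eta n w x / (\<integral>x. comp eta n w x \<partial>psi)
              - post n w x\<bar>" using px by simp
    qed
    moreover have "limsup (\<lambda>n. ereal (1 / real n) * elog (L1_dist psi
        (\<lambda>x. comp eta n w x / (\<integral>x. comp eta n w x \<partial>psi))
            (post n w))) \<le> ereal (- c_diamond / L)"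
      by (rule limsup_log_distance_le[OF _ b_charged]) (use dom0 avg in \<open>auto simp: mass\<close>)
    ultimately show "limsup (\<lambda>n. ereal (1 / real n) * elog (L1_dist psi (filter eta (path w) n) (p n w)))
      \<le> ereal (- c_diamond / L)" by simp
  qed
qed

end

section \<open>Merging of the conditional expectations\<close>

context stationary_hidden_markov
begin

definition obs_all :: "'w measure" where
  "obs_all = sigma_XY P psi theta X Y {} {1..}"

definition obs_signal :: "nat \<Rightarrow> 'w measure" where
  "obs_signal n = sigma_XY P psi theta X Y {n} {1..n}"

lemma space_obs_all [simp]: "space obs_all = space P"
  and space_obs_signal [simp]: "space (obs_signal n) = space P"
  by (simp_all add: obs_all_def obs_signal_def)

lemma obs_all_subalgebra: "subalgebra P obs_all" and obs_signal_subalgebra: "subalgebra P (obs_signal n)"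
  unfolding obs_all_def obs_signal_def by (intro subalgebra_sigma_XY, auto)+

lemma obs_le: "n \<le> k \<Longrightarrow> sets (obs n) \<subseteq> sets (obs k)"
  unfolding obs_def by (intro sets_sigma_XY_mono) (simp_all add: subset_eq)

lemma obs_le_all: "sets (obs n) \<subseteq> sets obs_all"
  unfolding obs_def obs_all_def by (intro sets_sigma_XY_mono) (simp_all add: subset_eq)

lemma obs_le_signal: "sets (obs n) \<subseteq> sets (obs_signal n)"
  unfolding obs_def obs_signal_def by (intro sets_sigma_XY_mono) (simp_all add: subset_eq)

text \<open>The union of the increasing sigma-algebras is a generator stable under intersections, on which the
  two candidates for the conditional expectation can be compared.\<close>

lemma obs_all_generated: "sets obs_all = sigma_sets (space P) (\<Union>n. sets (obs n))"
proof
  have "(\<Union>n. sets (obs n)) \<subseteq> Pow (space P)"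
    using sets.space_closed[of "obs _"] by auto
  then have G: "sets (sigma (space P) (\<Union>n. sets (obs n))) = sigma_sets (space P) (\<Union>n. sets (obs n))"
    and sp: "space (sigma (space P) (\<Union>n. sets (obs n))) = space P" by simp_all
  have "sets obs_all \<subseteq> sets (sigma (space P) (\<Union>n. sets (obs n)))"
    unfolding obs_all_def
  proof (rule sets_sigma_XY_subset[OF sp])
    fix j :: nat assume j: "j \<in> {1..}"
    have "Y j \<in> measurable (obs j) theta"
      unfolding obs_def using j by (intro measurable_sigma_XY_snd Y_measurable) auto
    moreover have "(\<lambda>w. w) \<in> measurable (sigma (space P) (\<Union>n. sets (obs n))) (obs j)"
      using sp G by (intro measurable_ident_mono) auto
    ultimately show "Y j \<in> measurable (sigma (space P) (\<Union>n. sets (obs n))) theta"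
      using measurable_compose[of "\<lambda>w. w"] by fastforce
  qed auto
  then show "sets obs_all \<subseteq> sigma_sets (space P) (\<Union>n. sets (obs n))" using G by simp
  show "sigma_sets (space P) (\<Union>n. sets (obs n)) \<subseteq> sets obs_all"
    using sets.sigma_sets_subset[of "\<Union>n. sets (obs n)" obs_all] obs_le_all by auto
qed

lemma obs_signal_sets:
  assumes "A \<in> sets (obs_signal n)"
  obtains D where "D \<in> sets (obs n \<Otimes>\<^sub>M psi)" "\<And>w. w \<in> space P \<Longrightarrow> w \<in> A \<longleftrightarrow> (w, X n w) \<in> D"
proof (rule sets_vimage_pair[OF assms _ X_measurable space_obs])
  let ?V = "vimage_algebra (space P) (\<lambda>w. (w, X n w)) (obs n \<Otimes>\<^sub>M psi)"
  note V = measurable_vimage_pair[OF X_measurable[of n] space_obs[of n]]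
  show "sets (obs_signal n) \<subseteq> sets ?V"
    unfolding obs_signal_def
  proof (rule sets_sigma_XY_subset)
    fix j assume "j \<in> {1..n}"
    then have "Y j \<in> measurable (obs n) theta"
      unfolding obs_def by (intro measurable_sigma_XY_snd Y_measurable) auto
    from measurable_compose[OF V(1) this] show "Y j \<in> measurable ?V theta" by simp
  qed (use V(2) in auto)
qed (use that in blast)

text \<open>The true initial density \<open>mu\<close> is bounded away from zero; the ratio of \<open>eta\<close> to \<open>mu\<close> at the
  initial signal is then integrable, but it may be unbounded.\<close>

context
  fixes eta :: "'a \<Rightarrow> real" and mu_star :: real
  assumes eta: "prob_density psi eta"
    and mu_star: "0 < mu_star" "\<And>x. x \<in> space psi \<Longrightarrow> mu_star \<le> mu x"
begin

definition initial_ratio :: "'w \<Rightarrow> real" where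
  "initial_ratio w = eta (X 0 w) / mu (X 0 w)"

definition ratio :: "nat \<Rightarrow> 'w \<Rightarrow> real" where
  "ratio n w = comp eta n w (X n w) / post n w (X n w)"

text \<open>The bounds start at time one, where the ratio of the predictions is at most \<open>upper_start\<close>
  even if \<open>eta / mu\<close> is unbounded.\<close>

definition upper_start :: real where
  "upper_start = L / (\<integral>x. b x * mu x \<partial>psi)"

definition bound :: "real \<Rightarrow> nat \<Rightarrow> 'w \<Rightarrow> real" where
  "bound c n w = ratio_bound (\<lambda>k. post (Suc k) w) (\<lambda>k. comp eta (Suc k) w) c n"

lemma eta_measurable [measurable]: "eta \<in> borel_measurable psi"
  and eta_nonneg: "x \<in> space psi \<Longrightarrow> 0 \<le> eta x"
  using eta by (auto simp: prob_density_def)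

lemma comp_eta_measurable [measurable]: "case_prod (comp eta n) \<in> borel_measurable (obs n \<Otimes>\<^sub>M psi)"
  by (rule comp_measurable[OF eta_measurable])

lemma mu_pos: "x \<in> space psi \<Longrightarrow> 0 < mu x"
  using mu_star(1) mu_star(2)[of x] by linarith

lemma initial_mass_pos: "0 < (\<integral>x. b x * mu x \<partial>psi)"
proof -
  have 1: "nonneg_integrable m" "nonneg_integrable mu"
    using prob_density_integrable(1)[OF m] prob_density_integrable(1)[OF mu] by auto
  have 2: "AE x in psi. mu x = 0 \<longrightarrow> m x = 0" using mu_pos by (intro AE_I2) force
  show ?thesis by (rule b_integral_zero_mono[OF 1 2 b_charged])
qed

text \<open>Measurability in the observations alone is what lets the limit of the bounds be a conditional
  expectation given the observations.\<close>

lemma bound_measurable: "bound c n \<in> borel_measurable (obs (Suc n))"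
proof (induction n)
  case 0 then show ?case by (simp add: bound_def[abs_def])
next
  case (Suc n)
  note [measurable] = Suc
  have "(\<lambda>w. bound c n w + (\<integral>z. b z * (comp eta (Suc n) w z - bound c n w * post (Suc n) w z) \<partial>psi) / L) \<in> borel_measurable (obs (Suc n))"
    by measurable
  then have "bound c (Suc n) \<in> borel_measurable (obs (Suc n))"
    unfolding bound_def[abs_def] ratio_bound.simps .
  from measurable_compose[OF id_obs_Suc this] show ?case by simp
qed

lemma coupled_from_one:
  assumes "regular_path w"
  shows "coupled_filters psi lam L b (\<lambda>n. post (Suc n) w) (\<lambda>n. comp eta (Suc n) w)
    (\<lambda>n x. gam x (Y (Suc (Suc n)) w) / normalizer (post (Suc n) w) (Y (Suc (Suc n)) w))"
  using coupled_filters.shifted[OF coupled_path[OF eta assms], of 1] by (simp)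

lemma start_bounds:
  assumes reg: "regular_path w"
  shows "AE x in psi. 0 * post (Suc 0) w x \<le> comp eta (Suc 0) w x"
    and "AE x in psi. comp eta (Suc 0) w x \<le> upper_start * post (Suc 0) w x"
proof -
  interpret coupled_filters psi lam L b "\<lambda>n. post n w" "\<lambda>n. comp eta n w"
    "\<lambda>n x. gam x (Y (Suc n) w) / normalizer (post n w) (Y (Suc n) w)"
    by (rule coupled_path[OF eta reg])
  show "AE x in psi. 0 * post (Suc 0) w x \<le> comp eta (Suc 0) w x"
    using G_nn[of _ "Suc 0"] by (intro AE_I2) simp
  have "AE x in psi. comp eta 1 w x
      \<le> L * (\<integral>z. comp eta 0 w z \<partial>psi) / mass 0 * post 1 w x"
    by (rule entry_upper) (unfold mass_def, simp add: post_def initial_mass_pos)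
  then show "AE x in psi. comp eta (Suc 0) w x \<le> upper_start * post (Suc 0) w x"
    using prob_density_integrable(2)[OF eta]
    by (simp add: mass_def upper_start_def comp_def[of _ 0] post_def[of 0])
qed

lemma upper_start_nonneg: "0 \<le> upper_start"
  unfolding upper_start_def using L_pos initial_mass_pos by simp

lemma bound_properties:
  assumes reg: "regular_path w"
  shows "AE x in psi. bound 0 n w * post (Suc n) w x \<le> comp eta (Suc n) w x"
    and "AE x in psi. comp eta (Suc n) w x \<le> bound upper_start n w * post (Suc n) w x"
    and "bound 0 n w \<le> bound 0 (Suc n) w"
    and "bound upper_start (Suc n) w \<le> bound upper_start n w"
    and "bound 0 n w \<le> bound upper_start n w"
    and "bound upper_start n w - bound 0 n w \<le> upper_start * exp (- (\<Sum>k<n. filtered b (Suc k) w) / L)"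
proof -
  interpret coupled_filters psi lam L b "\<lambda>n. post (Suc n) w" "\<lambda>n. comp eta (Suc n) w"
    "\<lambda>n x. gam x (Y (Suc (Suc n)) w) / normalizer (post (Suc n) w) (Y (Suc (Suc n)) w)"
    by (rule coupled_from_one[OF reg])
  note start = start_bounds[OF reg]
  show "AE x in psi. bound 0 n w * post (Suc n) w x \<le> comp eta (Suc n) w x"
    unfolding bound_def by (rule relax_lower[OF start(1)])
  show "AE x in psi. comp eta (Suc n) w x \<le> bound upper_start n w * post (Suc n) w x"
    unfolding bound_def by (rule relax_upper[OF start(2)])
  show "bound 0 n w \<le> bound 0 (Suc n) w"
    unfolding bound_def by (rule relax_lower_Suc[OF start(1)])
  show "bound upper_start (Suc n) w \<le> bound upper_start n w"
    unfolding bound_def by (rule relax_upper_Suc[OF start(2)])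
  show "bound 0 n w \<le> bound upper_start n w"
    unfolding bound_def by (rule relax_diff_nonneg[OF upper_start_nonneg])
  have "mass k = filtered b (Suc k) w" for k unfolding mass_def filtered_def ..
  then show "bound upper_start n w - bound 0 n w \<le> upper_start * exp (- (\<Sum>k<n. filtered b (Suc k) w) / L)"
    unfolding bound_def using relax_diff_le[OF upper_start_nonneg, of n] by simp
qed

text \<open>The nested intervals of bounds shrink to one point: the sums in the exponent diverge by the
  law of large numbers.\<close>

definition limit_ratio :: "'w \<Rightarrow> real" where
  "limit_ratio w = lim (\<lambda>n. bound 0 n w)"

lemma bounds_converge:
  assumes reg: "regular_path w"
    and avg: "\<forall>c'<c_diamond. eventually (\<lambda>n. c' * real n \<le> (\<Sum>k<n. filtered b k w)) sequentially"
  shows "(\<lambda>n. bound 0 n w) \<longlonglongrightarrow> limit_ratio w" "(\<lambda>n. bound upper_start n w) \<longlonglongrightarrow> limit_ratio w"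
    "0 \<le> limit_ratio w" "limit_ratio w \<le> upper_start"
proof -
  note B = bound_properties[OF reg]
  have inc: "incseq (\<lambda>n. bound 0 n w)" using B(3) by (intro incseq_SucI)
  have dec: "decseq (\<lambda>n. bound upper_start n w)" using B(4) by (intro decseq_SucI)
  have le: "bound 0 n w \<le> upper_start" for n
    using B(5)[of n] decseqD[OF dec, of 0 n] by (simp add: bound_def)
  then have "Bseq (\<lambda>n. bound 0 n w)"
  proof (intro BseqI'[where K="upper_start"])
    fix n
    have "0 \<le> bound 0 n w" using incseqD[OF inc, of 0 n] by (simp add: bound_def)
    then show "norm (bound 0 n w) \<le> upper_start" using le[of n] by simp
  qed
  then have "convergent (\<lambda>n. bound 0 n w)"
    using inc by (intro Bseq_monoseq_convergent incseq_imp_monoseq)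
  then show lim: "(\<lambda>n. bound 0 n w) \<longlonglongrightarrow> limit_ratio w"
    unfolding limit_ratio_def by (simp add: convergent_LIMSEQ_iff)
  have nn: "0 \<le> filtered b k w" for k
    using filtered_bounds(1)[OF _ reg, of L b] b_nonneg b_le_L by (auto simp: bounded_fun_def)
  have sum: "eventually (\<lambda>n. c_diamond / 2 * real n \<le> (\<Sum>k<Suc n. filtered b k w)) sequentially"
  proof -
    have "eventually (\<lambda>n. c_diamond / 2 * real n \<le> (\<Sum>k<n. filtered b k w)) sequentially"
      by (rule avg[rule_format]) (use b_charged in simp)
    then show ?thesis
    proof eventually_elim
      case (elim n) then show ?case using nn[of n] by simp
    qed
  qed
  have "(\<lambda>n. upper_start * exp (filtered b 0 w / L) * exp (- (c_diamond / (2 * L)) * real n)) \<longlonglongrightarrow> upper_start * exp (filtered b 0 w / L) * 0"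
  proof (intro tendsto_mult_left)
    have "(\<lambda>n. exp (- (c_diamond / (2 * L))) ^ n) \<longlonglongrightarrow> 0"
      using b_charged L_pos by (intro LIMSEQ_power_zero) simp
    then show "(\<lambda>n. exp (- (c_diamond / (2 * L)) * real n)) \<longlonglongrightarrow> 0"
      by (simp only: exp_of_nat2_mult)
  qed
  then have upper: "(\<lambda>n. upper_start * exp (filtered b 0 w / L) * exp (- (c_diamond / (2 * L)) * real n)) \<longlonglongrightarrow> 0"
    by simp
  have "(\<lambda>n. bound upper_start n w - bound 0 n w) \<longlonglongrightarrow> 0"
  proof (rule tendsto_sandwich[OF _ _ tendsto_const upper])
    show "eventually (\<lambda>n. 0 \<le> bound upper_start n w - bound 0 n w) sequentially" using B(5) by simp
    show "eventually (\<lambda>n. bound upper_start n w - bound 0 n w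
        \<le> upper_start * exp (filtered b 0 w / L) * exp (- (c_diamond / (2 * L)) * real n)) sequentially"
      using sum
    proof eventually_elim
      case (elim n)
      have "(\<Sum>k<n. filtered b (Suc k) w) = (\<Sum>k<Suc n. filtered b k w) - filtered b 0 w"
        by (simp only: sum.lessThan_Suc_shift)
      then have "c_diamond / 2 * real n - filtered b 0 w \<le> (\<Sum>k<n. filtered b (Suc k) w)"
        using elim by linarith
      then have "- (\<Sum>k<n. filtered b (Suc k) w) / L \<le> (filtered b 0 w - c_diamond / 2 * real n) / L"
        using L_pos by (intro divide_right_mono) auto
      also have "\<dots> = filtered b 0 w / L + - (c_diamond / (2 * L)) * real n"
        using L_pos by (simp add: field_simps)
      finally have "exp (- (\<Sum>k<n. filtered b (Suc k) w) / L)
          \<le> exp (filtered b 0 w / L) * exp (- (c_diamond / (2 * L)) * real n)"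
        by (simp only: exp_le_cancel_iff exp_add[symmetric])
      then have "upper_start * exp (- (\<Sum>k<n. filtered b (Suc k) w) / L)
          \<le> upper_start * (exp (filtered b 0 w / L) * exp (- (c_diamond / (2 * L)) * real n))"
        using upper_start_nonneg by (rule mult_left_mono)
      then show ?case using B(6)[of n] by (simp only: mult.assoc)
    qed
  qed
  from tendsto_add[OF this lim] show "(\<lambda>n. bound upper_start n w) \<longlonglongrightarrow> limit_ratio w" by simp
  show "limit_ratio w \<le> upper_start" using lim le by (intro LIMSEQ_le_const2) auto
  have "0 \<le> bound 0 n w" for n using incseqD[OF inc, of 0 n] by (simp add: bound_def)
  then show "0 \<le> limit_ratio w" using lim by (intro LIMSEQ_le_const) auto
qed

text \<open>The current signal has conditional density \<open>post n w\<close>, so it almost surely avoids sets that this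
  density does not charge.\<close>

lemma AE_filter_signal:
  assumes D: "D \<in> sets (obs n \<Otimes>\<^sub>M psi)"
    and null: "AE w in P. AE x in psi. (w, x) \<in> D \<longrightarrow> post n w x \<le> 0"
  shows "AE w in P. (w, X n w) \<notin> D"
proof -
  have idX: "(\<lambda>w. (w, X n w)) \<in> measurable P (obs n \<Otimes>\<^sub>M psi)" using id_P_obs by measurable
  have Dm: "indicator D \<in> borel_measurable (obs n \<Otimes>\<^sub>M psi)" using D by simp
  have "(\<integral>\<^sup>+w. indicator D (w, X n w) \<partial>P) = (\<integral>\<^sup>+w. \<integral>\<^sup>+x. indicator D (w, x) * ennreal (post n w x) \<partial>psi \<partial>P)"
    using post_density[of n, unfolded joint_density_def, rule_format, OF Dm] by simp
  also have "\<dots> = (\<integral>\<^sup>+w. 0 \<partial>P)"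
  proof (rule nn_integral_cong_AE)
    show "AE w in P. (\<integral>\<^sup>+x. indicator D (w, x) * ennreal (post n w x) \<partial>psi) = 0"
      using null
    proof eventually_elim
      fix w assume "AE x in psi. (w, x) \<in> D \<longrightarrow> post n w x \<le> 0"
      then have "AE x in psi. indicator D (w, x) * ennreal (post n w x) = 0"
        by eventually_elim (auto simp: indicator_def ennreal_neg)
      from nn_integral_cong_AE[OF this]
      show "(\<integral>\<^sup>+x. indicator D (w, x) * ennreal (post n w x) \<partial>psi) = 0" by simp
    qed
  qed
  finally have z: "(\<integral>\<^sup>+w. indicator D (w, X n w) \<partial>P) = 0" by simp
  have "(\<lambda>w. indicator D (w, X n w) :: ennreal) \<in> borel_measurable P"
    by (rule measurable_compose[OF idX Dm])
  with z have "AE w in P. indicator D (w, X n w) = (0::ennreal)"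
    by (subst (asm) nn_integral_0_iff_AE) auto
  then show ?thesis by eventually_elim (auto simp: indicator_def split: if_splits)
qed

lemma ratio_between_bounds:
  "AE w in P. bound 0 n w \<le> ratio (Suc n) w \<and> ratio (Suc n) w \<le> bound upper_start n w"
proof -
  note [measurable] = bound_measurable[of _ n]
  let ?Q = "obs (Suc n) \<Otimes>\<^sub>M psi"
  define D where "D = {z \<in> space ?Q. post (Suc n) (fst z) (snd z) \<le> 0 \<or>
      comp eta (Suc n) (fst z) (snd z) < bound 0 n (fst z) * post (Suc n) (fst z) (snd z) \<or>
      bound upper_start n (fst z) * post (Suc n) (fst z) (snd z) < comp eta (Suc n) (fst z) (snd z)}"
  have Dm: "D \<in> sets ?Q" unfolding D_def by measurable
  have "AE w in P. (w, X (Suc n) w) \<notin> D"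
  proof (rule AE_filter_signal[OF Dm])
    show "AE w in P. AE x in psi. (w, x) \<in> D \<longrightarrow> post (Suc n) w x \<le> 0"
      using AE_regular_path
    proof eventually_elim
      fix w assume reg: "regular_path w"
      show "AE x in psi. (w, x) \<in> D \<longrightarrow> post (Suc n) w x \<le> 0"
        using bound_properties(1)[OF reg, of n] bound_properties(2)[OF reg, of n]
        by eventually_elim (simp add: D_def)
    qed
  qed
  then show ?thesis using AE_space
  proof eventually_elim
    case (elim w)
    then have "0 < post (Suc n) w (X (Suc n) w)" "bound 0 n w * post (Suc n) w (X (Suc n) w) \<le> comp eta (Suc n) w (X (Suc n) w)"
      "comp eta (Suc n) w (X (Suc n) w) \<le> bound upper_start n w * post (Suc n) w (X (Suc n) w)"
      using X_space[of w "Suc n"] by (auto simp: D_def space_pair_measure)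
    moreover have "ratio (Suc n) w = comp eta (Suc n) w (X (Suc n) w) / post (Suc n) w (X (Suc n) w)"
      by (simp add: ratio_def)
    ultimately show ?case by (simp add: pos_le_divide_eq pos_divide_le_eq)
  qed
qed

lemma ratio_tendsto: "AE w in P. (\<lambda>n. ratio n w) \<longlonglongrightarrow> limit_ratio w"
proof -
  have "AE w in P. \<forall>n. bound 0 n w \<le> ratio (Suc n) w \<and> ratio (Suc n) w \<le> bound upper_start n w"
    unfolding AE_all_countable using ratio_between_bounds by blast
  then show ?thesis using AE_regular_path filtered_b_average
  proof eventually_elim
    case (elim w)
    note lim = bounds_converge[OF elim(2,3)]
    have "(\<lambda>n. ratio (Suc n) w) \<longlonglongrightarrow> limit_ratio w"
      by (rule tendsto_sandwich[OF _ _ lim(1,2)]) (use elim(1) in auto)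
    then show ?case by (rule LIMSEQ_imp_Suc)
  qed
qed

lemma limit_ratio_bounds: "AE w in P. 0 \<le> limit_ratio w \<and> limit_ratio w \<le> upper_start"
  using AE_regular_path filtered_b_average by eventually_elim (intro conjI bounds_converge)

lemma limit_ratio_measurable: "limit_ratio \<in> borel_measurable obs_all"
proof -
  have "bound 0 n \<in> borel_measurable obs_all" for n
  proof -
    have "(\<lambda>w. w) \<in> measurable obs_all (obs (Suc n))"
      using obs_le_all by (intro measurable_ident_mono) auto
    from measurable_compose[OF this bound_measurable] show ?thesis by simp
  qed
  then show ?thesis unfolding limit_ratio_def[abs_def] by (rule borel_measurable_lim_metric)
qed

lemma initial_ratio_measurable [measurable]: "initial_ratio \<in> borel_measurable P"
  unfolding initial_ratio_def[abs_def] by measurable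

lemma initial_ratio_nonneg: "w \<in> space P \<Longrightarrow> 0 \<le> initial_ratio w"
  unfolding initial_ratio_def using eta_nonneg mu_pos X_space by (intro divide_nonneg_pos) auto

lemma companion_density: "joint_density (\<lambda>w. ennreal (initial_ratio w)) n (\<lambda>w. comp eta n w)"
  unfolding initial_ratio_def comp_def[abs_def]
  by (rule companion_joint_density[OF eta]) (use mu_pos in force)

lemma nn_integral_initial_ratio: "(\<integral>\<^sup>+w. ennreal (initial_ratio w) \<partial>P) = 1"
proof -
  have "(\<integral>\<^sup>+w. ennreal (initial_ratio w) * (\<lambda>_. 1) (w, X 0 w) \<partial>P)
      = (\<integral>\<^sup>+w. \<integral>\<^sup>+x. (\<lambda>_. 1) (w, x) * ennreal (comp eta 0 w x) \<partial>psi \<partial>P)"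
    using companion_density[of 0] unfolding joint_density_def by (rule bspec) simp
  then show ?thesis using eta by (simp add: prob_density_def emeasure_space_1 comp_def)
qed

lemma initial_ratio_integrable: "integrable P initial_ratio"
  using nn_integral_initial_ratio initial_ratio_nonneg
  by (intro integrableI_nonneg) (auto intro!: AE_I2)

lemma ratio_nonneg: "AE w in P. 0 \<le> ratio n w"
  using AE_regular_path AE_space
proof eventually_elim
  case (elim w)
  interpret coupled_filters psi lam L b "\<lambda>n. post n w" "\<lambda>n. comp eta n w"
    "\<lambda>n x. gam x (Y (Suc n) w) / normalizer (post n w) (Y (Suc n) w)"
    by (rule coupled_path[OF eta elim(1)])
  show ?case unfolding ratio_def using F_nn[OF X_space[OF elim(2)]] G_nn[OF X_space[OF elim(2)]]
    by (intro divide_nonneg_nonneg)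
qed

lemma ratio_measurable: "ratio n \<in> borel_measurable (obs_signal n)"
proof -
  have "(\<lambda>w. w) \<in> measurable (obs_signal n) (obs n)"
    using obs_le_signal by (intro measurable_ident_mono) auto
  moreover have "X n \<in> measurable (obs_signal n) psi"
    unfolding obs_signal_def by (rule measurable_sigma_XY_fst) auto
  ultimately have p: "(\<lambda>w. (w, X n w)) \<in> measurable (obs_signal n) (obs n \<Otimes>\<^sub>M psi)"
    by (rule measurable_Pair)
  show ?thesis
    using measurable_compose[OF p comp_eta_measurable]
      measurable_compose[OF p post_measurable]
    unfolding ratio_def[abs_def] by simp
qed

text \<open>The two joint densities are \<open>comp eta n\<close> and \<open>post n\<close>; their quotient is the density of one weighted
  law of \<open>(w, X n w)\<close> with respect to the other. Where \<open>post n\<close> vanishes the quotient is \<open>0\<close> by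
  convention, and \<open>comp eta n\<close> vanishes too.\<close>

lemma nn_integral_ratio:
  assumes A: "A \<in> sets (obs_signal n)"
  shows "(\<integral>\<^sup>+w. ennreal (initial_ratio w) * indicator A w \<partial>P) = (\<integral>\<^sup>+w. ennreal (ratio n w) * indicator A w \<partial>P)"
proof -
  obtain D where D [measurable]: "D \<in> sets (obs n \<Otimes>\<^sub>M psi)" and AD: "\<And>w. w \<in> space P \<Longrightarrow> w \<in> A \<longleftrightarrow> (w, X n w) \<in> D"
    using obs_signal_sets[OF A] by blast
  have H1: "indicator D \<in> borel_measurable (obs n \<Otimes>\<^sub>M psi)" by simp
  have H2: "(\<lambda>(w, x). ennreal (comp eta n w x / post n w x) * indicator D (w, x)) \<in> borel_measurable (obs n \<Otimes>\<^sub>M psi)" by measurable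
  have "(\<integral>\<^sup>+w. ennreal (initial_ratio w) * indicator A w \<partial>P) = (\<integral>\<^sup>+w. ennreal (initial_ratio w) * indicator D (w, X n w) \<partial>P)"
    using AD by (intro nn_integral_cong) (simp add: indicator_def)
  also have "\<dots> = (\<integral>\<^sup>+w. \<integral>\<^sup>+x. indicator D (w, x) * ennreal (comp eta n w x) \<partial>psi \<partial>P)"
    using companion_density[of n, unfolded joint_density_def, rule_format, OF H1] by simp
  also have "\<dots> = (\<integral>\<^sup>+w. \<integral>\<^sup>+x. (ennreal (comp eta n w x / post n w x) * indicator D (w, x)) * ennreal (post n w x) \<partial>psi \<partial>P)"
  proof (rule nn_integral_cong_AE)
    show "AE w in P. (\<integral>\<^sup>+x. indicator D (w, x) * ennreal (comp eta n w x) \<partial>psi)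
        = (\<integral>\<^sup>+x. (ennreal (comp eta n w x / post n w x) * indicator D (w, x)) * ennreal (post n w x) \<partial>psi)"
      using AE_regular_path
    proof eventually_elim
      fix w assume reg: "regular_path w"
      interpret coupled_filters psi lam L b "\<lambda>n. post n w" "\<lambda>n. comp eta n w"
    "\<lambda>n x. gam x (Y (Suc n) w) / normalizer (post n w) (Y (Suc n) w)"
        by (rule coupled_path[OF eta reg])
      have dom: "AE x in psi. post n w x = 0 \<longrightarrow> comp eta n w x = 0"
        by (rule G_dominated) (use mu_pos in \<open>force simp: post_def intro!: AE_I2\<close>)
      show "(\<integral>\<^sup>+x. indicator D (w, x) * ennreal (comp eta n w x) \<partial>psi)
        = (\<integral>\<^sup>+x. (ennreal (comp eta n w x / post n w x) * indicator D (w, x)) * ennreal (post n w x) \<partial>psi)"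
        using dom AE_space
      proof (intro nn_integral_cong_AE, eventually_elim)
        fix x assume d: "post n w x = 0 \<longrightarrow> comp eta n w x = 0" and x: "x \<in> space psi"
        have "0 \<le> post n w x" "0 \<le> comp eta n w x" using F_nn[OF x] G_nn[OF x] .
        then have "ennreal (comp eta n w x / post n w x) * ennreal (post n w x) = ennreal (comp eta n w x)"
          using d by (cases "post n w x = 0") (auto simp: ennreal_mult[symmetric])
        then show "indicator D (w, x) * ennreal (comp eta n w x) = (ennreal (comp eta n w x / post n w x) * indicator D (w, x)) * ennreal (post n w x)"
          by (metis mult.assoc mult.commute)
      qed
    qed
  qed
  also have "\<dots> = (\<integral>\<^sup>+w. ennreal (comp eta n w (X n w) / post n w (X n w)) * indicator D (w, X n w) \<partial>P)"
    using post_density[of n, unfolded joint_density_def, rule_format, OF H2] by simp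
  also have "\<dots> = (\<integral>\<^sup>+w. ennreal (ratio n w) * indicator A w \<partial>P)"
    using AD by (intro nn_integral_cong) (simp add: indicator_def ratio_def)
  finally show ?thesis .
qed

lemma ratio_integrable: "integrable P (ratio n)"
proof (rule integrableI_nonneg)
  show "ratio n \<in> borel_measurable P"
    using measurable_from_subalg[OF obs_signal_subalgebra ratio_measurable] .
  have "(\<integral>\<^sup>+w. ennreal (ratio n w) * indicator (space P) w \<partial>P) = (\<integral>\<^sup>+w. ennreal (initial_ratio w) * indicator (space P) w \<partial>P)"
    using nn_integral_ratio[of "space P" n] sets.top[of "obs_signal n"] by simp
  moreover have "(\<integral>\<^sup>+w. ennreal (ratio n w) * indicator (space P) w \<partial>P) = (\<integral>\<^sup>+w. ennreal (ratio n w) \<partial>P)"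
    "(\<integral>\<^sup>+w. ennreal (initial_ratio w) * indicator (space P) w \<partial>P) = (\<integral>\<^sup>+w. ennreal (initial_ratio w) \<partial>P)"
    by (auto intro!: nn_integral_cong)
  ultimately show "(\<integral>\<^sup>+w. ennreal (ratio n w) \<partial>P) < \<infinity>"
    using nn_integral_initial_ratio by simp
qed (rule ratio_nonneg)

lemma set_integral_eqI:
  assumes A: "A \<in> sets P" and h: "integrable P h" "AE w in P. 0 \<le> h w" and k: "integrable P k" "AE w in P. 0 \<le> k w"
    and eq: "(\<integral>\<^sup>+w. ennreal (h w) * indicator A w \<partial>P) = (\<integral>\<^sup>+w. ennreal (k w) * indicator A w \<partial>P)"
  shows "(\<integral>w\<in>A. h w \<partial>P) = (\<integral>w\<in>A. k w \<partial>P)"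
proof -
  have "(\<integral>w\<in>A. f w \<partial>P) = enn2real (\<integral>\<^sup>+w. ennreal (f w) * indicator A w \<partial>P)"
    if f: "integrable P f" "AE w in P. 0 \<le> f w" for f :: "'w \<Rightarrow> real"
  proof -
    have [measurable]: "f \<in> borel_measurable P" "A \<in> sets P" using f A by auto
    have "(\<integral>w\<in>A. f w \<partial>P) = (\<integral>w. f w * indicator A w \<partial>P)"
      by (simp add: set_lebesgue_integral_def mult.commute)
    also have "\<dots> = enn2real (\<integral>\<^sup>+w. ennreal (f w * indicator A w) \<partial>P)"
    proof (rule integral_eq_nn_integral)
      show "AE w in P. 0 \<le> f w * indicator A w" using f(2) by eventually_elim simp
    qed measurable
    also have "(\<integral>\<^sup>+w. ennreal (f w * indicator A w) \<partial>P) = (\<integral>\<^sup>+w. ennreal (f w) * indicator A w \<partial>P)"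
      by (intro nn_integral_cong) (simp add: indicator_def)
    finally show ?thesis .
  qed
  then show ?thesis using h k eq by simp
qed

lemma cond_exp_given_signal: "AE w in P. real_cond_exp P (obs_signal n) initial_ratio w = ratio n w"
proof -
  interpret fms: finite_measure_subalgebra P "obs_signal n"
    by unfold_locales (rule obs_signal_subalgebra)
  show ?thesis
  proof (rule fms.real_cond_exp_charact)
    fix A assume A: "A \<in> sets (obs_signal n)"
    then have "A \<in> sets P" using obs_signal_subalgebra by (auto simp: subalgebra_def)
    then show "(\<integral>w\<in>A. initial_ratio w \<partial>P) = (\<integral>w\<in>A. ratio n w \<partial>P)"
      using initial_ratio_nonneg
      by (intro set_integral_eqI initial_ratio_integrable ratio_integrable ratio_nonneg
          nn_integral_ratio A) (auto intro!: AE_I2)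
  qed (rule initial_ratio_integrable ratio_integrable ratio_measurable)+
qed

lemma limit_ratio_integrable: "integrable P limit_ratio"
proof (rule integrable_const_bound)
  show "AE w in P. norm (limit_ratio w) \<le> upper_start"
    using limit_ratio_bounds by eventually_elim simp
  show "limit_ratio \<in> borel_measurable P"
    using measurable_from_subalg[OF obs_all_subalgebra limit_ratio_measurable] .
qed

text \<open>On an event observed by time \<open>k\<close>, the integral of the ratio at time \<open>n\<close> does not depend on
  \<open>n \<ge> k\<close>, and bounded convergence identifies it with that of the limit.\<close>

lemma nn_integral_limit_ratio_finite_time:
  assumes A: "A \<in> sets (obs k)"
  shows "(\<integral>\<^sup>+w. ennreal (initial_ratio w) * indicator A w \<partial>P) = (\<integral>\<^sup>+w. ennreal (limit_ratio w) * indicator A w \<partial>P)"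
proof -
  have AP [measurable]: "A \<in> sets P" using A obs_subalgebra by (auto simp: subalgebra_def)
  have [measurable]: "limit_ratio \<in> borel_measurable P" "ratio n \<in> borel_measurable P" for n
    using measurable_from_subalg[OF obs_all_subalgebra limit_ratio_measurable]
      measurable_from_subalg[OF obs_signal_subalgebra ratio_measurable] by auto
  let ?I = "\<integral>\<^sup>+w. ennreal (initial_ratio w) * indicator A w \<partial>P"
  have "(\<lambda>n. \<integral>\<^sup>+w. ennreal (ratio (Suc n) w) * indicator A w \<partial>P)
      \<longlonglongrightarrow> (\<integral>\<^sup>+w. ennreal (limit_ratio w) * indicator A w \<partial>P)"
  proof (rule nn_integral_dominated_convergence[where w="\<lambda>_. ennreal upper_start"])
    show "AE w in P. ennreal (ratio (Suc j) w) * indicator A w \<le> ennreal upper_start" for j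
      using ratio_between_bounds[of j] AE_regular_path
    proof eventually_elim
      case (elim w)
      have "decseq (\<lambda>n. bound upper_start n w)"
        by (intro decseq_SucI bound_properties(4)[OF elim(2)])
      from decseqD[OF this, of 0 j] have "bound upper_start j w \<le> bound upper_start 0 w" by simp
      then have "ratio (Suc j) w \<le> upper_start" using elim(1) by (simp add: bound_def)
      then show ?case by (auto simp: indicator_def ennreal_leI)
    qed
    show "(\<integral>\<^sup>+w. ennreal upper_start \<partial>P) < \<infinity>" by (simp add: emeasure_space_1)
    show "AE w in P. (\<lambda>n. ennreal (ratio (Suc n) w) * indicator A w) \<longlonglongrightarrow> ennreal (limit_ratio w) * indicator A w"
      using ratio_tendsto
    proof eventually_elim
      case (elim w)
      then have "(\<lambda>n. ennreal (ratio (Suc n) w)) \<longlonglongrightarrow> ennreal (limit_ratio w)"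
        by (intro tendsto_ennrealI LIMSEQ_Suc)
      then show ?case by (cases "w \<in> A") auto
    qed
  qed measurable
  moreover have "eventually (\<lambda>n. (\<integral>\<^sup>+w. ennreal (ratio (Suc n) w) * indicator A w \<partial>P) = ?I) sequentially"
    using eventually_ge_at_top[of k]
  proof eventually_elim
    case (elim n)
    then have "A \<in> sets (obs_signal (Suc n))" using A obs_le[of k "Suc n"] obs_le_signal by auto
    then show ?case by (rule nn_integral_ratio[symmetric])
  qed
  then have "(\<lambda>n. \<integral>\<^sup>+w. ennreal (ratio (Suc n) w) * indicator A w \<partial>P) \<longlonglongrightarrow> ?I"
    by (rule tendsto_eventually)
  ultimately show ?thesis by (rule LIMSEQ_unique[rotated])
qed

lemma nn_integral_limit_ratio:
  assumes A: "A \<in> sets obs_all"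
  shows "(\<integral>\<^sup>+w. ennreal (initial_ratio w) * indicator A w \<partial>P) = (\<integral>\<^sup>+w. ennreal (limit_ratio w) * indicator A w \<partial>P)"
proof -
  have [measurable]: "limit_ratio \<in> borel_measurable P"
    using measurable_from_subalg[OF obs_all_subalgebra limit_ratio_measurable] .
  have idm: "(\<lambda>w. w) \<in> measurable P obs_all"
    using obs_all_subalgebra by (intro measurable_ident_mono) (auto simp: subalgebra_def)
  define N where "N h = distr (density P (\<lambda>w. ennreal (h w))) obs_all (\<lambda>w. w)" for h :: "'w \<Rightarrow> real"
  have N: "emeasure (N h) B = (\<integral>\<^sup>+w. ennreal (h w) * indicator B w \<partial>P)"
    if h [measurable]: "h \<in> borel_measurable P" and B: "B \<in> sets obs_all" for h B
  proof -
    have BP: "B \<in> sets P" using B obs_all_subalgebra by (auto simp: subalgebra_def)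
    have "emeasure (N h) B = emeasure (density P (\<lambda>w. ennreal (h w))) B"
      unfolding N_def using idm B sets.sets_into_space[OF BP]
      by (subst emeasure_distr) (auto simp: Int_absorb2)
    also have "\<dots> = (\<integral>\<^sup>+w. ennreal (h w) * indicator B w \<partial>P)"
      using BP by (intro emeasure_density) measurable
    finally show ?thesis .
  qed
  have "N initial_ratio = N limit_ratio"
  proof (rule measure_eqI_generator_eq[where \<Omega>="space P" and A="\<lambda>_. space P"])
    show "Int_stable (\<Union>n. sets (obs n))"
    proof (rule Int_stableI)
      fix a c assume "a \<in> (\<Union>n. sets (obs n))" "c \<in> (\<Union>n. sets (obs n))"
      then obtain i j where "a \<in> sets (obs i)" "c \<in> sets (obs j)" by blast
      then have "a \<in> sets (obs (max i j))" "c \<in> sets (obs (max i j))"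
        using obs_le[of i "max i j"] obs_le[of j "max i j"] by auto
      then show "a \<inter> c \<in> (\<Union>n. sets (obs n))" by blast
    qed
    show "(\<Union>n. sets (obs n)) \<subseteq> Pow (space P)" using sets.space_closed[of "obs _"] by auto
    show "sets (N initial_ratio) = sigma_sets (space P) (\<Union>n. sets (obs n))"
      "sets (N limit_ratio) = sigma_sets (space P) (\<Union>n. sets (obs n))"
      by (simp_all add: N_def obs_all_generated)
    show "range (\<lambda>_::nat. space P) \<subseteq> (\<Union>n. sets (obs n))"
      using sets.top[of "obs 0"] by auto
    have "space P \<in> sets obs_all" using sets.top[of obs_all] by simp
    then have "emeasure (N initial_ratio) (space P) \<le> (\<integral>\<^sup>+w. ennreal (initial_ratio w) \<partial>P)"
      by (subst N) (auto intro!: nn_integral_mono simp: indicator_def)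
    then show "emeasure (N initial_ratio) (space P) \<noteq> \<infinity>" for i :: nat
      using nn_integral_initial_ratio by (auto simp: top_unique)
    fix B assume "B \<in> (\<Union>n. sets (obs n))"
    then obtain k where B: "B \<in> sets (obs k)" by blast
    then have "B \<in> sets obs_all" using obs_le_all by blast
    then show "emeasure (N initial_ratio) B = emeasure (N limit_ratio) B"
      using nn_integral_limit_ratio_finite_time[OF B] by (simp add: N)
  qed simp
  then show ?thesis using N[of initial_ratio A] N[of limit_ratio A] A by simp
qed

lemma cond_exp_given_observations: "AE w in P. real_cond_exp P obs_all initial_ratio w = limit_ratio w"
proof -
  interpret fms: finite_measure_subalgebra P obs_all
    by unfold_locales (rule obs_all_subalgebra)
  show ?thesis
  proof (rule fms.real_cond_exp_charact)
    fix A assume A: "A \<in> sets obs_all"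
    then have AP: "A \<in> sets P" using obs_all_subalgebra by (auto simp: subalgebra_def)
    have l: "AE w in P. 0 \<le> limit_ratio w" using limit_ratio_bounds by eventually_elim simp
    have i: "AE w in P. 0 \<le> initial_ratio w" using initial_ratio_nonneg by (rule AE_I2)
    show "(\<integral>w\<in>A. initial_ratio w \<partial>P) = (\<integral>w\<in>A. limit_ratio w \<partial>P)"
      by (rule set_integral_eqI[OF AP initial_ratio_integrable i limit_ratio_integrable l
            nn_integral_limit_ratio[OF A]])
  qed (rule initial_ratio_integrable limit_ratio_integrable limit_ratio_measurable)+
qed

theorem cond_exps_merge:
  "AE w in P. (\<lambda>n. real_cond_exp P (sigma_XY P psi theta X Y {n} {1..n}) (\<lambda>w. eta (X 0 w) / mu (X 0 w)) w)
    \<longlonglongrightarrow> real_cond_exp P (sigma_XY P psi theta X Y {} {1..}) (\<lambda>w. eta (X 0 w) / mu (X 0 w)) w"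
proof -
  have "AE w in P. \<forall>n. real_cond_exp P (obs_signal n) initial_ratio w = ratio n w"
    unfolding AE_all_countable using cond_exp_given_signal by blast
  then have "AE w in P. (\<lambda>n. real_cond_exp P (obs_signal n) initial_ratio w)
      \<longlonglongrightarrow> real_cond_exp P obs_all initial_ratio w"
    using cond_exp_given_observations ratio_tendsto by eventually_elim simp
  then show ?thesis unfolding obs_signal_def obs_all_def initial_ratio_def[abs_def] .
qed

end

end

section \<open>Stability of the nonlinear filter\<close>

lemma essinf_AE: "AE y in R. essinf R f \<le> f y"
  using esssup_AE[of "\<lambda>x. - f x" R]
  by eventually_elim (simp add: essinf_def ereal_uminus_le_reorder)

lemma essinf_nonneg:
  assumes "f \<in> borel_measurable R" "\<And>x. x \<in> space R \<Longrightarrow> 0 \<le> f x"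
  shows "0 \<le> essinf R f"
proof -
  have "esssup R (\<lambda>x. - f x) \<le> 0"
    using assms by (intro esssup_I) (auto intro!: AE_I2)
  then show ?thesis by (simp add: essinf_def ereal_0_le_uminus_iff)
qed

text \<open>The minorant is the essential infimum of the transition density where \<open>m\<close> is positive, and
  \<open>0\<close> elsewhere. It is measurable because it is the quotient of the product with \<open>m\<close>, which is
  integrable since its integral is not zero, by \<open>m\<close>.\<close>

lemma stationary_kernel_of_densities:
  assumes fin: "finite_measure psi" and lam: "kernel_density psi psi lam"
    and lam_le: "\<And>x y. x \<in> space psi \<Longrightarrow> y \<in> space psi \<Longrightarrow> lam x y \<le> L"
    and m: "prob_density psi m"
    and inv: "invariant_measure (density_kernel psi lam) (density psi (\<lambda>x. ennreal (m x)))"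
    and pos: "0 < lam_diamond psi lam m"
  obtains b where "stationary_kernel psi lam L b m" "(\<integral>x. b x * m x \<partial>psi) = lam_diamond psi lam m"
proof -
  interpret finite_measure psi by (rule fin)
  define a where "a x = real_of_ereal (essinf psi (\<lambda>y. ereal (lam x y)))" for x
  define b where "b x = a x * m x / m x" for x
  have lam_meas: "case_prod lam \<in> borel_measurable (psi \<Otimes>\<^sub>M psi)"
    and lam_nn: "\<And>x y. x \<in> space psi \<Longrightarrow> y \<in> space psi \<Longrightarrow> 0 \<le> lam x y"
    using lam by (auto simp: kernel_density_def prob_density_def)
  have sect: "(\<lambda>y. ereal (lam x y)) \<in> borel_measurable psi" if "x \<in> space psi" for x
    using measurable_Pair2[OF lam_meas that] by simp
  have am: "integrable psi (\<lambda>x. a x * m x)"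
    using pos not_integrable_integral_eq unfolding lam_diamond_def a_def by fastforce
  have ess_nn: "0 \<le> essinf psi (\<lambda>y. ereal (lam x y))" if "x \<in> space psi" for x
    using lam_nn[OF that] by (intro essinf_nonneg sect that) auto
  have a_nn: "0 \<le> a x" if "x \<in> space psi" for x
    unfolding a_def using ess_nn[OF that] by (rule real_of_ereal_pos)
  have a_le: "AE y in psi. a x \<le> lam x y" if x: "x \<in> space psi" for x
    using essinf_AE[of psi "\<lambda>y. ereal (lam x y)"]
  proof eventually_elim
    case (elim y)
    then show ?case using ess_nn[OF x] unfolding a_def
      by (cases "essinf psi (\<lambda>y. ereal (lam x y))") auto
  qed
  have bm: "b x * m x = a x * m x" for x by (simp add: b_def)
  have "stationary_kernel psi lam L b m"
  proof unfold_locales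
    show "b \<in> borel_measurable psi"
      unfolding b_def[abs_def] using am m by (intro borel_measurable_divide) (auto simp: prob_density_def)
    show "0 \<le> b x" if "x \<in> space psi" for x
      using a_nn[OF that] by (simp add: b_def)
    show "AE y in psi. b x \<le> lam x y" if "x \<in> space psi" for x
      using a_le[OF that] AE_space by eventually_elim (use lam_nn[OF that] in \<open>auto simp: b_def\<close>)
    show "space psi \<noteq> {}"
      using m by (auto simp: prob_density_def nn_integral_empty)
    show "0 < (\<integral>x. b x * m x \<partial>psi)" using pos by (simp add: bm lam_diamond_def a_def)
  qed (use assms in auto)
  moreover have "(\<integral>x. b x * m x \<partial>psi) = lam_diamond psi lam m" by (simp add: bm lam_diamond_def a_def)
  ultimately show ?thesis by (rule that)
qed

lemma finite_measure_of_density_bound: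
  assumes "prob_density psi beta" "0 < c" "\<And>x. x \<in> space psi \<Longrightarrow> c \<le> beta x"
  shows "finite_measure psi"
proof
  have "ennreal c * emeasure psi (space psi) = (\<integral>\<^sup>+x. ennreal c \<partial>psi)" by simp
  also have "\<dots> \<le> (\<integral>\<^sup>+x. ennreal (beta x) \<partial>psi)"
    using assms(3) by (intro nn_integral_mono ennreal_leI)
  also have "\<dots> = 1" using assms(1) by (simp add: prob_density_def)
  finally show "emeasure psi (space psi) \<noteq> \<infinity>"
    using assms(2) by (auto simp: ennreal_mult_top top_unique)
qed

theorem theorem1p1:
  fixes S :: "'a::euclidean_space set"
    and psi :: "'a measure"
    and theta :: "'b::euclidean_space measure"
    and lam :: "'a \<Rightarrow> 'a \<Rightarrow> real"
    and gam :: "'a \<Rightarrow> 'b \<Rightarrow> real"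
    and m nu beta :: "'a \<Rightarrow> real"
    and lam_star beta_star :: real
  assumes psi: "sets psi = sets (restrict_space borel S)" "sigma_finite_measure psi"
    and theta: "sets theta = sets borel" "sigma_finite_measure theta"
    and lam: "kernel_density psi psi lam"
    and gam: "kernel_density psi theta gam"
    and m: "prob_density psi m"
    and ergodic: "ergodic_measure (density_kernel psi lam) (density psi (\<lambda>x. ennreal (m x)))"
    and lam_star: "\<And>x y. x \<in> S \<Longrightarrow> y \<in> S \<Longrightarrow> lam x y \<le> lam_star"
    and diamond_pos: "0 < lam_diamond psi lam m"
    and nu: "prob_density psi nu"
    and beta: "prob_density psi beta"
    and beta_star: "0 < beta_star" "\<And>x. x \<in> S \<Longrightarrow> beta_star \<le> beta x"
  shows
    "(\<forall>(P :: 'w measure) X Y.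
        hidden_markov psi theta (density_kernel psi lam) (density_kernel theta gam) beta P X Y \<longrightarrow>
        (AE w in P.
          (\<lambda>n. real_cond_exp P (sigma_XY P psi theta X Y {n} {1..n})
                 (\<lambda>w. nu (X 0 w) / beta (X 0 w)) w)
          \<longlonglongrightarrow> real_cond_exp P (sigma_XY P psi theta X Y {} {1..})
                 (\<lambda>w. nu (X 0 w) / beta (X 0 w)) w))
     \<and>
     (\<forall>(P :: 'w measure) X Y pi_nu.
        hidden_markov psi theta (density_kernel psi lam) (density_kernel theta gam) nu P X Y \<longrightarrow>
        filtering_density psi theta P X Y pi_nu \<longrightarrow>
        (AE w in P.
          limsup (\<lambda>n. ereal (1 / real n) *
            elog (L1_dist psi (filter_rec psi lam gam beta (\<lambda>k. Y k w) n) (pi_nu n w)))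
          \<le> ereal (- lam_diamond psi lam m / lam_star)))"
proof -
  have space: "space psi = S"
    using sets_eq_imp_space_eq[OF psi(1)] by (simp add: space_restrict_space)
  have fin: "finite_measure psi"
    using beta_star by (intro finite_measure_of_density_bound[OF beta beta_star(1)]) (simp add: space)
  have inv: "invariant_measure (density_kernel psi lam) (density psi (\<lambda>x. ennreal (m x)))"
    using ergodic by (simp add: ergodic_measure_def)
  obtain b where b: "stationary_kernel psi lam lam_star b m"
    and c: "(\<integral>x. b x * m x \<partial>psi) = lam_diamond psi lam m"
    by (rule stationary_kernel_of_densities[OF fin lam _ m inv diamond_pos]) (use lam_star in \<open>auto simp: space\<close>)
  \<comment> \<open>The model is used with either of the two densities as the true initial density.\<close>
  have model: "stationary_hidden_markov psi lam lam_star b theta gam P init X Y m"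
    if "hidden_markov psi theta (density_kernel psi lam) (density_kernel theta gam) init P X Y"
      "prob_density psi init" for P :: "'w measure" and X Y init
  proof -
    interpret stationary_kernel psi lam lam_star b m by (rule b)
    interpret P: prob_space P using that by (simp add: hidden_markov_def)
    interpret theta: sigma_finite_measure theta by (rule theta(2))
    show ?thesis by unfold_locales (rule gam that)+
  qed
  show ?thesis
  proof (intro conjI allI impI)
    fix P :: "'w measure" and X Y
    assume "hidden_markov psi theta (density_kernel psi lam) (density_kernel theta gam) beta P X Y"
    then interpret stationary_hidden_markov psi lam lam_star b theta gam P beta X Y m
      using model beta by blast
    show "AE w in P.
          (\<lambda>n. real_cond_exp P (sigma_XY P psi theta X Y {n} {1..n})
                 (\<lambda>w. nu (X 0 w) / beta (X 0 w)) w)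
          \<longlonglongrightarrow> real_cond_exp P (sigma_XY P psi theta X Y {} {1..})
                 (\<lambda>w. nu (X 0 w) / beta (X 0 w)) w"
      by (rule cond_exps_merge[OF nu beta_star(1)]) (simp add: beta_star(2) space)
  next
    fix P :: "'w measure" and X Y pi_nu
    assume "hidden_markov psi theta (density_kernel psi lam) (density_kernel theta gam) nu P X Y"
      and p: "filtering_density psi theta P X Y pi_nu"
    then interpret stationary_hidden_markov psi lam lam_star b theta gam P nu X Y m
      using model nu by blast
    have "0 < beta x" if "x \<in> space psi" for x
      using beta_star(1) beta_star(2)[of x] that by (simp add: space)
    from wrong_filter_forgets[OF beta this p]
    show "AE w in P.
          limsup (\<lambda>n. ereal (1 / real n) *
            elog (L1_dist psi (filter_rec psi lam gam beta (\<lambda>k. Y k w) n) (pi_nu n w)))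
          \<le> ereal (- lam_diamond psi lam m / lam_star)"
      by (simp add: c)
  qed
qed

end
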